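(* Let $a_1,a_2,b\in\mathbb{R}$ and assume that $\mathcal{F}_0$ is rich enough. Let $\mu$ be a (possibly degenerate) Gaussian law on $\mathbb{R}$, prescribed at time $T$ for the equation $$dY(t)=\left(a_1Y(t)+a_2\mathbb{E}[Y(t)]+b\,z(t)\right)dt+z(t)\,dW(t),\ t\in[0,T],\qquad \mathbb{P}_{Y(T)}=\mu.$$ Then, for every $s\in[0,T)$, the set $\mathcal{Y}^\mu(s)$ of backward reachable laws at time $s$ is $$\mathcal{Y}^\mu(s)=\left\{\mathcal{N}(y,\sigma):\ \sigma\in\left[0,e^{-2a_1(T-s)}\mathrm{Var}(\mu)\right],\ y\in\left[y_{\min}(\sigma),y_{\max}(\sigma)\right]\right\},$$ where $\mathrm{Var}(\mu)=\int_{\mathbb{R}}\left(r-\int_{\mathbb{R}}q\,\mu(dq)\right)^2\mu(dr)$ and $$y_{\min}(\sigma)=e^{-(a_1+a_2)(T-s)}\int_{\mathbb{R}}r\,\mu(dr)-|b|\sqrt{f(T-s)}\sqrt{e^{-2a_1(T-s)}\mathrm{Var}(\mu)-\sigma},$$ $$y_{\max}(\sigma)=e^{-(a_1+a_2)(T-s)}\int_{\mathbb{R}}r\,\mu(dr)+|b|\sqrt{f(T-s)}\sqrt{e^{-2a_1(T-s)}\mathrm{Var}(\mu)-\sigma},$$ with, for $t\in[0,T]$, $f(t)=\frac{1-e^{-2a_2t}}{2a_2}$ if $a_2\neq0$ and $f(t)=t$ if $a_2=0$.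
   Context: Let $T>0$ be fixed, $W$ a scalar standard Brownian motion on a probability space $(\Omega,\mathcal{F},\mathbb{P})$, and $\mathbb{F}=\{\mathcal{F}_t\}_{t\ge0}$ the augmented Brownian filtration enriched with an initial $\sigma$-field $\mathcal{F}_0$ independent of $W$. "$\mathcal{F}_0$ rich enough" means that $\mathcal{F}_0$ supports random variables of every law in the 2-Wasserstein space $\mathcal{P}_2(\mathbb{R})$. $\mathbb{P}_\xi$ denotes the law of $\xi$. $\mathcal{N}(y,\sigma)$ denotes the Gaussian law with mean $y$ and variance $\sigma\ge0$ (a Dirac mass at $y$ if $\sigma=0$), and $\mathcal{G}auss$ is the set of all such laws. A solution of the equation with terminal law $\mu$ is a couple $(Y,z)$ of a continuous $\mathbb{F}$-adapted real-valued process $Y$ and a deterministic Borel measurable $z:[0,T]\to\mathbb{R}$, square integrable on $[0,T]$, such that: 1) $\mathbb{P}_{Y(T)}=\mu$; 2) $Y(0)$ is $\mathcal{F}_0$-measurable with $\mathbb{P}_{Y(0)}\in\mathcal{G}auss$; 3) for all $t\in[0,T]$, $\mathbb{P}$-a.s., $Y(t)=Y(T)-\int_t^T\left(a_1Y(r)+a_2\mathbb{E}[Y(r)]+b\,z(r)\right)dr-\int_t^Tz(r)\,dW(r)$. The set of backward reachable laws at time $s$ is $\mathcal{Y}^\mu(s):=\{\mathbb{P}_{Y(s)}:\ (Y,z)\text{ is a solution with terminal law }\mu\}$. (In the paper $b=BD^*(DD^* )^{-1}$ is the scalar arising from row vectors $B,D$ with $D\ne0$.) *)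

theory Defs
  imports "HOL-Probability.Probability"
begin

section \<open>Gaussian laws and the Wasserstein space\<close>

text \<open>The second parameter is the variance, whereas \<^const>\<open>normal_density\<close> takes the
  standard deviation.\<close>

definition gaussian_law :: "real \<Rightarrow> real \<Rightarrow> real measure" where
  "gaussian_law y \<sigma> =
     (if \<sigma> = 0 then return borel y
      else density lborel (\<lambda>x. ennreal (normal_density y (sqrt \<sigma>) x)))"

definition Gauss :: "real measure set" where
  "Gauss = {gaussian_law y \<sigma> | y \<sigma>. 0 \<le> \<sigma>}"

definition Wasserstein2 :: "real measure set" where
  "Wasserstein2 = {\<nu>. prob_space \<nu> \<and> sets \<nu> = sets borel \<and> integrable \<nu> (\<lambda>x. x\<^sup>2)}"

definition law_mean :: "real measure \<Rightarrow> real" where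
  "law_mean \<mu> = (\<integral>r. r \<partial>\<mu>)"

definition law_var :: "real measure \<Rightarrow> real" where
  "law_var \<mu> = (\<integral>r. (r - (\<integral>q. q \<partial>\<mu>))\<^sup>2 \<partial>\<mu>)"


section \<open>Brownian motion, initial information and filtration\<close>

text \<open>Processes are functions of time and outcome; only times \<open>t \<ge> 0\<close> matter.\<close>

definition brownian_motion :: "'a measure \<Rightarrow> (real \<Rightarrow> 'a \<Rightarrow> real) \<Rightarrow> bool" where
  "brownian_motion M W \<longleftrightarrow>
     prob_space M \<and>
     (\<forall>t\<ge>0. W t \<in> borel_measurable M) \<and>
     (AE \<omega> in M. W 0 \<omega> = 0) \<and>
     (\<forall>s t. 0 \<le> s \<longrightarrow> s < t \<longrightarrow>
        distr M borel (\<lambda>\<omega>. W t \<omega> - W s \<omega>) = gaussian_law 0 (t - s)) \<and>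
     (\<forall>(\<tau> :: nat \<Rightarrow> real) n. 0 \<le> \<tau> 0 \<longrightarrow> mono \<tau> \<longrightarrow>
        prob_space.indep_vars M (\<lambda>_. borel)
          (\<lambda>i \<omega>. W (\<tau> (Suc i)) \<omega> - W (\<tau> i) \<omega>) {..<n}) \<and>
     (AE \<omega> in M. continuous_on {0..} (\<lambda>t. W t \<omega>))"

definition process_events ::
    "'a measure \<Rightarrow> (real \<Rightarrow> 'a \<Rightarrow> real) \<Rightarrow> real set \<Rightarrow> 'a set set" where
  "process_events M W I = (\<Union>r\<in>I. {W r -` B \<inter> space M | B. B \<in> sets borel})"

definition independent_of_process ::
    "'a measure \<Rightarrow> 'a measure \<Rightarrow> (real \<Rightarrow> 'a \<Rightarrow> real) \<Rightarrow> bool" where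
  "independent_of_process M F0 W \<longleftrightarrow>
     prob_space.indep_set M (sets F0) (sigma_sets (space M) (process_events M W {0..}))"

text \<open>The Brownian filtration, augmented by the null sets of \<open>M\<close> and enriched with the initial
  \<open>\<sigma>\<close>-field \<open>F0\<close>. Only its \<open>\<sigma>\<close>-fields are relevant, not the (trivial) measure
  carried by \<^const>\<open>sigma\<close>.\<close>

definition enriched_filtration ::
    "'a measure \<Rightarrow> 'a measure \<Rightarrow> (real \<Rightarrow> 'a \<Rightarrow> real) \<Rightarrow> real \<Rightarrow> 'a measure" where
  "enriched_filtration M F0 W t =
     sigma (space M) (sets F0 \<union> process_events M W {0..t} \<union> null_sets M)"

definition rich_enough :: "'a measure \<Rightarrow> 'a measure \<Rightarrow> bool" where
  "rich_enough M F0 \<longleftrightarrow>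
     (\<forall>\<nu>\<in>Wasserstein2. \<exists>\<xi>\<in>borel_measurable F0. distr M borel \<xi> = \<nu>)"


section \<open>Stochastic integral of a deterministic integrand\<close>

definition step_function :: "nat \<Rightarrow> (nat \<Rightarrow> real) \<Rightarrow> (nat \<Rightarrow> real) \<Rightarrow> real \<Rightarrow> real" where
  "step_function n \<tau> c r = (\<Sum>i<n. c i * indicator {\<tau> i<..\<tau> (Suc i)} r)"

definition step_integral ::
    "(real \<Rightarrow> 'a \<Rightarrow> real) \<Rightarrow> nat \<Rightarrow> (nat \<Rightarrow> real) \<Rightarrow> (nat \<Rightarrow> real) \<Rightarrow> 'a \<Rightarrow> real" where
  "step_integral W n \<tau> c \<omega> = (\<Sum>i<n. c i * (W (\<tau> (Suc i)) \<omega> - W (\<tau> i) \<omega>))"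

text \<open>\<open>J\<close> is a version of \<open>\<integral>\<^sub>u\<^sup>v z(r) dW(r)\<close>: the \<open>L\<^sup>2(M)\<close>-limit of the elementary integrals of
  step functions converging to \<open>z\<close> in \<open>L\<^sup>2([u,v])\<close>. By the Ito isometry \<open>J\<close> does not depend, up to
  null sets, on the approximating sequence. Squared \<open>L\<^sup>2\<close>-norms are nonnegative integrals, so that
  an infinite norm is not mistaken for zero.\<close>

definition is_stochastic_integral ::
    "'a measure \<Rightarrow> (real \<Rightarrow> 'a \<Rightarrow> real) \<Rightarrow> (real \<Rightarrow> real) \<Rightarrow> real \<Rightarrow> real \<Rightarrow> ('a \<Rightarrow> real) \<Rightarrow> bool"
where
  "is_stochastic_integral M W z u v J \<longleftrightarrow>
     J \<in> borel_measurable M \<and>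
     (\<exists>(n :: nat \<Rightarrow> nat) (\<tau> :: nat \<Rightarrow> nat \<Rightarrow> real) (c :: nat \<Rightarrow> nat \<Rightarrow> real).
        (\<forall>k. mono_on {..n k} (\<tau> k) \<and> \<tau> k ` {..n k} \<subseteq> {u..v}) \<and>
        (\<lambda>k. \<integral>\<^sup>+r\<in>{u..v}. ennreal ((step_function (n k) (\<tau> k) (c k) r - z r)\<^sup>2) \<partial>lborel)
          \<longlonglongrightarrow> 0 \<and>
        (\<lambda>k. \<integral>\<^sup>+\<omega>. ennreal ((step_integral W (n k) (\<tau> k) (c k) \<omega> - J \<omega>)\<^sup>2) \<partial>M)
          \<longlonglongrightarrow> 0)"


section \<open>Solutions with prescribed terminal law and backward reachable laws\<close>

text \<open>Integrability of \<open>Y r\<close> and of the drift make the expectation and the \<open>dr\<close>-integral in the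
  equation meaningful; Lebesgue integrals of non-integrable functions are \<open>0\<close> by convention.\<close>

definition mf_solution ::
    "'a measure \<Rightarrow> 'a measure \<Rightarrow> (real \<Rightarrow> 'a \<Rightarrow> real) \<Rightarrow> real \<Rightarrow> real \<Rightarrow> real \<Rightarrow> real \<Rightarrow>
     real measure \<Rightarrow> (real \<Rightarrow> 'a \<Rightarrow> real) \<Rightarrow> (real \<Rightarrow> real) \<Rightarrow> bool" where
  "mf_solution M F0 W T a1 a2 b \<mu> Y z \<longleftrightarrow>
     (\<forall>t\<in>{0..T}. Y t \<in> borel_measurable (enriched_filtration M F0 W t)) \<and>
     (AE \<omega> in M. continuous_on {0..T} (\<lambda>t. Y t \<omega>)) \<and>
     set_borel_measurable borel {0..T} z \<and>
     set_integrable lborel {0..T} (\<lambda>r. (z r)\<^sup>2) \<and>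
     distr M borel (Y T) = \<mu> \<and>
     Y 0 \<in> borel_measurable (enriched_filtration M F0 W 0) \<and>
     distr M borel (Y 0) \<in> Gauss \<and>
     (\<forall>r\<in>{0..T}. integrable M (Y r)) \<and>
     (AE \<omega> in M. set_integrable lborel {0..T}
        (\<lambda>r. a1 * Y r \<omega> + a2 * (\<integral>\<omega>'. Y r \<omega>' \<partial>M) + b * z r)) \<and>
     (\<forall>t\<in>{0..T}. \<exists>J. is_stochastic_integral M W z t T J \<and>
        (AE \<omega> in M. Y t \<omega> = Y T \<omega>
           - (LINT r:{t..T}|lborel. a1 * Y r \<omega> + a2 * (\<integral>\<omega>'. Y r \<omega>' \<partial>M) + b * z r)
           - J \<omega>))"

definition backward_reachable ::
    "'a measure \<Rightarrow> 'a measure \<Rightarrow> (real \<Rightarrow> 'a \<Rightarrow> real) \<Rightarrow> real \<Rightarrow> real \<Rightarrow> real \<Rightarrow> real \<Rightarrow>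
     real measure \<Rightarrow> real \<Rightarrow> real measure set" where
  "backward_reachable M F0 W T a1 a2 b \<mu> s =
     {distr M borel (Y s) | Y z. mf_solution M F0 W T a1 a2 b \<mu> Y z}"


section \<open>The bounds on the mean\<close>

definition f_coef :: "real \<Rightarrow> real \<Rightarrow> real" where
  "f_coef a2 t = (if a2 \<noteq> 0 then (1 - exp (- 2 * a2 * t)) / (2 * a2) else t)"

definition y_min ::
    "real \<Rightarrow> real \<Rightarrow> real \<Rightarrow> real \<Rightarrow> real measure \<Rightarrow> real \<Rightarrow> real \<Rightarrow> real" where
  "y_min T a1 a2 b \<mu> s \<sigma> =
     exp (- (a1 + a2) * (T - s)) * law_mean \<mu>
     - \<bar>b\<bar> * sqrt (f_coef a2 (T - s)) * sqrt (exp (- 2 * a1 * (T - s)) * law_var \<mu> - \<sigma>)"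

definition y_max ::
    "real \<Rightarrow> real \<Rightarrow> real \<Rightarrow> real \<Rightarrow> real measure \<Rightarrow> real \<Rightarrow> real \<Rightarrow> real" where
  "y_max T a1 a2 b \<mu> s \<sigma> =
     exp (- (a1 + a2) * (T - s)) * law_mean \<mu>
     + \<bar>b\<bar> * sqrt (f_coef a2 (T - s)) * sqrt (exp (- 2 * a1 * (T - s)) * law_var \<mu> - \<sigma>)"

end

theory Submission
  imports Defs
begin

text \<open>A deterministic volatility makes the law of \<open>Y(t)\<close> explicit: by variation of constants it is
  Gaussian, and for \<open>s < T\<close>
  \[ e^{-(a_1+a_2)(T-s)} E[Y(T)] = E[Y(s)] + b \int_s^T e^{(a_1+a_2)(s-r)} z(r) dr, \]
  \[ e^{-2a_1(T-s)} Var[Y(T)] = Var[Y(s)] + \int_s^T e^{2a_1(s-r)} z(r)^2 dr. \]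
  Cauchy--Schwarz, applied to \<open>exp (a\<^sub>2 (s - r))\<close> and \<open>exp (a\<^sub>1 (s - r)) z(r)\<close>, bounds the shift of the
  mean by the variance spent on \<open>[s, T]\<close>. Conversely, the volatilities \<open>\<plusminus> c exp ((a\<^sub>1 - a\<^sub>2) r)\<close> that
  change sign once attain every admissible pair.

  No stochastic calculus is needed: a path-wise Riemann--Stieltjes sum with exponential weights
  converges to the solution of the linear equation, while its law is that of a Wiener integral, so that
  characteristic functions pass to the limit.\<close>

section \<open>Gaussian laws\<close>

text \<open>The stochastic integral comes as one random variable \<open>J t\<close> per time t,
  fixed up to a null set that depends on t, so there is no integral process to which a product rule
  could be applied. The weighted sums use the equation only at countably many knots, where the noise
  agrees almost surely with a continuous function of time. The mean-field term is removed in two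
  stages: E[Y(r)] is first treated as a given forcing, which yields a Gaussian law, and the mean of
  that law then solves a deterministic linear equation of its own. As the initial value is random,
  characteristic functions are computed for the sum of a time-0 variable and a Wiener integral;
  independence is then used for finite sums only and survives in the limit as a product formula. For
  the converse the noise is switched off on [0, s]. The prescribed law at s is carried back to time
  0, where the rich initial \<sigma>-field realises it; the equation is solved forward with the
  terminal law left open, and mean and variance identify that law as \<mu> at the end.\<close>

lemma gaussian_law_eq_distr:
  assumes "0 \<le> \<sigma>"
  shows "gaussian_law y \<sigma> = distr std_normal_distribution borel (\<lambda>x. y + sqrt \<sigma> * x)"
proof (cases "\<sigma> = 0")
  case True
  then show ?thesis
    by (simp add: gaussian_law_def prob_space.distr_const[OF prob_space_normal_density])
next
  case False
  interpret prob_space std_normal_distribution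
    by (rule prob_space_normal_density) simp
  have "distributed std_normal_distribution lborel (\<lambda>x. x) std_normal_density"
    by (simp add: distributed_def distr_id2)
  from normal_density_affine[OF this, of "sqrt \<sigma>" y] False assms
  have "distributed std_normal_distribution lborel (\<lambda>x. y + sqrt \<sigma> * x) (normal_density y (sqrt \<sigma>))"
    by simp
  then have "distr std_normal_distribution lborel (\<lambda>x. y + sqrt \<sigma> * x) =
      density lborel (normal_density y (sqrt \<sigma>))"
    by (rule distributed_distr_eq_density)
  then show ?thesis
    using False by (simp add: gaussian_law_def cong: distr_cong)
qed

lemma sets_gaussian_law [simp, measurable_cong]: "sets (gaussian_law y \<sigma>) = sets borel"
  by (simp add: gaussian_law_def)

lemma space_gaussian_law [simp]: "space (gaussian_law y \<sigma>) = UNIV"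
  by (simp add: gaussian_law_def)

lemma real_distribution_gaussian_law:
  assumes "0 \<le> \<sigma>"
  shows "real_distribution (gaussian_law y \<sigma>)"
proof -
  interpret prob_space std_normal_distribution
    by (rule prob_space_normal_density) simp
  show ?thesis
    unfolding gaussian_law_eq_distr[OF assms] by (rule real_distribution_distr) simp
qed

text \<open>Here and for the other moments, pulling back to one standard normal variable treats the
  Dirac case together with the case of a density.\<close>

lemma integrable_gaussian_law_square:
  assumes "0 \<le> \<sigma>"
  shows "integrable (gaussian_law y \<sigma>) (\<lambda>x. x\<^sup>2)"
proof -
  have "integrable std_normal_distribution (\<lambda>x. y\<^sup>2 + 2 * y * sqrt \<sigma> * x ^ 1 + \<sigma> * x ^ 2)"
    by (intro Bochner_Integration.integrable_add integrable_mult_right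
        integrable_std_normal_distribution_moment
        finite_measure.integrable_const prob_space.finite_measure prob_space_normal_density) simp
  also have "(\<lambda>x::real. y\<^sup>2 + 2 * y * sqrt \<sigma> * x ^ 1 + \<sigma> * x ^ 2) = (\<lambda>x. (y + sqrt \<sigma> * x)\<^sup>2)"
    using assms by (simp add: power2_sum power_mult_distrib fun_eq_iff)
  finally show ?thesis
    unfolding gaussian_law_eq_distr[OF assms] by (simp add: integrable_distr_eq)
qed

lemma integrable_gaussian_law:
  assumes "0 \<le> \<sigma>"
  shows "integrable (gaussian_law y \<sigma>) (\<lambda>x. x)"
proof -
  have "integrable std_normal_distribution (\<lambda>x. y + sqrt \<sigma> * x ^ 1)"
    by (intro Bochner_Integration.integrable_add integrable_mult_right
        integrable_std_normal_distribution_moment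
        finite_measure.integrable_const prob_space.finite_measure prob_space_normal_density) simp
  then show ?thesis
    unfolding gaussian_law_eq_distr[OF assms] by (simp add: integrable_distr_eq)
qed

lemma law_mean_gaussian_law:
  assumes "0 \<le> \<sigma>"
  shows "law_mean (gaussian_law y \<sigma>) = y"
proof -
  interpret prob_space std_normal_distribution
    by (rule prob_space_normal_density) simp
  have *: "integrable std_normal_distribution (\<lambda>x. x)"
    using integrable_std_normal_distribution_moment[of 1] by simp
  have "(\<integral>x. x \<partial>std_normal_distribution) = 0"
    using integral_std_normal_distribution_moment_odd[of 1] by simp
  moreover have "(\<integral>x. y + sqrt \<sigma> * x \<partial>std_normal_distribution) =
      y + sqrt \<sigma> * (\<integral>x. x \<partial>std_normal_distribution)"
    using * prob_space by (subst Bochner_Integration.integral_add) simp_all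
  ultimately show ?thesis
    unfolding gaussian_law_eq_distr[OF assms] law_mean_def
    by (subst integral_distr) simp_all
qed

lemma law_var_gaussian_law:
  assumes "0 \<le> \<sigma>"
  shows "law_var (gaussian_law y \<sigma>) = \<sigma>"
proof -
  have "(\<integral>x. x\<^sup>2 \<partial>std_normal_distribution) = 1"
    using std_normal_distribution_even_moments[of 1] by simp
  then have "(\<integral>x. (x - y)\<^sup>2 \<partial>gaussian_law y \<sigma>) = \<sigma>"
    unfolding gaussian_law_eq_distr[OF assms]
    using assms by (simp add: integral_distr power_mult_distrib)
  then show ?thesis
    using law_mean_gaussian_law[OF assms, of y] by (simp add: law_var_def law_mean_def)
qed

lemma char_distr_affine:
  assumes [measurable]: "X \<in> borel_measurable M"
  shows "char (distr M borel (\<lambda>\<omega>. m + c * X \<omega>)) t = iexp (t * m) * char (distr M borel X) (t * c)"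
proof -
  have "char (distr M borel (\<lambda>\<omega>. m + c * X \<omega>)) t = (CLINT \<omega>|M. iexp (t * m) * iexp (t * c * X \<omega>))"
    by (simp add: char_def integral_distr algebra_simps exp_add)
  also have "\<dots> = iexp (t * m) * (CLINT \<omega>|M. iexp (t * c * X \<omega>))"
    by (rule integral_mult_right_zero)
  finally show ?thesis
    by (simp add: char_def integral_distr)
qed

lemma char_gaussian_law:
  assumes "0 \<le> \<sigma>"
  shows "char (gaussian_law y \<sigma>) t = iexp (t * y) * complex_of_real (exp (- \<sigma> * t\<^sup>2 / 2))"
proof -
  have "char (distr std_normal_distribution borel (\<lambda>x. x)) = char std_normal_distribution"
    by (subst distr_id2) simp_all
  then show ?thesis
    using assms unfolding gaussian_law_eq_distr[OF assms]
    by (simp add: char_distr_affine char_std_normal_distribution power_mult_distrib mult.commute[of "t\<^sup>2"])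
qed

text \<open>By Levy's uniqueness theorem. Laws are identified through characteristic functions
  throughout: they turn independent sums into products, pass to limits, and make \<sigma> = 0 no
  special case.\<close>

lemma (in prob_space) distr_eq_gaussian_lawI:
  assumes [measurable]: "X \<in> borel_measurable M" and "0 \<le> \<sigma>"
    and "\<And>t. char (distr M borel X) t = iexp (t * y) * complex_of_real (exp (- \<sigma> * t\<^sup>2 / 2))"
  shows "distr M borel X = gaussian_law y \<sigma>"
  by (rule Levy_uniqueness)
    (auto simp: assms real_distribution_gaussian_law char_gaussian_law real_distribution_distr)

lemma (in prob_space) distr_affine_gaussian_law:
  assumes [measurable]: "X \<in> borel_measurable M" and "0 \<le> \<sigma>"
    and "distr M borel X = gaussian_law y \<sigma>"
  shows "distr M borel (\<lambda>\<omega>. m + c * X \<omega>) = gaussian_law (m + c * y) (c\<^sup>2 * \<sigma>)"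
  using assms
  by (intro distr_eq_gaussian_lawI)
    (auto simp: char_distr_affine char_gaussian_law algebra_simps power_mult_distrib exp_add)

lemma gaussian_law_in_Wasserstein2:
  assumes "0 \<le> \<sigma>"
  shows "gaussian_law y \<sigma> \<in> Wasserstein2"
  using real_distribution_gaussian_law[OF assms, of y] integrable_gaussian_law_square[OF assms]
  by (simp add: Wasserstein2_def real_distribution_def)

section \<open>Square-integrable functions\<close>

lemma nn_integral_square_eq_integral:
  fixes f :: "'b \<Rightarrow> real"
  assumes "integrable N (\<lambda>x. (f x)\<^sup>2)"
  shows "(\<integral>\<^sup>+x. ennreal ((f x)\<^sup>2) \<partial>N) = ennreal (\<integral>x. (f x)\<^sup>2 \<partial>N)"
  using assms by (intro nn_integral_eq_integral) auto

lemma square_add_le: "(x + y)\<^sup>2 \<le> 2 * x\<^sup>2 + 2 * (y::real)\<^sup>2"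
  using sum_squares_bound[of x y] by (simp add: power2_sum)

text \<open>The quadratic A - 2 t C + t^2 B is the integral of (f - t g)^2, hence nonnegative for
  every t; its value at t = C / B is the claim.\<close>

lemma
  fixes f g :: "'b \<Rightarrow> real"
  assumes [measurable]: "f \<in> borel_measurable N" "g \<in> borel_measurable N"
    and f: "integrable N (\<lambda>x. (f x)\<^sup>2)" and g: "integrable N (\<lambda>x. (g x)\<^sup>2)"
  shows integrable_mult_squares: "integrable N (\<lambda>x. f x * g x)"
    and integral_Cauchy_Schwarz:
      "\<bar>\<integral>x. f x * g x \<partial>N\<bar> \<le> sqrt (\<integral>x. (f x)\<^sup>2 \<partial>N) * sqrt (\<integral>x. (g x)\<^sup>2 \<partial>N)"
proof -
  have "norm (f x * g x) \<le> norm ((f x)\<^sup>2 + (g x)\<^sup>2)" for x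
    using sum_squares_bound[of "\<bar>f x\<bar>" "\<bar>g x\<bar>"] mult_nonneg_nonneg[of "\<bar>f x\<bar>" "\<bar>g x\<bar>"]
    by (simp add: abs_mult del: mult_nonneg_nonneg)
  then show fg: "integrable N (\<lambda>x. f x * g x)"
    by (intro Bochner_Integration.integrable_bound[OF Bochner_Integration.integrable_add[OF f g]]) auto
  define A B C where "A = (\<integral>x. (f x)\<^sup>2 \<partial>N)" and "B = (\<integral>x. (g x)\<^sup>2 \<partial>N)"
    and "C = (\<integral>x. f x * g x \<partial>N)"
  have pos: "0 \<le> A" "0 \<le> B"
    by (simp_all add: A_def B_def)
  have quad: "0 \<le> A - 2 * t * C + t\<^sup>2 * B" for t
  proof -
    have "(\<integral>x. (f x)\<^sup>2 - 2 * t * (f x * g x) + t\<^sup>2 * (g x)\<^sup>2 \<partial>N) = A - 2 * t * C + t\<^sup>2 * B"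
      using f g fg by (simp add: A_def B_def C_def)
    moreover have "(f x)\<^sup>2 - 2 * t * (f x * g x) + t\<^sup>2 * (g x)\<^sup>2 = (f x - t * g x)\<^sup>2" for x
      by (simp add: power2_diff power_mult_distrib)
    ultimately have "A - 2 * t * C + t\<^sup>2 * B = (\<integral>x. (f x - t * g x)\<^sup>2 \<partial>N)"
      by (simp only:)
    then show ?thesis
      by simp
  qed
  have "C\<^sup>2 \<le> A * B"
  proof (cases "B = 0")
    case True
    \<comment> \<open>With B = 0 the quadratic is affine in t; were C nonzero, t = (A + 1) / (2 C)
      would give the value -1.\<close>
    then show ?thesis
      using quad[of "(A + 1) / (2 * C)"] by (cases "C = 0") auto
  next
    case False
    then show ?thesis
      using quad[of "C / B"] pos by (simp add: field_simps power2_eq_square)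
  qed
  then have "sqrt (C\<^sup>2) \<le> sqrt (A * B)"
    by (rule real_sqrt_le_mono)
  then show "\<bar>C\<bar> \<le> sqrt A * sqrt B"
    by (simp add: real_sqrt_mult)
qed

text \<open>Since the distances are nonnegative integrals, their convergence to 0 makes one of them
  finite, which puts g into L2. The norms converge because f_k^2 - g^2 = (f_k - g)^2 + 2 (f_k - g)
  g, where Cauchy-Schwarz controls the last term.\<close>

lemma
  fixes f :: "nat \<Rightarrow> 'b \<Rightarrow> real"
  assumes [measurable]: "\<And>k. f k \<in> borel_measurable N" "g \<in> borel_measurable N"
    and f: "\<And>k. integrable N (\<lambda>x. (f k x)\<^sup>2)"
    and lim: "(\<lambda>k. \<integral>\<^sup>+x. ennreal ((f k x - g x)\<^sup>2) \<partial>N) \<longlonglongrightarrow> 0"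
  shows square_integrable_L2_limit: "integrable N (\<lambda>x. (g x)\<^sup>2)"
    and tendsto_integral_square: "(\<lambda>k. \<integral>x. (f k x)\<^sup>2 \<partial>N) \<longlonglongrightarrow> (\<integral>x. (g x)\<^sup>2 \<partial>N)"
    and tendsto_L2_dist: "(\<lambda>k. \<integral>x. (f k x - g x)\<^sup>2 \<partial>N) \<longlonglongrightarrow> 0"
proof -
  define d where "d k = (\<integral>\<^sup>+x. ennreal ((f k x - g x)\<^sup>2) \<partial>N)" for k
  have "eventually (\<lambda>k. d k < 1) sequentially"
    using lim unfolding d_def by (rule order_tendstoD) simp
  then obtain k where "d k < 1"
    by (auto simp: eventually_sequentially)
  then have "integrable N (\<lambda>x. (f k x - g x)\<^sup>2)"
    by (intro integrableI_bounded) (auto simp: d_def less_top[symmetric] top_unique)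
  then have "integrable N (\<lambda>x. 2 * (f k x)\<^sup>2 + 2 * (f k x - g x)\<^sup>2)"
    using f by simp
  then show g: "integrable N (\<lambda>x. (g x)\<^sup>2)"
  proof (rule Bochner_Integration.integrable_bound)
    show "AE x in N. norm ((g x)\<^sup>2) \<le> norm (2 * (f k x)\<^sup>2 + 2 * (f k x - g x)\<^sup>2)"
      using square_add_le[of "f k x" "g x - f k x" for x]
      by (intro AE_I2) (simp add: power2_commute)
  qed simp
  have fg: "integrable N (\<lambda>x. (f k x - g x)\<^sup>2)" for k
  proof -
    have "integrable N (\<lambda>x. 2 * (f k x)\<^sup>2 + 2 * (g x)\<^sup>2)"
      using f g by simp
    then show ?thesis
      by (rule Bochner_Integration.integrable_bound)
        (use square_add_le[of "f k x" "- g x" for x] in auto)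
  qed
  define D where "D k = (\<integral>x. (f k x - g x)\<^sup>2 \<partial>N)" for k
  have "(\<lambda>k. ennreal (D k)) \<longlonglongrightarrow> ennreal 0"
    using lim by (simp add: D_def nn_integral_square_eq_integral[OF fg])
  then show D: "D \<longlonglongrightarrow> 0"
    by (subst (asm) tendsto_ennreal_iff) (auto simp: D_def)
  have bound: "\<bar>(\<integral>x. (f k x)\<^sup>2 \<partial>N) - (\<integral>x. (g x)\<^sup>2 \<partial>N)\<bar> \<le> D k + 2 * (sqrt (D k) * sqrt (\<integral>x. (g x)\<^sup>2 \<partial>N))" for k
  proof -
    have m: "integrable N (\<lambda>x. (f k x - g x) * g x)"
      by (rule integrable_mult_squares) (use fg g in auto)
    have "(\<integral>x. (f k x)\<^sup>2 \<partial>N) = (\<integral>x. (f k x - g x)\<^sup>2 + 2 * ((f k x - g x) * g x) + (g x)\<^sup>2 \<partial>N)"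
      by (simp add: power2_eq_square algebra_simps)
    also have "\<dots> = D k + 2 * (\<integral>x. (f k x - g x) * g x \<partial>N) + (\<integral>x. (g x)\<^sup>2 \<partial>N)"
      using fg g m by (simp add: D_def)
    finally have eq: "(\<integral>x. (f k x)\<^sup>2 \<partial>N) - (\<integral>x. (g x)\<^sup>2 \<partial>N) = D k + 2 * (\<integral>x. (f k x - g x) * g x \<partial>N)"
      by simp
    have "0 \<le> D k"
      by (simp add: D_def)
    moreover have "\<bar>\<integral>x. (f k x - g x) * g x \<partial>N\<bar> \<le> sqrt (D k) * sqrt (\<integral>x. (g x)\<^sup>2 \<partial>N)"
      unfolding D_def by (rule integral_Cauchy_Schwarz) (use fg g in auto)
    ultimately show ?thesis
      unfolding eq by linarith
  qed
  have "(\<lambda>k. D k + 2 * (sqrt (D k) * sqrt (\<integral>x. (g x)\<^sup>2 \<partial>N))) \<longlonglongrightarrow>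
      0 + 2 * (sqrt 0 * sqrt (\<integral>x. (g x)\<^sup>2 \<partial>N))"
    by (intro tendsto_intros D)
  then have lim0: "(\<lambda>k. D k + 2 * (sqrt (D k) * sqrt (\<integral>x. (g x)\<^sup>2 \<partial>N))) \<longlonglongrightarrow> 0"
    by (simp only: real_sqrt_zero mult_zero_left mult_zero_right add_0_left)
  have "(\<lambda>k. (\<integral>x. (f k x)\<^sup>2 \<partial>N) - (\<integral>x. (g x)\<^sup>2 \<partial>N)) \<longlonglongrightarrow> 0"
    by (rule Lim_null_comparison[OF _ lim0]) (simp only: real_norm_def bound eventually_True)
  then show "(\<lambda>k. \<integral>x. (f k x)\<^sup>2 \<partial>N) \<longlonglongrightarrow> (\<integral>x. (g x)\<^sup>2 \<partial>N)"
    by (rule LIM_zero_cancel)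
qed

lemma L2_dominated_convergence:
  fixes f :: "nat \<Rightarrow> 'b \<Rightarrow> real"
  assumes [measurable]: "\<And>k. f k \<in> borel_measurable N" "g \<in> borel_measurable N"
    "w \<in> borel_measurable N"
    and w: "integrable N (\<lambda>x. (w x)\<^sup>2)"
    and bound: "\<And>k. AE x in N. \<bar>f k x\<bar> \<le> w x"
    and lim: "AE x in N. (\<lambda>k. f k x) \<longlonglongrightarrow> g x"
  shows "(\<lambda>k. \<integral>\<^sup>+x. ennreal ((f k x - g x)\<^sup>2) \<partial>N) \<longlonglongrightarrow> 0"
proof -
  have all: "AE x in N. \<forall>k. \<bar>f k x\<bar> \<le> w x"
    using bound by (simp add: AE_all_countable)
  have "(\<lambda>k. \<integral>\<^sup>+x. ennreal ((f k x - g x)\<^sup>2) \<partial>N) \<longlonglongrightarrow> (\<integral>\<^sup>+x. 0 \<partial>N)"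
  proof (rule nn_integral_dominated_convergence)
    \<comment> \<open>The limit inherits the bound w, so the difference is bounded by 2 w.\<close>
    show "AE x in N. ennreal ((f k x - g x)\<^sup>2) \<le> ennreal ((2 * w x)\<^sup>2)" for k
      using all lim
    proof eventually_elim
      case (elim x)
      then have "\<bar>g x\<bar> \<le> w x"
        by (intro LIMSEQ_le_const2[of "\<lambda>k. \<bar>f k x\<bar>"] tendsto_rabs) auto
      then have "\<bar>f k x - g x\<bar> \<le> \<bar>2 * w x\<bar>"
        using elim(1)[rule_format, of k] by linarith
      then show ?case
        by (intro ennreal_leI) (simp add: abs_le_square_iff)
    qed
    have "integrable N (\<lambda>x. (2 * w x)\<^sup>2)"
      using w by (simp add: power_mult_distrib)
    then show "(\<integral>\<^sup>+x. ennreal ((2 * w x)\<^sup>2) \<partial>N) < \<infinity>"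
      by (simp only: nn_integral_square_eq_integral) simp
    show "AE x in N. (\<lambda>k. ennreal ((f k x - g x)\<^sup>2)) \<longlonglongrightarrow> 0"
      using lim
    proof eventually_elim
      case (elim x)
      then have "(\<lambda>k. ennreal ((f k x - g x)\<^sup>2)) \<longlonglongrightarrow> ennreal ((g x - g x)\<^sup>2)"
        by (intro tendsto_intros)
      then show ?case by simp
    qed
  qed simp_all
  then show ?thesis by simp
qed

section \<open>Increment sums\<close>

text \<open>A triple \<open>(c, p, q)\<close> stands for the step \<open>c\<close> on \<open>{p<..q}\<close>. Evaluating the same list on a path
  and on \<open>\<lambda>t. of_bool (r \<le> t)\<close> gives the elementary stochastic integral and the integrand at \<open>r\<close>.\<close>

definition increment_sum :: "(real \<times> real \<times> real) list \<Rightarrow> (real \<Rightarrow> real) \<Rightarrow> real" where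
  "increment_sum l F = (\<Sum>(c, p, q)\<leftarrow>l. c * (F q - F p))"

definition step_fun :: "(real \<times> real \<times> real) list \<Rightarrow> real \<Rightarrow> real" where
  "step_fun l r = increment_sum l (\<lambda>t. of_bool (r \<le> t))"

definition steps_in :: "real \<Rightarrow> real \<Rightarrow> (real \<times> real \<times> real) list \<Rightarrow> bool" where
  "steps_in u v l \<longleftrightarrow> (\<forall>(c, p, q)\<in>set l. u \<le> p \<and> p \<le> q \<and> q \<le> v)"

definition scale_steps :: "real \<Rightarrow> (real \<times> real \<times> real) list \<Rightarrow> (real \<times> real \<times> real) list" where
  "scale_steps a l = map (\<lambda>(c, p, q). (a * c, p, q)) l"

definition partition_steps :: "nat \<Rightarrow> (nat \<Rightarrow> real) \<Rightarrow> (nat \<Rightarrow> real) \<Rightarrow> (real \<times> real \<times> real) list" where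
  "partition_steps n \<tau> c = map (\<lambda>i. (c i, \<tau> i, \<tau> (Suc i))) [0..<n]"

lemma increment_sum_Nil [simp]: "increment_sum [] F = 0"
  and increment_sum_Cons: "increment_sum ((c, p, q) # l) F = c * (F q - F p) + increment_sum l F"
  and increment_sum_append: "increment_sum (l @ l') F = increment_sum l F + increment_sum l' F"
  by (simp_all add: increment_sum_def)

lemma increment_sum_scale: "increment_sum (scale_steps a l) F = a * increment_sum l F"
  by (induction l) (auto simp: scale_steps_def increment_sum_def algebra_simps)

lemma increment_sum_partition:
  "increment_sum (partition_steps n \<tau> c) F = (\<Sum>i<n. c i * (F (\<tau> (Suc i)) - F (\<tau> i)))"
  by (simp add: increment_sum_def partition_steps_def comp_def interv_sum_list_conv_sum_set_nat
      atLeast0LessThan)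

lemma increment_sum_linear:
  "increment_sum l (\<lambda>t. a * F t + b * G t) = a * increment_sum l F + b * increment_sum l G"
  by (induction l) (auto simp: increment_sum_def algebra_simps)

lemma step_fun_append: "step_fun (l @ l') r = step_fun l r + step_fun l' r"
  and step_fun_scale: "step_fun (scale_steps a l) r = a * step_fun l r"
  by (simp_all add: step_fun_def increment_sum_append increment_sum_scale)

lemma steps_in_append [simp]: "steps_in u v (l @ l') \<longleftrightarrow> steps_in u v l \<and> steps_in u v l'"
  by (simp add: steps_in_def ball_Un)

lemma steps_in_scale [simp]: "steps_in u v (scale_steps a l) \<longleftrightarrow> steps_in u v l"
  by (simp add: steps_in_def scale_steps_def split_beta)

lemma steps_in_mono: "steps_in u v l \<Longrightarrow> u' \<le> u \<Longrightarrow> v \<le> v' \<Longrightarrow> steps_in u' v' l"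
  unfolding steps_in_def split_beta by (meson order_trans)

lemma steps_in_partition:
  assumes "mono_on {..n} \<tau>" and "\<tau> ` {..n} \<subseteq> {u..v}"
  shows "steps_in u v (partition_steps n \<tau> c)"
proof -
  have "u \<le> \<tau> i \<and> \<tau> i \<le> \<tau> (Suc i) \<and> \<tau> (Suc i) \<le> v" if "i < n" for i
    using that assms(2) mono_onD[OF assms(1), of i "Suc i"] by (auto simp: image_subset_iff)
  then show ?thesis
    by (simp add: steps_in_def partition_steps_def)
qed

lemma borel_measurable_step_fun [measurable]: "step_fun l \<in> borel_measurable borel"
proof (induction l)
  case Nil
  then show ?case by (simp add: step_fun_def[abs_def])
next
  case (Cons a l)
  obtain c p q where a: "a = (c, p, q)" by (cases a)
  have "step_fun (a # l) = (\<lambda>r. c * (indicator {..q} r - indicator {..p} r) + step_fun l r)"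
    by (auto simp: a step_fun_def increment_sum_Cons fun_eq_iff indicator_def)
  with Cons show ?case by simp
qed

lemma step_fun_outside:
  assumes "steps_in u v l" and "r \<notin> {u<..v}"
  shows "step_fun l r = 0"
  using assms by (induction l) (auto simp: step_fun_def increment_sum_def steps_in_def of_bool_def)

lemma step_function_eq_step_fun:
  assumes "mono_on {..n} \<tau>"
  shows "step_function n \<tau> c r = step_fun (partition_steps n \<tau> c) r"
proof -
  have "indicator {\<tau> i<..\<tau> (Suc i)} r = of_bool (r \<le> \<tau> (Suc i)) - (of_bool (r \<le> \<tau> i) :: real)"
    if "i < n" for i
    using that mono_onD[OF assms, of i "Suc i"] by (auto simp: indicator_def)
  then show ?thesis
    by (simp add: step_function_def step_fun_def increment_sum_partition)
qed

lemma step_integral_eq_increment_sum: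
  "step_integral W n \<tau> c \<omega> = increment_sum (partition_steps n \<tau> c) (\<lambda>t. W t \<omega>)"
  by (simp add: step_integral_def increment_sum_partition)

text \<open>Listed steps may overlap, whereas independence of increments and orthogonality of
  indicators concern disjoint cells. All end points together form one common grid, and every step
  splits into cells of it.\<close>

lemma steps_in_imp_partition:
  assumes l: "steps_in u v l" and "u \<le> v"
  obtains n \<tau> c where "mono \<tau>" "range \<tau> \<subseteq> {u..v}"
    "\<And>F. increment_sum l F = increment_sum (partition_steps n \<tau> c) F"
proof -
  define A where "A = insert u ((\<lambda>(c, p, q). p) ` set l \<union> (\<lambda>(c, p, q). q) ` set l)"
  define xs where "xs = sorted_list_of_set A"
  define n where "n = length xs - 1"
  \<comment> \<open>Freezing the index at n makes the grid monotone on all natural numbers, the form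
    in which independence of Brownian increments is postulated. The point u in \<open>A\<close>
    keeps the grid nonempty for the empty list.\<close>
  define \<tau> where "\<tau> i = xs ! min i n" for i
  have A: "finite A" "A \<noteq> {}" "A \<subseteq> {u..v}"
    using l \<open>u \<le> v\<close> by (fastforce simp: A_def steps_in_def)+
  then have xs: "set xs = A" "sorted_wrt (<) xs" "xs \<noteq> []"
    by (auto simp: xs_def)
  then have len: "length xs = Suc n"
    by (simp add: n_def)
  have less: "\<tau> i < \<tau> j" if "i < j" "j \<le> n" for i j
    using that len xs(2) by (auto simp: \<tau>_def sorted_wrt_iff_nth_less)
  have mono: "mono \<tau>"
  proof (rule monoI)
    fix i j :: nat assume "i \<le> j"
    then consider "min i n = min j n" | "min i n < min j n"
      by linarith
    then have "\<tau> (min i n) \<le> \<tau> (min j n)"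
    proof cases
      case 1
      then show ?thesis by simp
    next
      case 2
      then show ?thesis
        using less[of "min i n" "min j n"] by simp
    qed
    then show "\<tau> i \<le> \<tau> j"
      by (simp add: \<tau>_def)
  qed
  have range: "range \<tau> \<subseteq> {u..v}"
    using A(3) xs(1) len by (auto simp: \<tau>_def)
  have index: "\<exists>j\<le>n. x = \<tau> j" if "x \<in> A" for x
  proof -
    obtain j where "j < length xs" "xs ! j = x"
      using \<open>x \<in> A\<close> unfolding xs(1)[symmetric] in_set_conv_nth by blast
    then show ?thesis
      by (intro exI[of _ j]) (simp add: \<tau>_def len min_absorb1)
  qed
  have step: "F q - F p = (\<Sum>i<n. of_bool (p \<le> \<tau> i \<and> \<tau> i < q) * (F (\<tau> (Suc i)) - F (\<tau> i)))"
    if "p \<in> A" "q \<in> A" "p \<le> q" for p q and F :: "real \<Rightarrow> real"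
  proof -
    obtain j where j: "j \<le> n" "p = \<tau> j"
      using index[OF \<open>p \<in> A\<close>] by blast
    obtain k where k: "k \<le> n" "q = \<tau> k"
      using index[OF \<open>q \<in> A\<close>] by blast
    have "j \<le> k"
      using less[of k j] that(3) j k by force
    have "{i. i < n \<and> p \<le> \<tau> i \<and> \<tau> i < q} = {j..<k}"
    proof -
      have "p \<le> \<tau> i \<longleftrightarrow> j \<le> i" if "i < n" for i
        using less[of i j] monoD[OF mono, of j i] that j by force
      moreover have "\<tau> i < q \<longleftrightarrow> i < k" if "i < n" for i
        using less[of i k] monoD[OF mono, of k i] that k by force
      ultimately show ?thesis using k(1) by auto
    qed
    then have eq: "{i \<in> {..<n}. p \<le> \<tau> i \<and> \<tau> i < q} = {j..<k}"
      by simp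
    have "(\<Sum>i<n. of_bool (p \<le> \<tau> i \<and> \<tau> i < q) * (F (\<tau> (Suc i)) - F (\<tau> i))) =
        (\<Sum>i<n. if p \<le> \<tau> i \<and> \<tau> i < q then F (\<tau> (Suc i)) - F (\<tau> i) else 0)"
      by (rule sum.cong) simp_all
    also have "\<dots> = (\<Sum>i=j..<k. F (\<tau> (Suc i)) - F (\<tau> i))"
      by (simp only: sum.inter_filter[OF finite_lessThan, symmetric] eq)
    also have "\<dots> = F q - F p"
      using sum_Suc_diff'[OF \<open>j \<le> k\<close>, of "\<lambda>i. F (\<tau> i)"] j k by simp
    finally show ?thesis by simp
  qed
  \<comment> \<open>The cell starting at \<open>\<tau> i\<close> collects the coefficients of all
    steps that cover it. As p and q are knots, testing the left end point of the cell
    suffices.\<close>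
  define c where "c i = (\<Sum>(c, p, q)\<leftarrow>l. c * of_bool (p \<le> \<tau> i \<and> \<tau> i < q))" for i
  \<comment> \<open>The induction runs over lists l' with entries from l, while the grid stays that
    of the full list.\<close>
  have "increment_sum l' F =
      (\<Sum>i<n. (\<Sum>(c, p, q)\<leftarrow>l'. c * of_bool (p \<le> \<tau> i \<and> \<tau> i < q)) * (F (\<tau> (Suc i)) - F (\<tau> i)))"
    if "set l' \<subseteq> set l" for l' F
    using that
  proof (induction l')
    case (Cons a l')
    obtain c p q where a: "a = (c, p, q)" by (cases a)
    then have mem: "(c, p, q) \<in> set l"
      using Cons.prems by simp
    have "p \<in> A" "q \<in> A"
      using imageI[OF mem, of "\<lambda>(c, p, q). p"] imageI[OF mem, of "\<lambda>(c, p, q). q"]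
      by (simp_all add: A_def)
    moreover have "p \<le> q"
      using bspec[OF l[unfolded steps_in_def] mem] by simp
    ultimately have "p \<in> A" "q \<in> A" "p \<le> q"
      by blast+
    have "increment_sum (a # l') F = c * (F q - F p) + increment_sum l' F"
      by (simp add: a increment_sum_Cons)
    also have "\<dots> = (\<Sum>i<n. c * of_bool (p \<le> \<tau> i \<and> \<tau> i < q) * (F (\<tau> (Suc i)) - F (\<tau> i))) +
        (\<Sum>i<n. (\<Sum>(c, p, q)\<leftarrow>l'. c * of_bool (p \<le> \<tau> i \<and> \<tau> i < q)) * (F (\<tau> (Suc i)) - F (\<tau> i)))"
      using Cons.prems by (subst step[OF \<open>p \<in> A\<close> \<open>q \<in> A\<close> \<open>p \<le> q\<close>], subst Cons.IH)
        (simp_all only: sum_distrib_left mult.assoc set_subset_Cons list.set insert_subset)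
    also have "\<dots> = (\<Sum>i<n. (\<Sum>(c, p, q)\<leftarrow>a # l'. c * of_bool (p \<le> \<tau> i \<and> \<tau> i < q)) *
        (F (\<tau> (Suc i)) - F (\<tau> i)))"
      by (simp only: a list.map sum_list.Cons split_conv distrib_right sum.distrib)
    finally show ?case .
  qed simp
  then have "increment_sum l F = increment_sum (partition_steps n \<tau> c) F" for F
    by (simp add: increment_sum_partition c_def)
  with mono range show ?thesis by (rule that)
qed

text \<open>Half-open cells of a monotone grid are pairwise disjoint, so all cross terms vanish
  pointwise. This is the deterministic side of the Ito isometry.\<close>

lemma step_fun_partition_square:
  assumes "mono \<tau>"
  shows "(step_fun (partition_steps n \<tau> c) r)\<^sup>2 = (\<Sum>i<n. (c i)\<^sup>2 * indicator {\<tau> i<..\<tau> (Suc i)} r)"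
proof -
  define \<delta> :: "nat \<Rightarrow> real" where "\<delta> i = indicator {\<tau> i<..\<tau> (Suc i)} r" for i
  have \<delta>: "of_bool (r \<le> \<tau> (Suc i)) - of_bool (r \<le> \<tau> i) = \<delta> i" for i
    using monoD[OF assms, of i "Suc i"] by (auto simp: \<delta>_def indicator_def)
  have "(\<Sum>i<n. c i * \<delta> i)\<^sup>2 = (\<Sum>i<n. (c i)\<^sup>2 * \<delta> i)"
  proof (induction n)
    case (Suc n)
    have "\<delta> i * \<delta> n = 0" if "i < n" for i
      using that monoD[OF assms, of "Suc i" n] by (auto simp: \<delta>_def indicator_def)
    then have "(\<Sum>i<n. c i * \<delta> i) * \<delta> n = 0"
      unfolding sum_distrib_right by (intro sum.neutral ballI) (simp add: mult.assoc)
    moreover have "(\<delta> n)\<^sup>2 = \<delta> n"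
      by (simp add: \<delta>_def indicator_def)
    moreover have "(\<Sum>i<Suc n. c i * \<delta> i)\<^sup>2 =
        (\<Sum>i<n. c i * \<delta> i)\<^sup>2 + (c n)\<^sup>2 * (\<delta> n)\<^sup>2 + 2 * c n * ((\<Sum>i<n. c i * \<delta> i) * \<delta> n)"
      by (simp add: power2_eq_square algebra_simps)
    ultimately show ?case
      using Suc by simp
  qed simp
  then show ?thesis
    by (simp add: step_fun_def increment_sum_partition \<delta> \<delta>_def)
qed

lemma
  assumes "mono \<tau>"
  shows integrable_step_fun_partition_square:
      "integrable lborel (\<lambda>r. (step_fun (partition_steps n \<tau> c) r)\<^sup>2)"
    and integral_step_fun_partition_square:
      "(\<integral>r. (step_fun (partition_steps n \<tau> c) r)\<^sup>2 \<partial>lborel) = (\<Sum>i<n. (c i)\<^sup>2 * (\<tau> (Suc i) - \<tau> i))"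
proof -
  have le: "\<tau> i \<le> \<tau> (Suc i)" for i
    using assms by (rule monoD) simp
  have int: "integrable lborel (\<lambda>r. (c i)\<^sup>2 * indicator {\<tau> i<..\<tau> (Suc i)} r :: real)" for i
    using le[of i] by (intro integrable_mult_right integrable_real_indicator) auto
  have val: "(\<integral>r. (c i)\<^sup>2 * indicator {\<tau> i<..\<tau> (Suc i)} r \<partial>lborel) = (c i)\<^sup>2 * (\<tau> (Suc i) - \<tau> i)" for i
    using le[of i] by simp
  show "integrable lborel (\<lambda>r. (step_fun (partition_steps n \<tau> c) r)\<^sup>2)"
    unfolding step_fun_partition_square[OF assms] by (intro Bochner_Integration.integrable_sum int)
  show "(\<integral>r. (step_fun (partition_steps n \<tau> c) r)\<^sup>2 \<partial>lborel) = (\<Sum>i<n. (c i)\<^sup>2 * (\<tau> (Suc i) - \<tau> i))"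
    unfolding step_fun_partition_square[OF assms] Bochner_Integration.integral_sum[OF int] val ..
qed

lemma integrable_step_fun_square:
  assumes "steps_in u v l" and "u \<le> v"
  shows "integrable lborel (\<lambda>r. (step_fun l r)\<^sup>2)"
proof -
  obtain n \<tau> c where "mono \<tau>" "\<And>F. increment_sum l F = increment_sum (partition_steps n \<tau> c) F"
    using steps_in_imp_partition[OF assms] by metis
  then show ?thesis
    using integrable_step_fun_partition_square[of \<tau> n c] by (simp add: step_fun_def)
qed

section \<open>Exponential Riemann sums\<close>

text \<open>For n = 0 the division by zero collapses all knots to p, which is why the limits below
  run over \<open>Suc n\<close>.\<close>

definition knot :: "real \<Rightarrow> real \<Rightarrow> nat \<Rightarrow> nat \<Rightarrow> real" where
  "knot p q n i = p + real i * ((q - p) / real n)"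

text \<open>On a path F this list yields a Riemann-Stieltjes sum for the integral of exp (a (q - r))
  dF(r) over [p, q]; read as a step function it approximates exp (a (q - r)). One list thus carries
  both the path-wise limit and the integrand that determines the variance.\<close>

definition exp_steps :: "real \<Rightarrow> real \<Rightarrow> real \<Rightarrow> nat \<Rightarrow> (real \<times> real \<times> real) list" where
  "exp_steps a p q n = partition_steps n (knot p q n) (\<lambda>i. exp (a * (q - knot p q n (Suc i))))"

lemma knot_0 [simp]: "knot p q n 0 = p"
  by (simp add: knot_def)

lemma knot_last [simp]: "0 < n \<Longrightarrow> knot p q n n = q"
  by (simp add: knot_def)

lemma knot_Suc: "knot p q n (Suc i) = knot p q n i + (q - p) / real n"
  by (simp add: knot_def algebra_simps add_divide_distrib diff_divide_distrib)

lemma knot_mono: "p \<le> q \<Longrightarrow> i \<le> j \<Longrightarrow> knot p q n i \<le> knot p q n j"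
  by (simp add: knot_def mult_right_mono divide_right_mono)

lemma knot_in: "p \<le> q \<Longrightarrow> i \<le> n \<Longrightarrow> 0 < n \<Longrightarrow> knot p q n i \<in> {p..q}"
  using knot_mono[of p q 0 i n] knot_mono[of p q i n n] by simp

lemma steps_in_exp_steps:
  assumes "p \<le> q" and "0 < n"
  shows "steps_in p q (exp_steps a p q n)"
  unfolding exp_steps_def
proof (rule steps_in_partition)
  show "mono_on {..n} (knot p q n)"
    using knot_mono[OF assms(1)] by (auto simp: monotone_on_def)
  show "knot p q n ` {..n} \<subseteq> {p..q}"
    using knot_in[OF assms(1) _ assms(2)] by blast
qed

lemma increment_sum_exp_steps:
  "increment_sum (exp_steps a p q n) F =
    (\<Sum>i<n. exp (a * (q - knot p q n (Suc i))) * (F (knot p q n (Suc i)) - F (knot p q n i)))"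
  by (simp add: exp_steps_def increment_sum_partition)

lemma mesh_tendsto_0:
  assumes "0 < \<delta>"
  shows "eventually (\<lambda>n. (q - p) / real (Suc n) < \<delta>) sequentially"
proof -
  have "(\<lambda>n. (q - p) / real (Suc n)) \<longlonglongrightarrow> 0"
    by (rule LIMSEQ_Suc[OF lim_const_over_n])
  then show ?thesis
    using assms by (rule order_tendstoD)
qed

text \<open>The summation by parts behind the variation of constants formula: no regularity of \<open>k\<close> beyond
  continuity is needed, so that it applies to Brownian paths.\<close>

lemma exp_steps_tendsto:
  fixes u S :: "real \<Rightarrow> real"
  assumes "p \<le> q" and u: "continuous_on {p..q} u"
    and S: "\<And>x. x \<in> {p..q} \<Longrightarrow> (S has_real_derivative u x) (at x within {p..q})"
    and k: "\<And>x. x \<in> {p..q} \<Longrightarrow> k x = u x - a * S x"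
  shows "(\<lambda>n. increment_sum (exp_steps a p q (Suc n)) k) \<longlonglongrightarrow> u q - exp (a * (q - p)) * u p"
proof (cases "p = q")
  case True
  then show ?thesis
    by (simp add: increment_sum_exp_steps knot_def)
next
  case False
  with \<open>p \<le> q\<close> have "p < q" by simp
  \<comment> \<open>The mean value theorem gives one intermediate point x for the weight and another
    point y for S. The error of a cell of length h is then h a (\<Phi> (x, t i) - \<Phi> (t (Suc i),
    y)), and uniform continuity on the square controls it; the mesh is taken below d / 2 because
    both coordinates differ.\<close>
  define \<Phi> where "\<Phi> = (\<lambda>(x, y). exp (a * (q - x)) * u y)"
  have "continuous_on ({p..q} \<times> {p..q}) \<Phi>"
    unfolding \<Phi>_def split_beta
    by (intro continuous_intros continuous_on_compose2[OF u]) auto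
  then have unif: "uniformly_continuous_on ({p..q} \<times> {p..q}) \<Phi>"
    by (intro compact_uniformly_continuous compact_Times) auto
  show ?thesis
  proof (rule LIMSEQ_I)
    fix r :: real assume "0 < r"
    \<comment> \<open>The cell errors add up to at most (q - p) \<bar>a\<bar> e; the summand 1 makes
      this strictly less than r and keeps the denominator positive when a = 0.\<close>
    define e where "e = r / ((q - p) * \<bar>a\<bar> + 1)"
    have den: "0 < (q - p) * \<bar>a\<bar> + 1"
      using \<open>p < q\<close> by (simp add: add_nonneg_pos)
    then have "0 < e"
      using \<open>0 < r\<close> by (simp add: e_def)
    obtain d where "0 < d" and d: "\<And>z z'. z \<in> {p..q} \<times> {p..q} \<Longrightarrow> z' \<in> {p..q} \<times> {p..q} \<Longrightarrow>
        dist z' z < d \<Longrightarrow> dist (\<Phi> z') (\<Phi> z) < e"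
      using unif \<open>0 < e\<close> unfolding uniformly_continuous_on_def by meson
    from mesh_tendsto_0[of "d / 2" q p] \<open>0 < d\<close>
    obtain n0 where n0: "\<And>n. n \<ge> n0 \<Longrightarrow> (q - p) / real (Suc n) < d / 2"
      by (auto simp: eventually_sequentially)
    show "\<exists>n0. \<forall>n\<ge>n0. norm (increment_sum (exp_steps a p q (Suc n)) k - (u q - exp (a * (q - p)) * u p)) < r"
    proof (intro exI allI impI)
      fix n assume "n \<ge> n0"
      define N where "N = Suc n"
      define h where "h = (q - p) / real N"
      define t where "t = knot p q N"
      define E where "E i = exp (a * (q - t i))" for i
      have h: "0 < h" "h < d / 2"
        using n0[OF \<open>n \<ge> n0\<close>] \<open>p < q\<close> by (simp_all add: h_def N_def)
      have t: "t i \<in> {p..q}" "t (Suc i) \<in> {p..q}" "t (Suc i) = t i + h" if "i < N" for i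
        using that knot_in[of p q i N] knot_in[of p q "Suc i" N] \<open>p \<le> q\<close>
        by (simp_all add: t_def h_def knot_Suc)
      have bound: "\<bar>E (Suc i) * (k (t (Suc i)) - k (t i)) - (E (Suc i) * u (t (Suc i)) - E i * u (t i))\<bar>
          \<le> h * \<bar>a\<bar> * e" if "i < N" for i
      proof -
        note ti = t[OF that]
        have lt: "t i < t (Suc i)"
          using ti h by simp
        have sub: "{t i..t (Suc i)} \<subseteq> {p..q}"
          using ti by auto
        have "\<exists>x. t i < x \<and> x < t (Suc i) \<and>
            exp (a * (q - t (Suc i))) - exp (a * (q - t i)) = (t (Suc i) - t i) * (- a * exp (a * (q - x)))"
          by (rule MVT2[OF lt]) (auto intro!: derivative_eq_intros)
        then obtain x where x: "t i < x" "x < t (Suc i)" "E (Suc i) - E i = h * (- a * exp (a * (q - x)))"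
          using ti(3) unfolding E_def by auto
        have "\<exists>y\<in>{t i<..<t (Suc i)}. S (t (Suc i)) - S (t i) = u y * (t (Suc i) - t i)"
        proof (rule mvt_simple[OF lt, of S "\<lambda>y v. u y * v"])
          fix y assume "t i \<le> y" "y \<le> t (Suc i)"
          then have "y \<in> {t i..t (Suc i)}" by simp
          then show "(S has_derivative (*) (u y)) (at y within {t i..t (Suc i)})"
            using S[of y] sub unfolding has_field_derivative_def by (meson has_derivative_subset subsetD)
        qed
        then obtain y where y: "t i < y" "y < t (Suc i)" "S (t (Suc i)) - S (t i) = h * u y"
          using ti(3) by auto
        have "E (Suc i) * (k (t (Suc i)) - k (t i)) - (E (Suc i) * u (t (Suc i)) - E i * u (t i)) =
            - (E (Suc i) - E i) * u (t i) - a * E (Suc i) * (S (t (Suc i)) - S (t i))"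
          using ti by (simp add: k algebra_simps)
        also have "\<dots> = h * a * (\<Phi> (x, t i) - \<Phi> (t (Suc i), y))"
          unfolding x(3) y(3) by (simp add: \<Phi>_def E_def algebra_simps)
        finally have eq: "E (Suc i) * (k (t (Suc i)) - k (t i)) - (E (Suc i) * u (t (Suc i)) - E i * u (t i)) =
            h * a * (\<Phi> (x, t i) - \<Phi> (t (Suc i), y))" .
        have "dist (x, t i) (t (Suc i), y) \<le> dist x (t (Suc i)) + dist (t i) y"
          by (simp add: dist_Pair_Pair sqrt_sum_squares_le_sum)
        also have "\<dots> < d"
          using x y ti h by (simp add: dist_real_def)
        finally have "dist (\<Phi> (x, t i)) (\<Phi> (t (Suc i), y)) < e"
          using x y ti by (intro d) auto
        then have "h * \<bar>a\<bar> * \<bar>\<Phi> (x, t i) - \<Phi> (t (Suc i), y)\<bar> \<le> h * \<bar>a\<bar> * e"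
          using h by (intro mult_left_mono) (simp_all add: dist_real_def)
        then show ?thesis
          unfolding eq abs_mult using h by simp
      qed
      have "(\<Sum>i<N. E (Suc i) * u (t (Suc i)) - E i * u (t i)) = u q - exp (a * (q - p)) * u p"
        using sum_lessThan_telescope[of "\<lambda>i. E i * u (t i)" N]
        by (simp add: E_def t_def N_def)
      then have "increment_sum (exp_steps a p q N) k - (u q - exp (a * (q - p)) * u p) =
          (\<Sum>i<N. E (Suc i) * (k (t (Suc i)) - k (t i)) - (E (Suc i) * u (t (Suc i)) - E i * u (t i)))"
        by (simp add: increment_sum_exp_steps E_def t_def sum_subtractf)
      also have "norm \<dots> \<le> (\<Sum>i<N. h * \<bar>a\<bar> * e)"
        using bound by (intro order_trans[OF norm_sum] sum_mono) auto
      also have "\<dots> = (q - p) * \<bar>a\<bar> * e"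
        by (simp add: h_def N_def)
      also have "\<dots> < ((q - p) * \<bar>a\<bar> + 1) * e"
        using \<open>0 < e\<close> by (simp add: algebra_simps)
      also have "\<dots> = r"
        using den by (simp add: e_def)
      finally show "norm (increment_sum (exp_steps a p q (Suc n)) k - (u q - exp (a * (q - p)) * u p)) < r"
        by (simp add: N_def)
    qed
  qed
qed

text \<open>The increments \<open>D n i\<close> of the indicator are nonnegative and telescope to at
  most 1, so the step function is an average, with total mass at most 1, of the exponential weights.
  For r in (p, q] the mass is 1 and sits on the cell containing r, whose right end is within one
  mesh of r.\<close>

lemma
  assumes "p \<le> q"
  shows step_fun_exp_steps_bound: "\<bar>step_fun (exp_steps a p q (Suc n)) r\<bar> \<le> exp (\<bar>a\<bar> * (q - p))"
    and step_fun_exp_steps_tendsto: "r \<in> {p<..q} \<Longrightarrow>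
      (\<lambda>n. step_fun (exp_steps a p q (Suc n)) r) \<longlonglongrightarrow> exp (a * (q - r))"
proof -
  define F where "F t = (of_bool (r \<le> t) :: real)" for t
  define D where "D n i = F (knot p q (Suc n) (Suc i)) - F (knot p q (Suc n) i)" for n i
  have D: "0 \<le> D n i" for n i
    using knot_mono[OF assms, of i "Suc i" "Suc n"] by (auto simp: D_def F_def)
  have sum_D: "(\<Sum>i<Suc n. D n i) = F q - F p" for n
    unfolding D_def using sum_lessThan_telescope[of "\<lambda>i. F (knot p q (Suc n) i)" "Suc n"]
    by (simp del: sum.lessThan_Suc)
  have eq: "step_fun (exp_steps a p q (Suc n)) r = (\<Sum>i<Suc n. exp (a * (q - knot p q (Suc n) (Suc i))) * D n i)" for n
    by (simp add: step_fun_def increment_sum_exp_steps D_def F_def)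
  have in_pq: "knot p q (Suc n) (Suc i) \<in> {p..q}" if "i < Suc n" for n i
    using that assms by (intro knot_in) auto
  have "\<bar>step_fun (exp_steps a p q (Suc n)) r\<bar> \<le> (\<Sum>i<Suc n. exp (\<bar>a\<bar> * (q - p)) * D n i)"
    unfolding eq
  proof (intro order_trans[OF sum_abs] sum_mono)
    fix i assume "i \<in> {..<Suc n}"
    then have "knot p q (Suc n) (Suc i) \<in> {p..q}"
      by (intro in_pq) simp
    then have "a * (q - knot p q (Suc n) (Suc i)) \<le> \<bar>a\<bar> * (q - p)"
      by (intro mult_mono) auto
    then show "\<bar>exp (a * (q - knot p q (Suc n) (Suc i))) * D n i\<bar> \<le> exp (\<bar>a\<bar> * (q - p)) * D n i"
      using D by (simp add: abs_mult mult_right_mono)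
  qed
  also have "\<dots> = exp (\<bar>a\<bar> * (q - p)) * (F q - F p)"
    by (simp only: sum_distrib_left[symmetric] sum_D)
  also have "\<dots> \<le> exp (\<bar>a\<bar> * (q - p))"
    by (simp add: F_def)
  finally show "\<bar>step_fun (exp_steps a p q (Suc n)) r\<bar> \<le> exp (\<bar>a\<bar> * (q - p))" .
  show "(\<lambda>n. step_fun (exp_steps a p q (Suc n)) r) \<longlonglongrightarrow> exp (a * (q - r))" if r: "r \<in> {p<..q}"
  proof (rule LIMSEQ_I)
    fix e :: real assume "0 < e"
    have "isCont (\<lambda>x. exp (a * (q - x))) r"
      by (intro continuous_intros)
    then obtain d where "0 < d" and d: "\<And>x. dist x r < d \<Longrightarrow> dist (exp (a * (q - x))) (exp (a * (q - r))) < e / 2"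
      using \<open>0 < e\<close> unfolding continuous_at_eps_delta by (metis half_gt_zero)
    from mesh_tendsto_0[OF \<open>0 < d\<close>, of q p]
    obtain n0 where n0: "\<And>n. n \<ge> n0 \<Longrightarrow> (q - p) / real (Suc n) < d"
      by (auto simp: eventually_sequentially)
    have FF: "F q - F p = 1"
      using r by (simp add: F_def)
    show "\<exists>n0. \<forall>n\<ge>n0. norm (step_fun (exp_steps a p q (Suc n)) r - exp (a * (q - r))) < e"
    proof (intro exI allI impI)
      fix n assume "n \<ge> n0"
      have bound: "\<bar>(exp (a * (q - knot p q (Suc n) (Suc i))) - exp (a * (q - r))) * D n i\<bar> \<le> e / 2 * D n i" for i
      proof (cases "D n i = 0")
        case False
        then have "knot p q (Suc n) i < r" "r \<le> knot p q (Suc n) (Suc i)"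
          using knot_mono[OF assms, of i "Suc i" "Suc n"] by (auto simp: D_def F_def of_bool_def split: if_splits)
        then have "dist (knot p q (Suc n) (Suc i)) r < d"
          using n0[OF \<open>n \<ge> n0\<close>] by (simp add: dist_real_def knot_Suc)
        then have "\<bar>exp (a * (q - knot p q (Suc n) (Suc i))) - exp (a * (q - r))\<bar> \<le> e / 2"
          using d unfolding dist_real_def by (meson less_imp_le)
        then show ?thesis
          using D by (simp only: abs_mult abs_of_nonneg) (rule mult_right_mono)
      qed simp
      have "step_fun (exp_steps a p q (Suc n)) r - exp (a * (q - r)) =
          step_fun (exp_steps a p q (Suc n)) r - exp (a * (q - r)) * (\<Sum>i<Suc n. D n i)"
        by (simp only: sum_D FF mult_1_right)
      also have "\<dots> = (\<Sum>i<Suc n. (exp (a * (q - knot p q (Suc n) (Suc i))) - exp (a * (q - r))) * D n i)"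
        by (simp only: eq sum_distrib_left left_diff_distrib sum_subtractf)
      also have "norm \<dots> \<le> (\<Sum>i<Suc n. e / 2 * D n i)"
        unfolding real_norm_def by (intro order_trans[OF sum_abs] sum_mono bound)
      also have "\<dots> = e / 2"
        by (simp only: sum_distrib_left[symmetric] sum_D FF mult_1_right)
      also have "\<dots> < e"
        using \<open>0 < e\<close> by simp
      finally show "norm (step_fun (exp_steps a p q (Suc n)) r - exp (a * (q - r))) < e" .
    qed
  qed
qed

section \<open>The linear Volterra equation\<close>

text \<open>The resolvent of u(t) = k(t) + a \<integral> u over [0, t], that is, k(t) plus a times
  the integral of exp (a (t - r)) k(r). As k enters undifferentiated, Brownian paths are admissible.
  The factor exp (a t) is pulled out so that t occurs in the integral only as upper limit and the
  product rule applies.\<close>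

definition volterra :: "real \<Rightarrow> (real \<Rightarrow> real) \<Rightarrow> real \<Rightarrow> real" where
  "volterra a k t = k t + a * (exp (a * t) * integral {0..t} (\<lambda>r. exp (- (a * r)) * k r))"

text \<open>The factor S behind a satisfies S' = k + a S, which is \<open>volterra a k\<close>
  itself, and S(0) = 0. Hence S is the primitive of the solution, which is the integral
  equation.\<close>

lemma
  assumes k: "continuous_on {0..T} k"
  shows continuous_on_volterra: "continuous_on {0..T} (volterra a k)"
    and volterra_eq: "t \<in> {0..T} \<Longrightarrow> volterra a k t = k t + a * (LINT r:{0..t}|lborel. volterra a k r)"
proof -
  define S where "S t = exp (a * t) * integral {0..t} (\<lambda>r. exp (- (a * r)) * k r)" for t
  have S: "volterra a k t = k t + a * S t" for t
    by (simp add: volterra_def S_def)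
  have c: "continuous_on {0..T} (\<lambda>r. exp (- (a * r)) * k r)"
    by (intro continuous_intros k)
  have dS: "(S has_real_derivative volterra a k t) (at t within {0..T})" if "t \<in> {0..T}" for t
  proof -
    note [derivative_intros] = integral_has_real_derivative[OF c that]
    have "(S has_real_derivative
        exp (a * t) * (exp (- (a * t)) * k t) + exp (a * t) * a * integral {0..t} (\<lambda>r. exp (- (a * r)) * k r))
        (at t within {0..T})"
      unfolding S_def[abs_def] by (auto intro!: derivative_eq_intros)
    moreover have "exp (a * t) * (exp (- (a * t)) * k t) = k t"
      by (simp add: exp_minus field_simps)
    ultimately show ?thesis
      by (simp only: volterra_def mult.assoc mult.left_commute[of a])
  qed
  then have "continuous_on {0..T} S"
    by (intro DERIV_continuous_on)
  then show cont: "continuous_on {0..T} (volterra a k)"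
    unfolding S[abs_def] by (intro continuous_intros k)
  show "volterra a k t = k t + a * (LINT r:{0..t}|lborel. volterra a k r)" if t: "t \<in> {0..T}"
  proof -
    have sub: "{0..t} \<subseteq> {0..T}"
      using t by auto
    have "(volterra a k has_integral (S t - S 0)) {0..t}"
      using t sub by (intro fundamental_theorem_of_calculus)
        (auto simp: has_real_derivative_iff_has_vector_derivative[symmetric] intro: DERIV_subset[OF dS])
    moreover have "(LINT r:{0..t}|lborel. volterra a k r) = integral {0..t} (volterra a k)"
      using continuous_on_subset[OF cont sub]
      by (intro set_borel_integral_eq_integral(2) borel_integrable_atLeastAtMost') 
    ultimately show ?thesis
      unfolding S by (simp add: integral_unique) (simp add: S_def)
  qed
qed

lemma has_real_derivative_set_integral:
  assumes c: "continuous_on {0..T} u" and "t \<in> {0..T::real}"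
  shows "((\<lambda>t. LINT r:{0..t}|lborel. u r) has_real_derivative u t) (at t within {0..T})"
proof -
  have eq: "(LINT r:{0..x}|lborel. u r) = integral {0..x} u" if "x \<in> {0..T}" for x
    using that continuous_on_subset[OF c, of "{0..x}"]
    by (intro set_borel_integral_eq_integral(2) borel_integrable_atLeastAtMost') auto
  show ?thesis
    by (rule has_field_derivative_transform_within[OF integral_has_real_derivative[OF assms] zero_less_one assms(2)])
      (simp add: eq)
qed

section \<open>Wiener integrals\<close>

lemma LIMSEQ_null_comparison:
  fixes f :: "nat \<Rightarrow> 'b::real_normed_vector"
  assumes "\<And>k. norm (f k) \<le> g k" and "g \<longlonglongrightarrow> 0"
  shows "f \<longlonglongrightarrow> 0"
  using assms by (intro Lim_null_comparison[OF _ assms(2)]) simp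

lemma ennreal_LIMSEQ_null_comparison:
  fixes f :: "nat \<Rightarrow> ennreal"
  assumes "\<And>k. f k \<le> g k" and "g \<longlonglongrightarrow> 0"
  shows "f \<longlonglongrightarrow> 0"
  using assms by (intro tendsto_sandwich[OF _ _ tendsto_const assms(2)]) simp_all

lemma norm_iexp_diff_le: "norm (iexp x - iexp y) \<le> \<bar>x - y\<bar>"
proof -
  have "iexp x - iexp y = iexp y * (iexp (x - y) - 1)"
    by (simp add: algebra_simps exp_diff)
  also have "norm \<dots> = norm (iexp (x - y) - 1)"
    by (simp add: norm_mult)
  also have "\<dots> \<le> \<bar>x - y\<bar>"
    using iexp_approx1[of "x - y" 0] by simp
  finally show ?thesis .
qed

section \<open>The enriched filtration and the information at time 0\<close>

locale brownian_setting = prob_space M for M :: "'a measure" +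
  fixes F0 :: "'a measure" and W :: "real \<Rightarrow> 'a \<Rightarrow> real"
  assumes brownian: "brownian_motion M W"
    and subalgebra_F0: "subalgebra M F0"
    and independent_F0: "independent_of_process M F0 W"
begin

abbreviation filt :: "real \<Rightarrow> 'a measure" where
  "filt \<equiv> enriched_filtration M F0 W"

lemma W_measurable [measurable]: "0 \<le> t \<Longrightarrow> W t \<in> borel_measurable M"
  using brownian by (simp add: brownian_motion_def)

lemma process_events_subset: "I \<subseteq> {0..} \<Longrightarrow> process_events M W I \<subseteq> events"
  by (auto simp: process_events_def intro!: measurable_sets W_measurable)

lemma filt_generator_subset: "sets F0 \<union> process_events M W {0..t} \<union> null_sets M \<subseteq> events"
  using subalgebra_F0 process_events_subset[of "{0..t}"] by (auto simp: subalgebra_def)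

lemma filt_generator_Pow: "sets F0 \<union> process_events M W {0..t} \<union> null_sets M \<subseteq> Pow (space M)"
  using filt_generator_subset[of t] sets.space_closed[of M] by (rule subset_trans)

lemma space_filt [simp]: "space (filt t) = space M"
  by (simp add: enriched_filtration_def space_measure_of_conv)

lemma sets_filt:
  "sets (filt t) = sigma_sets (space M) (sets F0 \<union> process_events M W {0..t} \<union> null_sets M)"
  unfolding enriched_filtration_def by (rule sets_measure_of[OF filt_generator_Pow])

lemma sets_filt_subset: "sets (filt t) \<subseteq> events"
  unfolding sets_filt by (rule sets.sigma_sets_subset[OF filt_generator_subset])

lemma measurable_filt: "X \<in> borel_measurable (filt t) \<Longrightarrow> X \<in> borel_measurable M"
  using sets_filt_subset by (auto simp: measurable_def)

lemma sets_filt_mono: "s \<le> t \<Longrightarrow> sets (filt s) \<subseteq> sets (filt t)"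
  unfolding sets_filt
  by (intro sigma_sets_mono' Un_mono order_refl) (unfold process_events_def, rule UN_mono, auto)

lemma measurable_filt_mono: "X \<in> borel_measurable (filt s) \<Longrightarrow> s \<le> t \<Longrightarrow> X \<in> borel_measurable (filt t)"
  using sets_filt_mono by (auto simp: measurable_def)

lemma F0_measurable_filt: "X \<in> borel_measurable F0 \<Longrightarrow> X \<in> borel_measurable (filt t)"
  using subalgebra_F0 by (auto simp: measurable_def sets_filt subalgebra_def)

lemma null_sets_filt: "N \<in> null_sets M \<Longrightarrow> N \<in> sets (filt t)"
  by (auto simp: sets_filt)

lemma W_measurable_filt:
  assumes "0 \<le> r" and "r \<le> t"
  shows "W r \<in> borel_measurable (filt t)"
proof (rule measurableI)
  fix B :: "real set" assume "B \<in> sets borel"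
  with assms have "W r -` B \<inter> space M \<in> process_events M W {0..t}"
    unfolding process_events_def by (intro UN_I[of r] CollectI exI[of _ B] conjI refl) auto
  then show "W r -` B \<inter> space (filt t) \<in> sets (filt t)"
    by (auto simp: sets_filt)
qed simp

text \<open>At time 0 the filtration adds to \<open>F0\<close> only null sets and events of W(0),
  which is almost surely 0, so that such events are almost surely sure or impossible. This carries
  the independence of \<open>F0\<close> from the Brownian motion over to the \<sigma>-field in which
  Y(0) is measurable.\<close>

lemma filt_0_AE_F0:
  assumes "A \<in> sets (filt 0)"
  shows "\<exists>A'\<in>sets F0. AE \<omega> in M. \<omega> \<in> A \<longleftrightarrow> \<omega> \<in> A'"
  using assms unfolding sets_filt
proof (induction rule: sigma_sets.induct)
  case (Basic A)
  then consider "A \<in> sets F0" | "A \<in> process_events M W {0..0}" | "A \<in> null_sets M"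
    by auto
  then show ?case
  proof cases
    case 2
    then obtain B where A: "A = W 0 -` B \<inter> space M"
      by (auto simp: process_events_def)
    have "AE \<omega> in M. W 0 \<omega> = 0"
      using brownian by (simp add: brownian_motion_def)
    then have "AE \<omega> in M. \<omega> \<in> A \<longleftrightarrow> \<omega> \<in> (if 0 \<in> B then space F0 else {})"
      using AE_space by eventually_elim (use subalgebra_F0 in \<open>auto simp: A subalgebra_def\<close>)
    then show ?thesis
      by (rule bexI) auto
  next
    case 3
    then show ?thesis
      using AE_not_in by (intro bexI[of _ "{}"]) auto
  qed auto
next
  case Empty
  then show ?case by (intro bexI[of _ "{}"]) auto
next
  case (Compl A)
  then obtain A' where A': "A' \<in> sets F0" "AE \<omega> in M. \<omega> \<in> A \<longleftrightarrow> \<omega> \<in> A'" by blast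
  have "AE \<omega> in M. \<omega> \<in> space M - A \<longleftrightarrow> \<omega> \<in> space F0 - A'"
    using A'(2) AE_space by eventually_elim (use subalgebra_F0 in \<open>auto simp: subalgebra_def\<close>)
  then show ?case
    using A'(1) by (intro bexI[of _ "space F0 - A'"]) auto
next
  case (Union A)
  then obtain A' where A': "\<And>i::nat. A' i \<in> sets F0" "\<And>i. AE \<omega> in M. \<omega> \<in> A i \<longleftrightarrow> \<omega> \<in> A' i"
    by metis
  then have "AE \<omega> in M. \<forall>i. \<omega> \<in> A i \<longleftrightarrow> \<omega> \<in> A' i"
    by (simp add: AE_all_countable)
  then have "AE \<omega> in M. \<omega> \<in> (\<Union>i. A i) \<longleftrightarrow> \<omega> \<in> (\<Union>i. A' i)"
    by eventually_elim auto
  then show ?case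
    using A'(1) by (intro bexI[of _ "\<Union>i. A' i"]) auto
qed

abbreviation brownian_events :: "'a set set" where
  "brownian_events \<equiv> sigma_sets (space M) (process_events M W {0..})"

lemma indep_filt_0: "indep_set (sets (filt 0)) brownian_events"
proof -
  have ind: "brownian_events \<subseteq> events"
      "\<And>a b. a \<in> sets F0 \<Longrightarrow> b \<in> brownian_events \<Longrightarrow> prob (a \<inter> b) = prob a * prob b"
    using independent_F0 unfolding independent_of_process_def indep_sets2_eq by auto
  show ?thesis
    unfolding indep_sets2_eq
  proof (intro conjI ballI)
    fix a b assume ab: "a \<in> sets (filt 0)" "b \<in> brownian_events"
    obtain a' where a': "a' \<in> sets F0" "AE \<omega> in M. \<omega> \<in> a \<longleftrightarrow> \<omega> \<in> a'"
      using filt_0_AE_F0[OF ab(1)] by blast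
    have meas: "a \<in> events" "a' \<in> events" "b \<in> events"
      using ab a'(1) sets_filt_subset[of 0] ind(1) subalgebra_F0 by (auto simp: subalgebra_def)
    have "prob (a \<inter> b) = prob (a' \<inter> b)"
      by (rule finite_measure_eq_AE) (use a'(2) meas in auto)
    moreover have "prob a = prob a'"
      by (rule finite_measure_eq_AE) (use a'(2) meas in auto)
    ultimately show "prob (a \<inter> b) = prob a * prob b"
      using ind(2)[OF a'(1) ab(2)] by simp
  qed (use sets_filt_subset ind in auto)
qed

section \<open>Law and isometry of elementary Wiener sums\<close>

abbreviation W_sum :: "(real \<times> real \<times> real) list \<Rightarrow> 'a \<Rightarrow> real" where
  "W_sum l \<omega> \<equiv> increment_sum l (\<lambda>t. W t \<omega>)"

lemma W_sum_measurable_brownian: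
  assumes "steps_in 0 v l"
  shows "W_sum l \<in> borel_measurable (sigma (space M) (process_events M W {0..}))"
proof -
  let ?B = "sigma (space M) (process_events M W {0..})"
  have Pow: "process_events M W {0..} \<subseteq> Pow (space M)"
    using process_events_subset[of "{0..}"] sets.space_closed[of M] by auto
  have W: "W t \<in> borel_measurable ?B" if "0 \<le> t" for t
  proof (rule measurableI)
    fix B :: "real set" assume "B \<in> sets borel"
    with that have "W t -` B \<inter> space M \<in> process_events M W {0..}"
      unfolding process_events_def by (intro UN_I[of t] CollectI exI[of _ B] conjI refl) auto
    then show "W t -` B \<inter> space ?B \<in> sets ?B"
      by (auto simp: sets_measure_of[OF Pow] space_measure_of_conv)
  qed simp
  show ?thesis
    using assms
  proof (induction l)
    case (Cons a l)
    obtain c p q where "a = (c, p, q)" by (cases a)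
    with Cons W[of p] W[of q] show ?case
      by (simp add: increment_sum_Cons steps_in_def)
  qed simp
qed

lemma W_sum_measurable [measurable]:
  assumes "steps_in 0 v l"
  shows "W_sum l \<in> borel_measurable M"
proof -
  have "process_events M W {0..} \<subseteq> Pow (space M)"
    using process_events_subset[of "{0..}"] sets.space_closed[of M] by auto
  then have "sets (sigma (space M) (process_events M W {0..})) \<subseteq> events"
    by (simp add: sets_measure_of sets.sigma_sets_subset process_events_subset)
  with W_sum_measurable_brownian[OF assms] show ?thesis
    by (auto simp: measurable_def space_measure_of_conv)
qed

lemma indep_var_W_sum:
  assumes X: "X \<in> borel_measurable (filt 0)" and l: "steps_in 0 v l"
  shows "indep_var borel X borel (W_sum l)"
proof -
  have Pow: "process_events M W {0..} \<subseteq> Pow (space M)"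
    using process_events_subset[of "{0..}"] sets.space_closed[of M] by auto
  have "sigma_sets (space M) {X -` A \<inter> space M | A. A \<in> sets borel} \<subseteq> sets (filt 0)"
    by (rule sets.sigma_sets_subset[of _ "filt 0", unfolded space_filt])
      (use measurable_sets[OF X] in auto)
  moreover have "{W_sum l -` A \<inter> space M | A. A \<in> sets borel} \<subseteq> brownian_events"
    using measurable_sets[OF W_sum_measurable_brownian[OF l]]
    by (auto simp: sets_measure_of[OF Pow] space_measure_of_conv)
  then have "sigma_sets (space M) {W_sum l -` A \<inter> space M | A. A \<in> sets borel} \<subseteq> brownian_events"
    by (rule sigma_sets_subseteq[THEN order_trans]) (simp add: sigma_sets_sigma_sets_eq Pow)
  ultimately show ?thesis
    using indep_filt_0 measurable_filt[OF X] W_sum_measurable[OF l]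
    unfolding indep_var_eq indep_sets2_eq by blast
qed

text \<open>On the common grid the sum has independent Gaussian terms, so characteristic functions
  multiply and variances add; by disjointness of the cells the total is the squared L2 norm of the
  step function.\<close>

lemma distr_W_sum:
  assumes l: "steps_in 0 v l" and "0 \<le> v"
  shows "distr M borel (W_sum l) = gaussian_law 0 (\<integral>r. (step_fun l r)\<^sup>2 \<partial>lborel)"
proof -
  obtain n \<tau> c where \<tau>: "mono \<tau>" "range \<tau> \<subseteq> {0..v}"
    and eq: "\<And>F. increment_sum l F = increment_sum (partition_steps n \<tau> c) F"
    using steps_in_imp_partition[OF assms] by metis
  have pos: "0 \<le> \<tau> i" and le: "\<tau> i \<le> \<tau> (Suc i)" for i
    using \<tau> by (auto simp: image_subset_iff monoD)
  have norm: "(\<integral>r. (step_fun l r)\<^sup>2 \<partial>lborel) = (\<Sum>i<n. (c i)\<^sup>2 * (\<tau> (Suc i) - \<tau> i))"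
    unfolding step_fun_def eq using integral_step_fun_partition_square[OF \<tau>(1), of n c]
    by (simp add: step_fun_def)
  define D where "D i \<omega> = W (\<tau> (Suc i)) \<omega> - W (\<tau> i) \<omega>" for i \<omega>
  have D [measurable]: "D i \<in> borel_measurable M" for i
    unfolding D_def[abs_def] using pos by measurable
  have "indep_vars (\<lambda>_. borel) D {..<n}"
    using brownian \<tau>(1) pos[of 0] unfolding brownian_motion_def D_def[abs_def] by blast
  then have indep: "indep_vars (\<lambda>_. borel) (\<lambda>i \<omega>. c i * D i \<omega>) {..<n}"
    by (rule indep_vars_compose2) simp
  have law: "distr M borel (D i) = gaussian_law 0 (\<tau> (Suc i) - \<tau> i)" for i
  proof (cases "\<tau> i = \<tau> (Suc i)")
    case True
    then show ?thesis
      by (simp add: D_def[abs_def] gaussian_law_def)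
  next
    case False
    then show ?thesis
      using le[of i] pos[of i] brownian unfolding brownian_motion_def D_def[abs_def] by force
  qed
  have char_D: "char (distr M borel (\<lambda>\<omega>. c i * D i \<omega>)) t =
      complex_of_real (exp (- ((c i)\<^sup>2 * (\<tau> (Suc i) - \<tau> i)) * t\<^sup>2 / 2))" for i t
  proof -
    have "char (distr M borel (\<lambda>\<omega>. c i * D i \<omega>)) t = char (gaussian_law 0 (\<tau> (Suc i) - \<tau> i)) (t * c i)"
      using char_distr_affine[OF D, of 0 "c i" i t] by (simp add: law)
    also have "\<dots> = complex_of_real (exp (- (\<tau> (Suc i) - \<tau> i) * (t * c i)\<^sup>2 / 2))"
      using char_gaussian_law[of "\<tau> (Suc i) - \<tau> i" 0] le[of i] by simp
    also have "- (\<tau> (Suc i) - \<tau> i) * (t * c i)\<^sup>2 / 2 = - ((c i)\<^sup>2 * (\<tau> (Suc i) - \<tau> i)) * t\<^sup>2 / 2"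
      unfolding power_mult_distrib by (simp only: mult_minus_left mult_minus_right ac_simps)
    finally show ?thesis .
  qed
  have "char (distr M borel (W_sum l)) t =
      complex_of_real (exp (- (\<integral>r. (step_fun l r)\<^sup>2 \<partial>lborel) * t\<^sup>2 / 2))" for t
  proof -
    have "W_sum l = (\<lambda>\<omega>. \<Sum>i<n. c i * D i \<omega>)"
      by (simp add: eq increment_sum_partition D_def)
    then have "char (distr M borel (W_sum l)) t =
        (\<Prod>i<n. complex_of_real (exp (- ((c i)\<^sup>2 * (\<tau> (Suc i) - \<tau> i)) * t\<^sup>2 / 2)))"
      by (simp only: char_distr_sum[OF indep] char_D)
    also have "\<dots> = complex_of_real (exp (\<Sum>i<n. - ((c i)\<^sup>2 * (\<tau> (Suc i) - \<tau> i)) * t\<^sup>2 / 2))"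
      by (simp only: exp_sum[OF finite_lessThan] of_real_prod)
    also have "(\<Sum>i<n. - ((c i)\<^sup>2 * (\<tau> (Suc i) - \<tau> i)) * t\<^sup>2 / 2) =
        - (\<Sum>i<n. (c i)\<^sup>2 * (\<tau> (Suc i) - \<tau> i)) * t\<^sup>2 / 2"
      by (simp only: sum_divide_distrib[symmetric] sum_distrib_right[symmetric] sum_negf)
    finally show ?thesis
      by (simp only: norm)
  qed
  then show ?thesis
    using W_sum_measurable[OF l] by (intro distr_eq_gaussian_lawI) auto
qed

text \<open>Both facts are read off the Gaussian law of the sum.\<close>

lemma
  assumes l: "steps_in 0 v l" and "0 \<le> v"
  shows integrable_W_sum_square: "integrable M (\<lambda>\<omega>. (W_sum l \<omega>)\<^sup>2)"
    and W_sum_isometry: "(\<integral>\<omega>. (W_sum l \<omega>)\<^sup>2 \<partial>M) = (\<integral>r. (step_fun l r)\<^sup>2 \<partial>lborel)"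
proof -
  define \<sigma> where "\<sigma> = (\<integral>r. (step_fun l r)\<^sup>2 \<partial>lborel)"
  have "0 \<le> \<sigma>"
    by (simp add: \<sigma>_def)
  note [measurable] = W_sum_measurable[OF l]
  have law: "distr M borel (W_sum l) = gaussian_law 0 \<sigma>"
    unfolding \<sigma>_def by (rule distr_W_sum[OF assms])
  show "integrable M (\<lambda>\<omega>. (W_sum l \<omega>)\<^sup>2)"
    using integrable_gaussian_law_square[OF \<open>0 \<le> \<sigma>\<close>, of 0]
    unfolding law[symmetric] by (simp add: integrable_distr_eq)
  have "(\<integral>\<omega>. (W_sum l \<omega>)\<^sup>2 \<partial>M) = (\<integral>x. x\<^sup>2 \<partial>distr M borel (W_sum l))"
    by (simp add: integral_distr)
  also have "\<dots> = \<sigma>"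
    using law_var_gaussian_law[OF \<open>0 \<le> \<sigma>\<close>, of 0] law_mean_gaussian_law[OF \<open>0 \<le> \<sigma>\<close>, of 0]
    by (simp add: law law_var_def law_mean_def)
  finally show "(\<integral>\<omega>. (W_sum l \<omega>)\<^sup>2 \<partial>M) = (\<integral>r. (step_fun l r)\<^sup>2 \<partial>lborel)"
    by (simp add: \<sigma>_def)
qed

text \<open>Unlike \<^const>\<open>is_stochastic_integral\<close>, the integrand lives on the whole line and the
  approximating steps may overlap, which makes linearity immediate.\<close>

definition wiener :: "real \<Rightarrow> real \<Rightarrow> (real \<Rightarrow> real) \<Rightarrow> ('a \<Rightarrow> real) \<Rightarrow> bool" where
  "wiener u v \<phi> J \<longleftrightarrow> \<phi> \<in> borel_measurable borel \<and> J \<in> borel_measurable M \<and>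
    (\<exists>l. (\<forall>k. steps_in u v (l k)) \<and>
      (\<lambda>k. \<integral>\<^sup>+r. ennreal ((step_fun (l k) r - \<phi> r)\<^sup>2) \<partial>lborel) \<longlonglongrightarrow> 0 \<and>
      (\<lambda>k. \<integral>\<^sup>+\<omega>. ennreal ((W_sum (l k) \<omega> - J \<omega>)\<^sup>2) \<partial>M) \<longlonglongrightarrow> 0)"

lemma wiener_measurable: "wiener u v \<phi> J \<Longrightarrow> J \<in> borel_measurable M"
  by (simp add: wiener_def)

lemma wiener_zero: "wiener u v (\<lambda>_. 0) (\<lambda>_. 0)"
  unfolding wiener_def by (intro conjI exI[of _ "\<lambda>_. []"]) (auto simp: steps_in_def step_fun_def)

lemma wiener_mono: "wiener u v \<phi> J \<Longrightarrow> u' \<le> u \<Longrightarrow> v \<le> v' \<Longrightarrow> wiener u' v' \<phi> J"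
  unfolding wiener_def using steps_in_mono by meson

lemma tendsto_nn_integral_square_add:
  fixes f g :: "nat \<Rightarrow> 'b \<Rightarrow> real"
  assumes [measurable]: "\<And>k. f k \<in> borel_measurable N" "\<And>k. g k \<in> borel_measurable N"
    and f: "(\<lambda>k. \<integral>\<^sup>+x. ennreal ((f k x)\<^sup>2) \<partial>N) \<longlonglongrightarrow> 0"
    and g: "(\<lambda>k. \<integral>\<^sup>+x. ennreal ((g k x)\<^sup>2) \<partial>N) \<longlonglongrightarrow> 0"
  shows "(\<lambda>k. \<integral>\<^sup>+x. ennreal ((a * f k x + b * g k x)\<^sup>2) \<partial>N) \<longlonglongrightarrow> 0"
proof (rule tendsto_sandwich[OF _ _ tendsto_const])
  let ?B = "\<lambda>k. ennreal (2 * a\<^sup>2) * (\<integral>\<^sup>+x. ennreal ((f k x)\<^sup>2) \<partial>N) +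
      ennreal (2 * b\<^sup>2) * (\<integral>\<^sup>+x. ennreal ((g k x)\<^sup>2) \<partial>N)"
  have "(\<integral>\<^sup>+x. ennreal ((a * f k x + b * g k x)\<^sup>2) \<partial>N) \<le> ?B k" for k
  proof -
    have "ennreal ((a * f k x + b * g k x)\<^sup>2) \<le>
        ennreal (2 * a\<^sup>2) * ennreal ((f k x)\<^sup>2) + ennreal (2 * b\<^sup>2) * ennreal ((g k x)\<^sup>2)" for x
      using square_add_le[of "a * f k x" "b * g k x"]
      by (simp add: power_mult_distrib ennreal_mult[symmetric] ennreal_plus[symmetric] mult.assoc ennreal_leI
          del: ennreal_plus)
    then show ?thesis
      by (subst nn_integral_cmult[symmetric], simp)+
        (subst nn_integral_add[symmetric], simp_all add: nn_integral_mono)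
  qed
  then show "\<forall>\<^sub>F k in sequentially. (\<integral>\<^sup>+x. ennreal ((a * f k x + b * g k x)\<^sup>2) \<partial>N) \<le> ?B k"
    by simp
  have "?B \<longlonglongrightarrow> ennreal (2 * a\<^sup>2) * 0 + ennreal (2 * b\<^sup>2) * 0"
    by (intro tendsto_add ennreal_tendsto_cmult f g) auto
  then show "?B \<longlonglongrightarrow> 0" by simp
qed simp

lemma wiener_linear:
  assumes "wiener u v \<phi> J" and "wiener u v \<psi> K" and "0 \<le> u"
  shows "wiener u v (\<lambda>r. a * \<phi> r + b * \<psi> r) (\<lambda>\<omega>. a * J \<omega> + b * K \<omega>)"
proof -
  obtain l where l: "\<And>k. steps_in u v (l k)"
      "(\<lambda>k. \<integral>\<^sup>+r. ennreal ((step_fun (l k) r - \<phi> r)\<^sup>2) \<partial>lborel) \<longlonglongrightarrow> 0"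
      "(\<lambda>k. \<integral>\<^sup>+\<omega>. ennreal ((W_sum (l k) \<omega> - J \<omega>)\<^sup>2) \<partial>M) \<longlonglongrightarrow> 0"
    using assms(1) by (auto simp: wiener_def)
  obtain m where m: "\<And>k. steps_in u v (m k)"
      "(\<lambda>k. \<integral>\<^sup>+r. ennreal ((step_fun (m k) r - \<psi> r)\<^sup>2) \<partial>lborel) \<longlonglongrightarrow> 0"
      "(\<lambda>k. \<integral>\<^sup>+\<omega>. ennreal ((W_sum (m k) \<omega> - K \<omega>)\<^sup>2) \<partial>M) \<longlonglongrightarrow> 0"
    using assms(2) by (auto simp: wiener_def)
  note [measurable] = W_sum_measurable[OF steps_in_mono[OF l(1) \<open>0 \<le> u\<close> order_refl]]
    W_sum_measurable[OF steps_in_mono[OF m(1) \<open>0 \<le> u\<close> order_refl]]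
  have [measurable]: "\<phi> \<in> borel_measurable borel" "\<psi> \<in> borel_measurable borel"
      "J \<in> borel_measurable M" "K \<in> borel_measurable M"
    using assms by (simp_all add: wiener_def)
  define n where "n k = scale_steps a (l k) @ scale_steps b (m k)" for k
  have "(\<lambda>k. \<integral>\<^sup>+r. ennreal ((step_fun (n k) r - (a * \<phi> r + b * \<psi> r))\<^sup>2) \<partial>lborel) \<longlonglongrightarrow> 0"
    using tendsto_nn_integral_square_add[OF _ _ l(2) m(2), of a b]
    by (simp add: n_def step_fun_append step_fun_scale algebra_simps)
  moreover have "(\<lambda>k. \<integral>\<^sup>+\<omega>. ennreal ((W_sum (n k) \<omega> - (a * J \<omega> + b * K \<omega>))\<^sup>2) \<partial>M) \<longlonglongrightarrow> 0"
    using tendsto_nn_integral_square_add[OF _ _ l(3) m(3), of a b]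
    by (simp add: n_def increment_sum_append increment_sum_scale algebra_simps)
  moreover have "steps_in u v (n k)" for k
    using l(1) m(1) by (simp add: n_def)
  ultimately show ?thesis
    unfolding wiener_def by (intro conjI exI[of _ n]) auto
qed

text \<open>For step integrands the formula is independence of X and the sum. It passes to the limit
  since characteristic functions at t differ by at most \<bar>t\<bar> times the L1 distance, hence
  by \<bar>t\<bar> times the L2 distance. Keeping X inside the formula replaces a proof that X and
  the limit J are independent.\<close>

lemma
  assumes w: "wiener u v \<phi> J" and "0 \<le> u" "u \<le> v"
  shows wiener_square_integrable: "integrable lborel (\<lambda>r. (\<phi> r)\<^sup>2)"
    and char_add_wiener: "X \<in> borel_measurable (filt 0) \<Longrightarrow>
      char (distr M borel (\<lambda>\<omega>. X \<omega> + J \<omega>)) t =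
        char (distr M borel X) t * complex_of_real (exp (- (\<integral>r. (\<phi> r)\<^sup>2 \<partial>lborel) * t\<^sup>2 / 2))"
proof -
  obtain l where l: "\<And>k. steps_in u v (l k)"
      "(\<lambda>k. \<integral>\<^sup>+r. ennreal ((step_fun (l k) r - \<phi> r)\<^sup>2) \<partial>lborel) \<longlonglongrightarrow> 0"
      "(\<lambda>k. \<integral>\<^sup>+\<omega>. ennreal ((W_sum (l k) \<omega> - J \<omega>)\<^sup>2) \<partial>M) \<longlonglongrightarrow> 0"
    using assms(1) by (auto simp: wiener_def)
  have l0: "steps_in 0 v (l k)" for k
    using steps_in_mono[OF l(1) \<open>0 \<le> u\<close> order_refl] .
  have v: "0 \<le> v" using assms by simp
  note [measurable] = W_sum_measurable[OF l0]
  have [measurable]: "\<phi> \<in> borel_measurable borel" "J \<in> borel_measurable M"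
    using assms by (simp_all add: wiener_def)
  note sq = integrable_step_fun_square[OF l0 v]
  show "integrable lborel (\<lambda>r. (\<phi> r)\<^sup>2)"
    by (rule square_integrable_L2_limit[OF _ _ sq l(2)]) auto
  have norm: "(\<lambda>k. \<integral>r. (step_fun (l k) r)\<^sup>2 \<partial>lborel) \<longlonglongrightarrow> (\<integral>r. (\<phi> r)\<^sup>2 \<partial>lborel)"
    by (rule tendsto_integral_square[OF _ _ sq l(2)]) auto
  have dist: "(\<lambda>k. \<integral>\<omega>. (W_sum (l k) \<omega> - J \<omega>)\<^sup>2 \<partial>M) \<longlonglongrightarrow> 0"
    by (rule tendsto_L2_dist[OF _ _ integrable_W_sum_square[OF l0 v] l(3)]) auto
  have J2: "integrable M (\<lambda>\<omega>. (J \<omega>)\<^sup>2)"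
    by (rule square_integrable_L2_limit[OF _ _ integrable_W_sum_square[OF l0 v] l(3)]) auto
  show "char (distr M borel (\<lambda>\<omega>. X \<omega> + J \<omega>)) t =
      char (distr M borel X) t * complex_of_real (exp (- (\<integral>r. (\<phi> r)\<^sup>2 \<partial>lborel) * t\<^sup>2 / 2))"
    if X: "X \<in> borel_measurable (filt 0)"
  proof (rule LIMSEQ_unique)
    note [measurable] = measurable_filt[OF X]
    let ?c = "\<lambda>k. char (distr M borel (\<lambda>\<omega>. X \<omega> + W_sum (l k) \<omega>)) t"
    have "?c k = char (distr M borel X) t *
        complex_of_real (exp (- (\<integral>r. (step_fun (l k) r)\<^sup>2 \<partial>lborel) * t\<^sup>2 / 2))" for k
      using char_distr_add[OF indep_var_W_sum[OF X l0]]
      by (simp add: distr_W_sum[OF l0 v] char_gaussian_law)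
    then show "?c \<longlonglongrightarrow> char (distr M borel X) t *
        complex_of_real (exp (- (\<integral>r. (\<phi> r)\<^sup>2 \<partial>lborel) * t\<^sup>2 / 2))"
      by (simp only:) (intro tendsto_intros norm, simp)
    have "norm (?c k - char (distr M borel (\<lambda>\<omega>. X \<omega> + J \<omega>)) t) \<le>
        \<bar>t\<bar> * sqrt (\<integral>\<omega>. (W_sum (l k) \<omega> - J \<omega>)\<^sup>2 \<partial>M)" for k
    proof -
      have int2: "integrable M (\<lambda>\<omega>. (W_sum (l k) \<omega> - J \<omega>)\<^sup>2)"
      proof (rule Bochner_Integration.integrable_bound)
        show "integrable M (\<lambda>\<omega>. 2 * (W_sum (l k) \<omega>)\<^sup>2 + 2 * (J \<omega>)\<^sup>2)"
          using integrable_W_sum_square[OF l0 v, of k] J2 by simp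
        show "AE \<omega> in M. norm ((W_sum (l k) \<omega> - J \<omega>)\<^sup>2) \<le> norm (2 * (W_sum (l k) \<omega>)\<^sup>2 + 2 * (J \<omega>)\<^sup>2)"
          using square_add_le[of "W_sum (l k) \<omega>" "- J \<omega>" for \<omega>] by (intro AE_I2) simp
      qed simp
      have int1: "integrable M (\<lambda>\<omega>. \<bar>W_sum (l k) \<omega> - J \<omega>\<bar>)"
        using integrable_mult_squares[of "\<lambda>\<omega>. \<bar>W_sum (l k) \<omega> - J \<omega>\<bar>" M "\<lambda>_. 1"] int2 by simp
      have iexp: "integrable M (\<lambda>\<omega>. iexp (t * Z \<omega>))" if [measurable]: "Z \<in> borel_measurable M" for Z
        by (rule integrable_const_bound[of _ 1]) (auto simp del: of_real_mult)
      have "?c k - char (distr M borel (\<lambda>\<omega>. X \<omega> + J \<omega>)) t =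
          (CLINT \<omega>|M. iexp (t * (X \<omega> + W_sum (l k) \<omega>))) - (CLINT \<omega>|M. iexp (t * (X \<omega> + J \<omega>)))"
        by (simp add: char_def integral_distr)
      also have "\<dots> = (CLINT \<omega>|M. iexp (t * (X \<omega> + W_sum (l k) \<omega>)) - iexp (t * (X \<omega> + J \<omega>)))"
        by (rule Bochner_Integration.integral_diff[symmetric]) (intro iexp, measurable)+
      also have "norm \<dots> \<le> (\<integral>\<omega>. \<bar>t\<bar> * \<bar>W_sum (l k) \<omega> - J \<omega>\<bar> \<partial>M)"
      proof (rule order_trans[OF integral_norm_bound integral_mono])
        show "integrable M (\<lambda>\<omega>. norm (iexp (t * (X \<omega> + W_sum (l k) \<omega>)) - iexp (t * (X \<omega> + J \<omega>))))"
          by (intro integrable_norm Bochner_Integration.integrable_diff iexp) measurable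
        show "integrable M (\<lambda>\<omega>. \<bar>t\<bar> * \<bar>W_sum (l k) \<omega> - J \<omega>\<bar>)"
          using int1 by simp
        show "norm (iexp (t * (X \<omega> + W_sum (l k) \<omega>)) - iexp (t * (X \<omega> + J \<omega>))) \<le>
            \<bar>t\<bar> * \<bar>W_sum (l k) \<omega> - J \<omega>\<bar>" for \<omega>
          using norm_iexp_diff_le[of "t * (X \<omega> + W_sum (l k) \<omega>)" "t * (X \<omega> + J \<omega>)"]
          by (simp only: right_diff_distrib[symmetric] abs_mult add_diff_cancel_left)
      qed
      also have "\<dots> = \<bar>t\<bar> * (\<integral>\<omega>. \<bar>W_sum (l k) \<omega> - J \<omega>\<bar> \<partial>M)"
        by simp
      also have "(\<integral>\<omega>. \<bar>W_sum (l k) \<omega> - J \<omega>\<bar> \<partial>M) \<le> sqrt (\<integral>\<omega>. (W_sum (l k) \<omega> - J \<omega>)\<^sup>2 \<partial>M)"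
        using integral_Cauchy_Schwarz[of "\<lambda>\<omega>. \<bar>W_sum (l k) \<omega> - J \<omega>\<bar>" M "\<lambda>_. 1"] int2 prob_space by simp
      finally show ?thesis
        by (simp add: mult_left_mono)
    qed
    moreover have "(\<lambda>k. \<bar>t\<bar> * sqrt (\<integral>\<omega>. (W_sum (l k) \<omega> - J \<omega>)\<^sup>2 \<partial>M)) \<longlonglongrightarrow> 0"
      using tendsto_mult[OF tendsto_const tendsto_real_sqrt[OF dist], of "\<bar>t\<bar>"] by simp
    ultimately have "(\<lambda>k. ?c k - char (distr M borel (\<lambda>\<omega>. X \<omega> + J \<omega>)) t) \<longlonglongrightarrow> 0"
      by (rule LIMSEQ_null_comparison)
    then show "?c \<longlonglongrightarrow> char (distr M borel (\<lambda>\<omega>. X \<omega> + J \<omega>)) t"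
      by (rule LIM_zero_cancel)
  qed
qed

text \<open>The Ito isometry makes the sums Cauchy in \<open>L\<^sup>2\<close>; Fatou's lemma identifies their limit.\<close>

lemma wienerI_pointwise:
  assumes l: "\<And>k. steps_in u v (l k)" and "0 \<le> u" "u \<le> v"
    and [measurable]: "\<phi> \<in> borel_measurable borel" "J \<in> borel_measurable M"
    and \<phi>: "(\<lambda>k. \<integral>\<^sup>+r. ennreal ((step_fun (l k) r - \<phi> r)\<^sup>2) \<partial>lborel) \<longlonglongrightarrow> 0"
    and J: "AE \<omega> in M. (\<lambda>k. W_sum (l k) \<omega>) \<longlonglongrightarrow> J \<omega>"
  shows "wiener u v \<phi> J"
proof -
  have l0: "steps_in 0 v (l k)" for k
    using steps_in_mono[OF l(1) \<open>0 \<le> u\<close> order_refl] .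
  have v: "0 \<le> v" using assms by simp
  note [measurable] = W_sum_measurable[OF l0]
  define d where "d k = (\<integral>\<^sup>+r. ennreal ((step_fun (l k) r - \<phi> r)\<^sup>2) \<partial>lborel)" for k
  have diff: "(\<integral>\<^sup>+\<omega>. ennreal ((W_sum (l k) \<omega> - W_sum (l m) \<omega>)\<^sup>2) \<partial>M) \<le> 2 * d k + 2 * d m" for k m
  proof -
    \<comment> \<open>Written as a single step list, the difference of two sums falls under the
      isometry; \<phi> is then inserted between the two step functions.\<close>
    define n where "n = l k @ scale_steps (-1) (l m)"
    have n: "steps_in 0 v n"
      using l0 by (simp add: n_def)
    have "(\<integral>\<^sup>+\<omega>. ennreal ((W_sum (l k) \<omega> - W_sum (l m) \<omega>)\<^sup>2) \<partial>M) = (\<integral>\<^sup>+\<omega>. ennreal ((W_sum n \<omega>)\<^sup>2) \<partial>M)"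
      by (simp add: n_def increment_sum_append increment_sum_scale)
    also have "\<dots> = (\<integral>\<^sup>+r. ennreal ((step_fun n r)\<^sup>2) \<partial>lborel)"
      using integrable_W_sum_square[OF n v] integrable_step_fun_square[OF n v]
      by (simp add: nn_integral_square_eq_integral W_sum_isometry[OF n v])
    also have "\<dots> = (\<integral>\<^sup>+r. ennreal (((step_fun (l k) r - \<phi> r) + (\<phi> r - step_fun (l m) r))\<^sup>2) \<partial>lborel)"
      by (simp add: n_def step_fun_append step_fun_scale)
    also have "\<dots> \<le> (\<integral>\<^sup>+r. 2 * ennreal ((step_fun (l k) r - \<phi> r)\<^sup>2) + 2 * ennreal ((step_fun (l m) r - \<phi> r)\<^sup>2) \<partial>lborel)"
    proof (rule nn_integral_mono)
      fix r
      have "ennreal (((step_fun (l k) r - \<phi> r) + (\<phi> r - step_fun (l m) r))\<^sup>2) \<le>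
          ennreal (2 * (step_fun (l k) r - \<phi> r)\<^sup>2 + 2 * (step_fun (l m) r - \<phi> r)\<^sup>2)"
        using square_add_le[of "step_fun (l k) r - \<phi> r" "\<phi> r - step_fun (l m) r"]
        by (intro ennreal_leI) (simp only: power2_commute[of "\<phi> r"])
      also have "\<dots> = 2 * ennreal ((step_fun (l k) r - \<phi> r)\<^sup>2) + 2 * ennreal ((step_fun (l m) r - \<phi> r)\<^sup>2)"
        by (simp add: ennreal_plus ennreal_mult)
      finally show "ennreal (((step_fun (l k) r - \<phi> r) + (\<phi> r - step_fun (l m) r))\<^sup>2) \<le>
          2 * ennreal ((step_fun (l k) r - \<phi> r)\<^sup>2) + 2 * ennreal ((step_fun (l m) r - \<phi> r)\<^sup>2)" .
    qed
    also have "\<dots> = 2 * d k + 2 * d m"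
      by (simp add: d_def nn_integral_add nn_integral_cmult)
    finally show ?thesis .
  qed
  have "(\<integral>\<^sup>+\<omega>. ennreal ((W_sum (l k) \<omega> - J \<omega>)\<^sup>2) \<partial>M) \<le> 2 * d k" for k
  proof -
    have "(\<integral>\<^sup>+\<omega>. ennreal ((W_sum (l k) \<omega> - J \<omega>)\<^sup>2) \<partial>M) =
        (\<integral>\<^sup>+\<omega>. liminf (\<lambda>m. ennreal ((W_sum (l k) \<omega> - W_sum (l m) \<omega>)\<^sup>2)) \<partial>M)"
    proof (rule nn_integral_cong_AE)
      show "AE \<omega> in M. ennreal ((W_sum (l k) \<omega> - J \<omega>)\<^sup>2) =
          liminf (\<lambda>m. ennreal ((W_sum (l k) \<omega> - W_sum (l m) \<omega>)\<^sup>2))"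
        using J
      proof eventually_elim
        case (elim \<omega>)
        then have "(\<lambda>m. ennreal ((W_sum (l k) \<omega> - W_sum (l m) \<omega>)\<^sup>2)) \<longlonglongrightarrow> ennreal ((W_sum (l k) \<omega> - J \<omega>)\<^sup>2)"
          by (intro tendsto_intros)
        then show ?case
          by (rule lim_imp_Liminf[OF sequentially_bot, symmetric])
      qed
    qed
    also have "\<dots> \<le> liminf (\<lambda>m. \<integral>\<^sup>+\<omega>. ennreal ((W_sum (l k) \<omega> - W_sum (l m) \<omega>)\<^sup>2) \<partial>M)"
      by (rule nn_integral_liminf) simp
    also have "\<dots> \<le> liminf (\<lambda>m. 2 * d k + 2 * d m)"
      by (intro Liminf_mono always_eventually allI diff)
    also have "\<dots> = 2 * d k"
    proof (rule lim_imp_Liminf[OF sequentially_bot])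
      have "(\<lambda>m. 2 * d k + 2 * d m) \<longlonglongrightarrow> 2 * d k + 2 * 0"
        using \<phi> unfolding d_def by (intro tendsto_add ennreal_tendsto_cmult tendsto_const) auto
      then show "(\<lambda>m. 2 * d k + 2 * d m) \<longlonglongrightarrow> 2 * d k" by simp
    qed
    finally show ?thesis .
  qed
  moreover have "(\<lambda>k. 2 * d k) \<longlonglongrightarrow> 0"
    using ennreal_tendsto_cmult[of 2, OF _ \<phi>] by (simp add: d_def)
  ultimately have "(\<lambda>k. \<integral>\<^sup>+\<omega>. ennreal ((W_sum (l k) \<omega> - J \<omega>)\<^sup>2) \<partial>M) \<longlonglongrightarrow> 0"
    by (rule ennreal_LIMSEQ_null_comparison)
  with l \<phi> show ?thesis
    unfolding wiener_def by (intro conjI exI[of _ l]) auto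
qed

text \<open>Half-open steps vanish at the left end point u, where z may take any value; the two
  integrands agree off this single point.\<close>

lemma nn_integral_step_fun_diff:
  assumes "steps_in u v l"
  shows "(\<integral>\<^sup>+r\<in>{u..v}. ennreal ((step_fun l r - z r)\<^sup>2) \<partial>lborel) =
    (\<integral>\<^sup>+r. ennreal ((step_fun l r - indicator {u<..v} r * z r)\<^sup>2) \<partial>lborel)"
proof (rule nn_integral_cong_AE)
  have "AE r in lborel. r \<noteq> u"
    by (rule AE_lborel_singleton)
  then show "AE r in lborel. ennreal ((step_fun l r - z r)\<^sup>2) * indicator {u..v} r =
      ennreal ((step_fun l r - indicator {u<..v} r * z r)\<^sup>2)"
    by eventually_elim (use step_fun_outside[OF assms] in \<open>auto simp: indicator_def\<close>)
qed

lemma is_stochastic_integral_imp_wiener: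
  assumes "is_stochastic_integral M W z u v J"
    and z: "(\<lambda>r. indicator {u<..v} r * z r) \<in> borel_measurable borel"
  shows "wiener u v (\<lambda>r. indicator {u<..v} r * z r) J"
proof -
  obtain n \<tau> c where J: "J \<in> borel_measurable M"
    and \<tau>: "\<And>k. mono_on {..n k} (\<tau> k)" "\<And>k. \<tau> k ` {..n k} \<subseteq> {u..v}"
    and lim: "(\<lambda>k. \<integral>\<^sup>+r\<in>{u..v}. ennreal ((step_function (n k) (\<tau> k) (c k) r - z r)\<^sup>2) \<partial>lborel) \<longlonglongrightarrow> 0"
      "(\<lambda>k. \<integral>\<^sup>+\<omega>. ennreal ((step_integral W (n k) (\<tau> k) (c k) \<omega> - J \<omega>)\<^sup>2) \<partial>M) \<longlonglongrightarrow> 0"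
    using assms(1) unfolding is_stochastic_integral_def by blast
  define l where "l k = partition_steps (n k) (\<tau> k) (c k)" for k
  have l: "steps_in u v (l k)" for k
    unfolding l_def by (intro steps_in_partition \<tau>)
  have "(\<lambda>k. \<integral>\<^sup>+r. ennreal ((step_fun (l k) r - indicator {u<..v} r * z r)\<^sup>2) \<partial>lborel) \<longlonglongrightarrow> 0"
    using lim(1) unfolding nn_integral_step_fun_diff[OF l, symmetric]
    by (simp add: l_def step_function_eq_step_fun[OF \<tau>(1)])
  moreover have "(\<lambda>k. \<integral>\<^sup>+\<omega>. ennreal ((W_sum (l k) \<omega> - J \<omega>)\<^sup>2) \<partial>M) \<longlonglongrightarrow> 0"
    using lim(2) by (simp add: l_def step_integral_eq_increment_sum)
  ultimately show ?thesis
    using l J z unfolding wiener_def by blast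
qed

text \<open>Each overlapping list is rewritten on its common grid, which changes neither the step
  function nor the sum.\<close>

lemma wiener_imp_is_stochastic_integral:
  assumes "wiener u v (\<lambda>r. indicator {u<..v} r * z r) J" and "u \<le> v"
  shows "is_stochastic_integral M W z u v J"
proof -
  obtain l where J: "J \<in> borel_measurable M" and l: "\<And>k. steps_in u v (l k)"
    and lim: "(\<lambda>k. \<integral>\<^sup>+r. ennreal ((step_fun (l k) r - indicator {u<..v} r * z r)\<^sup>2) \<partial>lborel) \<longlonglongrightarrow> 0"
      "(\<lambda>k. \<integral>\<^sup>+\<omega>. ennreal ((W_sum (l k) \<omega> - J \<omega>)\<^sup>2) \<partial>M) \<longlonglongrightarrow> 0"
    using assms(1) by (auto simp: wiener_def)
  have "\<exists>n \<tau> c. mono \<tau> \<and> range \<tau> \<subseteq> {u..v} \<and>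
      (\<forall>F. increment_sum (l k) F = increment_sum (partition_steps n \<tau> c) F)" for k
    using steps_in_imp_partition[OF l \<open>u \<le> v\<close>, of k] by metis
  then obtain n \<tau> c where \<tau>: "\<And>k. mono (\<tau> k)" "\<And>k. range (\<tau> k) \<subseteq> {u..v}"
    and eq: "\<And>k F. increment_sum (l k) F = increment_sum (partition_steps (n k) (\<tau> k) (c k)) F"
    by metis
  have mono: "mono_on {..n k} (\<tau> k)" for k
    using \<tau>(1) by (rule mono_on_subset) simp
  have "step_fun (l k) r = step_function (n k) (\<tau> k) (c k) r" for k r
    by (simp add: step_function_eq_step_fun[OF mono] step_fun_def eq)
  then have "(\<lambda>k. \<integral>\<^sup>+r\<in>{u..v}. ennreal ((step_function (n k) (\<tau> k) (c k) r - z r)\<^sup>2) \<partial>lborel) \<longlonglongrightarrow> 0"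
    using lim(1) unfolding nn_integral_step_fun_diff[OF l, symmetric] by simp
  moreover have "(\<lambda>k. \<integral>\<^sup>+\<omega>. ennreal ((step_integral W (n k) (\<tau> k) (c k) \<omega> - J \<omega>)\<^sup>2) \<partial>M) \<longlonglongrightarrow> 0"
    using lim(2) by (simp add: step_integral_eq_increment_sum eq)
  moreover have "\<tau> k ` {..n k} \<subseteq> {u..v}" for k
    using \<tau>(2)[of k] by auto
  ultimately show ?thesis
    unfolding is_stochastic_integral_def using J mono by blast
qed

end

section \<open>Linear integral equations\<close>

lemma set_integrable_continuous_mult:
  fixes h g :: "real \<Rightarrow> real"
  assumes h: "continuous_on {p..q} h" and g: "set_integrable lborel {p..q} g"
  shows "set_integrable lborel {p..q} (\<lambda>r. h r * g r)"
proof -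
  have "bounded (h ` {p..q})"
    by (intro compact_imp_bounded compact_continuous_image h) simp
  then obtain C where "\<forall>y\<in>h ` {p..q}. norm y \<le> C"
    unfolding bounded_iff by blast
  then have C: "\<bar>h r\<bar> \<le> C" if "r \<in> {p..q}" for r
    using that by simp
  have [measurable]: "(\<lambda>r. indicator {p..q} r * h r) \<in> borel_measurable borel"
    using borel_measurable_continuous_on_indicator[OF _ h] by simp
  have g': "integrable lborel (\<lambda>r. indicator {p..q} r * g r)"
    using g by (simp add: set_integrable_def)
  note [measurable] = borel_measurable_integrable[OF g']
  have "integrable lborel (\<lambda>r. (indicator {p..q} r * h r) * (indicator {p..q} r * g r))"
  proof (rule Bochner_Integration.integrable_bound)
    show "integrable lborel (\<lambda>r. C * (indicator {p..q} r * g r))"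
      using g' by simp
    show "AE r in lborel. norm ((indicator {p..q} r * h r) * (indicator {p..q} r * g r)) \<le>
        norm (C * (indicator {p..q} r * g r))"
      using C by (intro AE_I2) (auto simp: indicator_def abs_mult intro!: mult_right_mono order_trans[OF C abs_ge_self])
  qed measurable
  moreover have "(indicator {p..q} r * h r) * (indicator {p..q} r * g r) = indicator {p..q} r *\<^sub>R (h r * g r)" for r
    by (simp add: indicator_def)
  ultimately show ?thesis
    by (simp add: set_integrable_def)
qed

lemma set_integral_combine:
  fixes f :: "real \<Rightarrow> real"
  assumes f: "set_integrable lborel {p..q} f" and t: "p \<le> t" "t \<le> q"
  shows "(LINT r:{p..q}|lborel. f r) = (LINT r:{p..t}|lborel. f r) + (LINT r:{t..q}|lborel. f r)"
proof -
  have "set_integrable lborel {p..t} f" "set_integrable lborel {t..q} f"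
    using t by (auto intro: set_integrable_subset[OF f])
  then show ?thesis
    using f t Henstock_Kurzweil_Integration.integral_combine[of p t q f]
    by (simp add: set_borel_integral_eq_integral)
qed

lemma set_integral_singleton:
  fixes f :: "real \<Rightarrow> real"
  shows "(LINT r:{p..p}|lborel. f r) = 0"
  unfolding set_lebesgue_integral_def
proof (rule integral_eq_zero_AE)
  have "AE r in lborel. r \<noteq> p"
    by (rule AE_lborel_singleton)
  then show "AE r in lborel. indicator {p..p} r *\<^sub>R f r = 0"
    by eventually_elim simp
qed

lemma continuous_on_set_integral:
  fixes f :: "real \<Rightarrow> real"
  assumes f: "set_integrable lborel {p..q} f"
  shows "continuous_on {p..q} (\<lambda>t. LINT r:{p..t}|lborel. f r)"
proof -
  have "set_integrable lborel {p..t} f" if "t \<in> {p..q}" for t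
    using that by (intro set_integrable_subset[OF f]) auto
  then have "(LINT r:{p..t}|lborel. f r) = integral {p..t} f" if "t \<in> {p..q}" for t
    using that by (simp add: set_borel_integral_eq_integral)
  moreover have "continuous_on {p..q} (\<lambda>t. integral {p..t} f)"
    by (intro indefinite_integral_continuous_1 set_borel_integral_eq_integral f)
  ultimately show ?thesis
    by (elim continuous_on_eq) simp
qed

text \<open>An increment of the primitive is the integral of g against
  \<open>of_bool (r \<le> q) - of_bool (r \<le> p)\<close>, and this is how \<open>step_fun\<close>
  reads the same step. Linearity along the list does the rest.\<close>

lemma
  fixes g :: "real \<Rightarrow> real"
  assumes l: "steps_in 0 v l" and g: "set_integrable lborel {0..v} g"
  shows set_integrable_step_fun_mult: "set_integrable lborel {0..v} (\<lambda>r. step_fun l r * g r)"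
    and increment_sum_set_integral: "increment_sum l (\<lambda>x. LINT r:{0..x}|lborel. g r) =
      (LINT r:{0..v}|lborel. step_fun l r * g r)"
proof -
  have cut: "set_integrable lborel {0..v} (\<lambda>r. of_bool (r \<le> x) * g r)"
      "(LINT r:{0..x}|lborel. g r) = (LINT r:{0..v}|lborel. of_bool (r \<le> x) * g r)" if "0 \<le> x" "x \<le> v" for x
  proof -
    have "indicator {0..v} r *\<^sub>R (of_bool (r \<le> x) * g r) = indicator {0..x} r *\<^sub>R g r" for r
      using that by (auto simp: indicator_def)
    moreover have "set_integrable lborel {0..x} g"
      using that by (intro set_integrable_subset[OF g]) auto
    ultimately show "set_integrable lborel {0..v} (\<lambda>r. of_bool (r \<le> x) * g r)"
      "(LINT r:{0..x}|lborel. g r) = (LINT r:{0..v}|lborel. of_bool (r \<le> x) * g r)"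
      by (simp_all only: set_integrable_def set_lebesgue_integral_def)
  qed
  have "set_integrable lborel {0..v} (\<lambda>r. step_fun l r * g r) \<and>
      increment_sum l (\<lambda>x. LINT r:{0..x}|lborel. g r) = (LINT r:{0..v}|lborel. step_fun l r * g r)"
    using l
  proof (induction l)
    case (Cons a l)
    obtain c p q where a: "a = (c, p, q)" by (cases a)
    have pq: "0 \<le> p" "p \<le> v" "0 \<le> q" "q \<le> v"
      using Cons.prems by (auto simp: a steps_in_def)
    have IH: "set_integrable lborel {0..v} (\<lambda>r. step_fun l r * g r)"
      "increment_sum l (\<lambda>x. LINT r:{0..x}|lborel. g r) = (LINT r:{0..v}|lborel. step_fun l r * g r)"
      using Cons by (simp_all add: steps_in_def)
    have eq: "step_fun (a # l) r * g r =
        c * (of_bool (r \<le> q) * g r - of_bool (r \<le> p) * g r) + step_fun l r * g r" for r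
      by (simp add: a step_fun_def increment_sum_Cons algebra_simps)
    show ?case
      unfolding eq using cut(1)[OF pq(1,2)] cut(1)[OF pq(3,4)] IH
      by (simp add: a increment_sum_Cons cut(2) pq set_integral_add set_integral_diff)
  qed (simp add: step_fun_def set_integrable_def)
  then show "set_integrable lborel {0..v} (\<lambda>r. step_fun l r * g r)"
    "increment_sum l (\<lambda>x. LINT r:{0..x}|lborel. g r) = (LINT r:{0..v}|lborel. step_fun l r * g r)"
    by blast+
qed

lemma exp_steps_set_integral_tendsto:
  fixes g :: "real \<Rightarrow> real"
  assumes g: "set_integrable lborel {0..t} g" and "0 \<le> t"
  shows "(\<lambda>n. increment_sum (exp_steps a 0 t (Suc n)) (\<lambda>x. LINT r:{0..x}|lborel. g r)) \<longlonglongrightarrow>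
    (LINT r:{0..t}|lborel. exp (a * (t - r)) * g r)"
proof -
  have l: "steps_in 0 t (exp_steps a 0 t (Suc n))" for n
    using \<open>0 \<le> t\<close> by (simp add: steps_in_exp_steps)
  have g': "integrable lborel (\<lambda>r. indicator {0..t} r * g r)"
    using g by (simp add: set_integrable_def)
  note [measurable] = borel_measurable_integrable[OF g']
  have swap: "indicator {0..t} r *\<^sub>R (h * g r) = h * (indicator {0..t} r * g r)" for r h :: real
    by simp
  show ?thesis
    unfolding increment_sum_set_integral[OF l g]
    unfolding set_lebesgue_integral_def swap
  proof (rule integral_dominated_convergence)
    show "integrable lborel (\<lambda>r. exp (\<bar>a\<bar> * (t - 0)) * \<bar>indicator {0..t} r * g r\<bar>)"
      using g' by simp
    show "AE r in lborel. norm (step_fun (exp_steps a 0 t (Suc n)) r * (indicator {0..t} r * g r)) \<le>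
        exp (\<bar>a\<bar> * (t - 0)) * \<bar>indicator {0..t} r * g r\<bar>" for n
      using step_fun_exp_steps_bound[OF \<open>0 \<le> t\<close>, of a n]
      by (intro AE_I2) (simp only: real_norm_def abs_mult, intro mult_right_mono, auto)
    \<comment> \<open>The point 0 has to be discarded: it lies in {0..t}, but the half-open steps
      miss it.\<close>
    have "AE r in lborel. r \<noteq> (0::real)"
      by (rule AE_lborel_singleton)
    then show "AE r in lborel. (\<lambda>n. step_fun (exp_steps a 0 t (Suc n)) r * (indicator {0..t} r * g r))
        \<longlonglongrightarrow> exp (a * (t - r)) * (indicator {0..t} r * g r)"
    proof eventually_elim
      case (elim r)
      show ?case
      proof (cases "r \<in> {0<..t}")
        case True
        then show ?thesis
          using step_fun_exp_steps_tendsto[OF \<open>0 \<le> t\<close> True, of a] by (intro tendsto_mult_right)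
      next
        case False
        with elim show ?thesis by (auto simp: indicator_def)
      qed
    qed
  qed measurable
qed

text \<open>k is what remains of u after removal of the linear drift. The exponential weights
  recover u from k alone, for a k that is only continuous.\<close>

lemma integral_equation_limit:
  fixes u k :: "real \<Rightarrow> real"
  assumes u: "continuous_on {0..T} u" and t: "t \<in> {0..T}"
    and k: "\<And>x. x \<in> {0..T} \<Longrightarrow> k x = u x - a * (LINT r:{0..x}|lborel. u r)"
  shows "(\<lambda>n. increment_sum (exp_steps a 0 t (Suc n)) k) \<longlonglongrightarrow> u t - exp (a * t) * u 0"
proof -
  have sub: "{0..t} \<subseteq> {0..T}"
    using t by auto
  have "(\<lambda>n. increment_sum (exp_steps a 0 t (Suc n)) k) \<longlonglongrightarrow> u t - exp (a * (t - 0)) * u 0"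
    using t sub continuous_on_subset[OF u sub]
    by (intro exp_steps_tendsto[where S = "\<lambda>x. LINT r:{0..x}|lborel. u r"])
      (auto simp: k intro!: DERIV_subset[OF has_real_derivative_set_integral[OF u] sub])
  then show ?thesis by simp
qed

text \<open>The exponential sums of the primitive of g have two limits, one from the equation for u
  and one from dominated convergence; their equality is variation of constants. This is the
  deterministic twin of the law of the stochastic equation below, where the noise contributes a
  third term.\<close>

lemma linear_integral_equation:
  fixes u g :: "real \<Rightarrow> real"
  assumes u: "continuous_on {0..T} u" and g: "set_integrable lborel {0..T} g"
    and eq: "\<And>x. x \<in> {0..T} \<Longrightarrow> u x = u0 + (LINT r:{0..x}|lborel. a * u r + g r)"
    and t: "t \<in> {0..T}"
  shows "u t = exp (a * t) * u0 + (LINT r:{0..t}|lborel. exp (a * (t - r)) * g r)"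
proof -
  define K where "K x = (LINT r:{0..x}|lborel. g r)" for x
  have k: "u0 + K x = u x - a * (LINT r:{0..x}|lborel. u r)" if "x \<in> {0..T}" for x
  proof -
    have sub: "{0..x} \<subseteq> {0..T}" using that by auto
    have "set_integrable lborel {0..x} g" "set_integrable lborel {0..x} (\<lambda>r. a * u r)"
      using set_integrable_subset[OF g _ sub] continuous_on_subset[OF u sub]
      by (simp_all add: borel_integrable_atLeastAtMost')
    then show ?thesis
      unfolding eq[OF that] K_def by (simp add: set_integral_add)
  qed
  have "increment_sum l (\<lambda>x. u0 + K x) = increment_sum l K" for l
    using increment_sum_linear[of l 1 "\<lambda>_. u0" 1 K] by (simp add: increment_sum_def)
  then have "(\<lambda>n. increment_sum (exp_steps a 0 t (Suc n)) K) \<longlonglongrightarrow> u t - exp (a * t) * u 0"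
    using integral_equation_limit[OF u t, of "\<lambda>x. u0 + K x" a] k by simp
  moreover have "(\<lambda>n. increment_sum (exp_steps a 0 t (Suc n)) K) \<longlonglongrightarrow>
      (LINT r:{0..t}|lborel. exp (a * (t - r)) * g r)"
    unfolding K_def[abs_def] using t
    by (intro exp_steps_set_integral_tendsto set_integrable_subset[OF g]) auto
  ultimately have "u t - exp (a * t) * u 0 = (LINT r:{0..t}|lborel. exp (a * (t - r)) * g r)"
    by (rule LIMSEQ_unique)
  moreover have "u 0 = u0"
  proof -
    show ?thesis using eq[of 0] t by (simp add: set_integral_singleton del: atLeastAtMost_singleton)
  qed
  ultimately show ?thesis by simp
qed

section \<open>Gaussian law of a linear equation with Wiener noise\<close>

context brownian_setting
begin

lemma wiener_increment_sum:
  assumes "0 \<le> u" and l: "steps_in p q l" and "\<And>x. x \<in> {p..q} \<Longrightarrow> wiener u v (\<phi> x) (J x)"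
  shows "wiener u v (\<lambda>r. increment_sum l (\<lambda>x. \<phi> x r)) (\<lambda>\<omega>. increment_sum l (\<lambda>x. J x \<omega>))"
  using l
proof (induction l)
  case (Cons a l)
  obtain c p' q' where a: "a = (c, p', q')" by (cases a)
  have "p' \<in> {p..q}" "q' \<in> {p..q}" "steps_in p q l"
    using Cons.prems by (auto simp: a steps_in_def)
  with Cons.IH assms(3) have w: "wiener u v (\<phi> q') (J q')" "wiener u v (\<phi> p') (J p')"
    "wiener u v (\<lambda>r. increment_sum l (\<lambda>x. \<phi> x r)) (\<lambda>\<omega>. increment_sum l (\<lambda>x. J x \<omega>))"
    by blast+
  from wiener_linear[OF wiener_linear[OF w(1,2) \<open>0 \<le> u\<close>, of 1 "-1"] w(3) \<open>0 \<le> u\<close>, of c 1]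
  show ?case
    by (simp add: a increment_sum_Cons)
qed (simp add: wiener_zero)

text \<open>The exponential sums \<open>R n\<close> of the noise are Wiener integrals with integrand
  \<open>step_fun (l n) r * z r\<close> on (0, t], so X + \<open>R n\<close> has an explicit
  characteristic function. Path by path they converge to Y(t) - X, where X is a function of Y(0).
  Comparing the two limits gives the law of Y(t).\<close>

lemma distr_linear_sde:
  assumes Y0: "Y 0 \<in> borel_measurable (filt 0)" "distr M borel (Y 0) = gaussian_law m0 V0" "0 \<le> V0"
    and Y: "\<And>t. t \<in> {0..T} \<Longrightarrow> Y t \<in> borel_measurable M"
    and cont: "AE \<omega> in M. continuous_on {0..T} (\<lambda>t. Y t \<omega>)"
    and g: "set_integrable lborel {0..T} g"
    and J: "\<And>t. t \<in> {0..T} \<Longrightarrow> wiener t T (\<lambda>r. indicator {t<..T} r * z r) (J t)"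
    and eq: "\<And>t. t \<in> {0..T} \<Longrightarrow>
      AE \<omega> in M. Y t \<omega> = Y 0 \<omega> + (LINT r:{0..t}|lborel. a * Y r \<omega> + g r) + (J 0 \<omega> - J t \<omega>)"
    and t: "t \<in> {0..T}"
  shows "distr M borel (Y t) = gaussian_law
    (exp (a * t) * m0 + (LINT r:{0..t}|lborel. exp (a * (t - r)) * g r))
    ((exp (a * t))\<^sup>2 * V0 + (LINT r:{0..t}|lborel. (exp (a * (t - r)) * z r)\<^sup>2))"
proof -
  have T: "0 \<le> T" "0 \<le> t" "t \<le> T"
    using t by auto
  note [measurable] = Y[OF t] measurable_filt[OF Y0(1)]
  \<comment> \<open>Differences of the backward integrals over (x, T] give the forward noise over
    (0, x].\<close>
  define N where "N x \<omega> = J 0 \<omega> - J x \<omega>" for x \<omega>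
  have N: "wiener 0 T (\<lambda>r. indicator {0<..x} r * z r) (N x)" if "x \<in> {0..T}" for x
  proof -
    have "wiener 0 T (\<lambda>r. 1 * (indicator {0<..T} r * z r) + - 1 * (indicator {x<..T} r * z r))
        (\<lambda>\<omega>. 1 * J 0 \<omega> + - 1 * J x \<omega>)"
      using that T by (intro wiener_linear J wiener_mono[OF J[of x]]) auto
    also have "(\<lambda>r. 1 * (indicator {0<..T} r * z r) + - 1 * (indicator {x<..T} r * z r)) =
        (\<lambda>r. indicator {0<..x} r * z r)"
      using that by (auto simp: fun_eq_iff indicator_def)
    finally show ?thesis
      by (simp add: N_def[abs_def])
  qed
  define l where "l n = exp_steps a 0 t (Suc n)" for n
  have l: "steps_in 0 t (l n)" for n
    using T by (simp add: l_def steps_in_exp_steps)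
  define \<zeta> where "\<zeta> r = indicator {0<..t} r * z r" for r
  define R where "R n \<omega> = increment_sum (l n) (\<lambda>x. N x \<omega>)" for n \<omega>
  have R: "wiener 0 T (\<lambda>r. step_fun (l n) r * \<zeta> r) (R n)" for n
  proof -
    have "wiener 0 T (\<lambda>r. increment_sum (l n) (\<lambda>x. indicator {0<..x} r * z r)) (R n)"
      unfolding R_def[abs_def] using T by (intro wiener_increment_sum[OF _ l] N) auto
    also have "(\<lambda>r. increment_sum (l n) (\<lambda>x. indicator {0<..x} r * z r)) = (\<lambda>r. step_fun (l n) r * \<zeta> r)"
    proof
      fix r
      \<comment> \<open>The added \<open>0 * 0\<close> brings the argument into the two-term shape
        of \<open>increment_sum_linear\<close>.\<close>
      have "increment_sum (l n) (\<lambda>x. indicator {0<..x} r * z r) =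
          increment_sum (l n) (\<lambda>x. (of_bool (0 < r) * z r) * of_bool (r \<le> x) + 0 * 0)"
        by (intro arg_cong2[where f = increment_sum] refl ext) (simp add: indicator_def)
      also have "\<dots> = (of_bool (0 < r) * z r) * step_fun (l n) r"
        unfolding increment_sum_linear step_fun_def by simp
      also have "\<dots> = step_fun (l n) r * \<zeta> r"
        using step_fun_outside[OF l, of r] by (auto simp: \<zeta>_def indicator_def)
      finally show "increment_sum (l n) (\<lambda>x. indicator {0<..x} r * z r) = step_fun (l n) r * \<zeta> r" .
    qed
    finally show ?thesis .
  qed
  note [measurable] = wiener_measurable[OF R]
  have \<zeta>: "integrable lborel (\<lambda>r. (\<zeta> r)\<^sup>2)" and [measurable]: "\<zeta> \<in> borel_measurable borel"
    using wiener_square_integrable[OF N[OF t]] N[OF t] T by (auto simp: \<zeta>_def[abs_def] wiener_def)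
  define \<sigma> where "\<sigma> = (LINT r:{0..t}|lborel. (exp (a * (t - r)) * z r)\<^sup>2)"
  have \<sigma>: "(\<lambda>n. \<integral>r. (step_fun (l n) r * \<zeta> r)\<^sup>2 \<partial>lborel) \<longlonglongrightarrow> \<sigma>"
  proof -
    have "(\<lambda>n. \<integral>r. (step_fun (l n) r * \<zeta> r)\<^sup>2 \<partial>lborel) \<longlonglongrightarrow> (\<integral>r. (exp (a * (t - r)) * \<zeta> r)\<^sup>2 \<partial>lborel)"
    proof (rule tendsto_integral_square)
      show "integrable lborel (\<lambda>r. (step_fun (l n) r * \<zeta> r)\<^sup>2)" for n
        by (rule wiener_square_integrable[OF R]) (use T in auto)
      show "(\<lambda>n. \<integral>\<^sup>+r. ennreal ((step_fun (l n) r * \<zeta> r - exp (a * (t - r)) * \<zeta> r)\<^sup>2) \<partial>lborel) \<longlonglongrightarrow> 0"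
      proof (rule L2_dominated_convergence)
        show "integrable lborel (\<lambda>r. (exp (\<bar>a\<bar> * (t - 0)) * \<bar>\<zeta> r\<bar>)\<^sup>2)"
          using \<zeta> by (simp add: power_mult_distrib)
        show "AE r in lborel. \<bar>step_fun (l n) r * \<zeta> r\<bar> \<le> exp (\<bar>a\<bar> * (t - 0)) * \<bar>\<zeta> r\<bar>" for n
          using step_fun_exp_steps_bound[OF T(2), of a n]
          by (intro AE_I2) (simp only: l_def abs_mult, intro mult_right_mono, auto)
        have "(\<lambda>n. step_fun (l n) r * \<zeta> r) \<longlonglongrightarrow> exp (a * (t - r)) * \<zeta> r" for r
        proof (cases "r \<in> {0<..t}")
          case True
          then show ?thesis
            unfolding l_def using step_fun_exp_steps_tendsto[OF T(2) True, of a] by (intro tendsto_mult_right)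
        qed (simp add: \<zeta>_def)
        then show "AE r in lborel. (\<lambda>n. step_fun (l n) r * \<zeta> r) \<longlonglongrightarrow> exp (a * (t - r)) * \<zeta> r"
          by simp
      qed measurable
    qed measurable
    also have "(\<integral>r. (exp (a * (t - r)) * \<zeta> r)\<^sup>2 \<partial>lborel) = \<sigma>"
      unfolding \<sigma>_def set_lebesgue_integral_def
    proof (rule integral_cong_AE)
      have "AE r in lborel. r \<noteq> (0::real)"
        by (rule AE_lborel_singleton)
      then show "AE r in lborel. (exp (a * (t - r)) * \<zeta> r)\<^sup>2 = indicator {0..t} r *\<^sub>R (exp (a * (t - r)) * z r)\<^sup>2"
        by eventually_elim (auto simp: \<zeta>_def indicator_def)
      \<comment> \<open>Measurability of z is available only through \<zeta>, on the half-open
        interval. The closed interval adds the point 0, where the integrand is a constant times an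
        indicator.\<close>
      have "(\<lambda>r. indicator {0} r * (exp (a * (t - r)) * z r)\<^sup>2 + (exp (a * (t - r)) * \<zeta> r)\<^sup>2) =
          (\<lambda>r. indicator {0} r * (exp (a * (t - 0)) * z 0)\<^sup>2 + (exp (a * (t - r)) * \<zeta> r)\<^sup>2)"
        by (auto simp: fun_eq_iff indicator_def)
      moreover have "(\<lambda>r. indicator {0..t} r *\<^sub>R (exp (a * (t - r)) * z r)\<^sup>2) =
          (\<lambda>r. indicator {0} r * (exp (a * (t - r)) * z r)\<^sup>2 + (exp (a * (t - r)) * \<zeta> r)\<^sup>2)"
        using T by (auto simp: fun_eq_iff indicator_def \<zeta>_def)
      ultimately show "(\<lambda>r. indicator {0..t} r *\<^sub>R (exp (a * (t - r)) * z r)\<^sup>2) \<in> borel_measurable lborel"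
        by simp
    qed measurable
    finally show ?thesis .
  qed
  define D where "D = (LINT r:{0..t}|lborel. exp (a * (t - r)) * g r)"
  define X where "X \<omega> = D + exp (a * t) * Y 0 \<omega>" for \<omega>
  have X: "X \<in> borel_measurable (filt 0)"
    unfolding X_def[abs_def] using Y0(1) by measurable
  note [measurable] = measurable_filt[OF X]
  have lim: "AE \<omega> in M. (\<lambda>n. X \<omega> + R n \<omega>) \<longlonglongrightarrow> Y t \<omega>"
  proof -
    have kn: "knot 0 t (Suc n) i \<in> {0..T}" if "i \<le> Suc n" for n i
      using knot_in[OF T(2) that] T by simp
    \<comment> \<open>The exceptional null set of the equation depends on the time, but only
      countably many knots occur. Between the knots N need not be continuous; at the knots it is
      replaced by k - u 0 - K, to which the path-wise limits apply.\<close>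
    have "AE \<omega> in M. \<forall>n. \<forall>i\<in>{..Suc n}. Y (knot 0 t (Suc n) i) \<omega> = Y 0 \<omega> +
        (LINT r:{0..knot 0 t (Suc n) i}|lborel. a * Y r \<omega> + g r) + N (knot 0 t (Suc n) i) \<omega>"
      unfolding N_def AE_all_countable
      by (intro allI AE_ball_countable[THEN iffD2] ballI eq kn) auto
    then show ?thesis
      using cont
    proof eventually_elim
      case (elim \<omega>)
      define u where "u r = Y r \<omega>" for r
      have u: "continuous_on {0..T} u"
        using elim(2) by (simp add: u_def)
      define k where "k x = u x - a * (LINT r:{0..x}|lborel. u r)" for x
      define K where "K x = (LINT r:{0..x}|lborel. g r)" for x
      have Nk: "N (knot 0 t (Suc n) i) \<omega> = k (knot 0 t (Suc n) i) - u 0 - K (knot 0 t (Suc n) i)"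
        if "i \<le> Suc n" for n i
      proof -
        let ?x = "knot 0 t (Suc n) i"
        have sub: "{0..?x} \<subseteq> {0..T}" using kn[OF that] by auto
        have "set_integrable lborel {0..?x} g" "set_integrable lborel {0..?x} (\<lambda>r. a * u r)"
          using set_integrable_subset[OF g _ sub] continuous_on_subset[OF u sub]
          by (simp_all add: borel_integrable_atLeastAtMost')
        then have "(LINT r:{0..?x}|lborel. a * u r + g r) = a * (LINT r:{0..?x}|lborel. u r) + K ?x"
          by (simp add: set_integral_add K_def)
        moreover have "u ?x = u 0 + (LINT r:{0..?x}|lborel. a * u r + g r) + N ?x \<omega>"
          using elim(1) that by (simp add: u_def)
        ultimately show ?thesis
          by (simp add: k_def)
      qed
      have "R n \<omega> = increment_sum (l n) k - increment_sum (l n) K" for n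
      proof -
        have "R n \<omega> = (\<Sum>i<Suc n. exp (a * (t - knot 0 t (Suc n) (Suc i))) *
            ((k (knot 0 t (Suc n) (Suc i)) - u 0 - K (knot 0 t (Suc n) (Suc i))) -
             (k (knot 0 t (Suc n) i) - u 0 - K (knot 0 t (Suc n) i))))"
          unfolding R_def l_def increment_sum_exp_steps by (intro sum.cong refl) (simp add: Nk)
        also have "\<dots> = increment_sum (l n) k - increment_sum (l n) K"
          unfolding l_def increment_sum_exp_steps sum_subtractf[symmetric]
          by (intro sum.cong refl) (simp add: algebra_simps)
        finally show ?thesis .
      qed
      moreover have "(\<lambda>n. increment_sum (l n) k) \<longlonglongrightarrow> u t - exp (a * t) * u 0"
        unfolding l_def by (rule integral_equation_limit[OF u t]) (simp add: k_def)
      moreover have "(\<lambda>n. increment_sum (l n) K) \<longlonglongrightarrow> D"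
        unfolding l_def K_def[abs_def] D_def using T
        by (intro exp_steps_set_integral_tendsto set_integrable_subset[OF g]) auto
      ultimately have "(\<lambda>n. X \<omega> + R n \<omega>) \<longlonglongrightarrow> X \<omega> + ((u t - exp (a * t) * u 0) - D)"
        by (simp only:) (intro tendsto_intros)
      then show ?case
        by (simp add: X_def u_def)
    qed
  qed
  have nonneg: "0 \<le> \<sigma>"
    unfolding \<sigma>_def set_lebesgue_integral_def by (intro integral_nonneg_AE AE_I2) auto
  have distr_X: "distr M borel X = gaussian_law (D + exp (a * t) * m0) ((exp (a * t))\<^sup>2 * V0)"
    unfolding X_def[abs_def] by (rule distr_affine_gaussian_law) (use Y0 in measurable)
  have "distr M borel (Y t) = gaussian_law (D + exp (a * t) * m0) ((exp (a * t))\<^sup>2 * V0 + \<sigma>)"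
  proof (rule distr_eq_gaussian_lawI)
    fix \<theta>
    let ?lim = "char (distr M borel X) \<theta> * complex_of_real (exp (- \<sigma> * \<theta>\<^sup>2 / 2))"
    have "(\<lambda>n. char (distr M borel (\<lambda>\<omega>. X \<omega> + R n \<omega>)) \<theta>) \<longlonglongrightarrow> ?lim"
    proof -
      have "(\<lambda>n. char (distr M borel (\<lambda>\<omega>. X \<omega> + R n \<omega>)) \<theta>) = (\<lambda>n. char (distr M borel X) \<theta> *
          complex_of_real (exp (- (\<integral>r. (step_fun (l n) r * \<zeta> r)\<^sup>2 \<partial>lborel) * \<theta>\<^sup>2 / 2)))"
        using char_add_wiener[OF R order_refl T(1) X] by simp
      then show ?thesis
        by (simp only:) (intro tendsto_intros \<sigma>, simp)
    qed
    moreover have "(\<lambda>n. char (distr M borel (\<lambda>\<omega>. X \<omega> + R n \<omega>)) \<theta>) \<longlonglongrightarrow> char (distr M borel (Y t)) \<theta>"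
    proof -
      have "(\<lambda>n. CLINT \<omega>|M. iexp (\<theta> * (X \<omega> + R n \<omega>))) \<longlonglongrightarrow> (CLINT \<omega>|M. iexp (\<theta> * Y t \<omega>))"
      proof (rule integral_dominated_convergence)
        show "AE \<omega> in M. (\<lambda>n. iexp (\<theta> * (X \<omega> + R n \<omega>))) \<longlonglongrightarrow> iexp (\<theta> * Y t \<omega>)"
          using lim by eventually_elim (intro tendsto_intros)
        show "integrable M (\<lambda>_. 1::real)" by simp
        show "AE \<omega> in M. norm (iexp (\<theta> * (X \<omega> + R n \<omega>))) \<le> 1" for n
          by (simp del: of_real_mult of_real_add)
      qed measurable
      then show ?thesis
        by (simp add: char_def integral_distr)
    qed
    ultimately have "char (distr M borel (Y t)) \<theta> = ?lim"
      by (rule LIMSEQ_unique[rotated])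
    then show "char (distr M borel (Y t)) \<theta> = iexp (\<theta> * (D + exp (a * t) * m0)) *
        complex_of_real (exp (- ((exp (a * t))\<^sup>2 * V0 + \<sigma>) * \<theta>\<^sup>2 / 2))"
      using Y0(3) unfolding distr_X
      by (simp add: char_gaussian_law mult.assoc exp_add[symmetric] of_real_mult[symmetric]
          del: of_real_mult) (simp add: algebra_simps add_divide_distrib)
  qed (use Y0(3) nonneg in auto)
  then show ?thesis
    by (simp add: D_def \<sigma>_def add.commute)
qed

end

section \<open>Discounted integrals over [s, T] and the function f\<close>

lemma set_integrable_of_square:
  fixes z :: "real \<Rightarrow> real"
  assumes z: "set_borel_measurable borel {p..q} z" and z2: "set_integrable lborel {p..q} (\<lambda>r. (z r)\<^sup>2)"
  shows "set_integrable lborel {p..q} z"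
proof -
  have [measurable]: "(\<lambda>r. indicator {p..q} r * z r) \<in> borel_measurable borel"
    using z by (simp add: set_borel_measurable_def)
  have sq: "(indicator {p..q} r * z r)\<^sup>2 = indicator {p..q} r *\<^sub>R (z r)\<^sup>2" for r
    by (simp add: indicator_def)
  have "integrable lborel (\<lambda>r. indicator {p..q} r * (indicator {p..q} r * z r))"
  proof (rule integrable_mult_squares)
    show "integrable lborel (\<lambda>r. (indicator {p..q} r * z r)\<^sup>2)"
      using z2 by (simp only: sq set_integrable_def)
    have "(\<lambda>r::real. (indicator {p..q} r :: real)\<^sup>2) = indicator {p..q}"
      by (simp add: fun_eq_iff indicator_def)
    then show "integrable lborel (\<lambda>r. (indicator {p..q} r :: real)\<^sup>2)"
      by (simp add: integrable_real_indicator emeasure_lborel_Icc_eq)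
  qed measurable
  moreover have "indicator {p..q} r * (indicator {p..q} r * z r) = indicator {p..q} r *\<^sub>R z r" for r
    by (simp add: indicator_def)
  ultimately show ?thesis
    by (simp add: set_integrable_def)
qed

text \<open>Discounting a value at T back to s. It is applied with a = a1 + a2 to the mean and with
  a = 2 a1 to the variance, where c is the value at time 0.\<close>

lemma exp_integral_split:
  fixes g :: "real \<Rightarrow> real"
  assumes g: "set_integrable lborel {0..T} g" and s: "0 \<le> s" "s \<le> T"
  shows "exp (- a * (T - s)) * (exp (a * T) * c + (LINT r:{0..T}|lborel. exp (a * (T - r)) * g r)) =
    exp (a * s) * c + (LINT r:{0..s}|lborel. exp (a * (s - r)) * g r) +
    (LINT r:{s..T}|lborel. exp (a * (s - r)) * g r)"
proof -
  have "exp (- a * (T - s)) * (LINT r:{0..T}|lborel. exp (a * (T - r)) * g r) =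
      (LINT r:{0..T}|lborel. exp (- a * (T - s)) * (exp (a * (T - r)) * g r))"
    by simp
  also have "\<dots> = (LINT r:{0..T}|lborel. exp (a * (s - r)) * g r)"
    by (simp only: mult.assoc[symmetric] exp_add[symmetric]) (simp add: algebra_simps)
  also have "\<dots> = (LINT r:{0..s}|lborel. exp (a * (s - r)) * g r) + (LINT r:{s..T}|lborel. exp (a * (s - r)) * g r)"
    using s by (intro set_integral_combine set_integrable_continuous_mult g continuous_intros)
  finally have "exp (- a * (T - s)) * (LINT r:{0..T}|lborel. exp (a * (T - r)) * g r) = \<dots>" .
  moreover have "exp (- a * (T - s)) * exp (a * T) = exp (a * s)"
    by (simp only: exp_add[symmetric]) (simp add: algebra_simps)
  ultimately show ?thesis
    by (simp only: distrib_left mult.assoc[symmetric] add.assoc)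
qed

text \<open>This is the origin of f: it is the primitive of exp (-2 a2 t) that vanishes at 0, so
  that f(T - s) is the squared L2 norm of exp (a2 (s - r)) on [s, T].\<close>

lemma DERIV_f_coef: "((\<lambda>r. f_coef a (r - s)) has_real_derivative exp (2 * a * (s - r))) (at r within A)"
proof (cases "a = 0")
  case True
  then show ?thesis
    by (auto simp: f_coef_def intro!: derivative_eq_intros)
next
  case False
  then show ?thesis
    by (auto simp: f_coef_def algebra_simps intro!: derivative_eq_intros)
qed

lemma set_integral_exp_eq_f_coef:
  assumes "p \<le> q"
  shows "(LINT r:{p..q}|lborel. exp (2 * a * (s - r))) = f_coef a (q - s) - f_coef a (p - s)"
proof -
  have "((\<lambda>r. exp (2 * a * (s - r))) has_integral (f_coef a (q - s) - f_coef a (p - s))) {p..q}"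
    using assms by (intro fundamental_theorem_of_calculus)
      (auto simp: has_real_derivative_iff_has_vector_derivative[symmetric] intro: DERIV_f_coef)
  moreover have "set_integrable lborel {p..q} (\<lambda>r. exp (2 * a * (s - r)))"
    by (intro borel_integrable_atLeastAtMost' continuous_intros)
  ultimately show ?thesis
    by (simp add: set_borel_integral_eq_integral integral_unique)
qed

lemma f_coef_0 [simp]: "f_coef a 0 = 0"
  by (simp add: f_coef_def)

lemma f_coef_pos:
  assumes "0 < t"
  shows "0 < f_coef a t"
proof (cases "a = 0")
  case False
  then consider "0 < a" | "a < 0" by linarith
  then show ?thesis
  proof cases
    case 1
    then have "exp (- 2 * a * t) < 1"
      using assms by simp
    with 1 show ?thesis by (simp add: f_coef_def)
  next
    case 2
    then have "1 < exp (- 2 * a * t)"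
      using assms by (simp add: mult_neg_pos)
    with 2 show ?thesis by (simp add: f_coef_def divide_neg_neg)
  qed
qed (use assms in \<open>simp add: f_coef_def\<close>)

lemma exp_integral_Cauchy_Schwarz:
  assumes z: "set_borel_measurable borel {s..T} z"
    and z2: "set_integrable lborel {s..T} (\<lambda>r. (z r)\<^sup>2)" and "s \<le> T"
  shows "\<bar>LINT r:{s..T}|lborel. exp ((a1 + a2) * (s - r)) * z r\<bar> \<le>
    sqrt (f_coef a2 (T - s)) * sqrt (LINT r:{s..T}|lborel. exp (2 * a1 * (s - r)) * (z r)\<^sup>2)"
proof -
  define f where "f r = indicator {s..T} r * exp (a2 * (s - r))" for r
  define g where "g r = exp (a1 * (s - r)) * (indicator {s..T} r * z r)" for r
  have [measurable]: "(\<lambda>r. indicator {s..T} r * z r) \<in> borel_measurable borel"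
    using z by (simp add: set_borel_measurable_def)
  have [measurable]: "f \<in> borel_measurable borel" "g \<in> borel_measurable borel"
    unfolding f_def[abs_def] g_def[abs_def] by measurable
  have f2: "(f r)\<^sup>2 = indicator {s..T} r *\<^sub>R exp (2 * a2 * (s - r))" for r
    by (simp add: f_def indicator_def exp_double[symmetric] mult.assoc)
  have g2: "(g r)\<^sup>2 = indicator {s..T} r *\<^sub>R (exp (2 * a1 * (s - r)) * (z r)\<^sup>2)" for r
    by (simp add: g_def indicator_def exp_double[symmetric] mult.assoc power_mult_distrib)
  have fg: "f r * g r = indicator {s..T} r *\<^sub>R (exp ((a1 + a2) * (s - r)) * z r)" for r
    by (simp add: f_def g_def indicator_def exp_add distrib_right)
  have "integrable lborel (\<lambda>r. (f r)\<^sup>2)" "integrable lborel (\<lambda>r. (g r)\<^sup>2)"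
    unfolding f2 g2 set_integrable_def[symmetric]
    by (intro borel_integrable_atLeastAtMost' set_integrable_continuous_mult z2 continuous_intros)+
  then have "\<bar>\<integral>r. f r * g r \<partial>lborel\<bar> \<le> sqrt (\<integral>r. (f r)\<^sup>2 \<partial>lborel) * sqrt (\<integral>r. (g r)\<^sup>2 \<partial>lborel)"
    by (intro integral_Cauchy_Schwarz) simp_all
  then show ?thesis
    using set_integral_exp_eq_f_coef[OF \<open>s \<le> T\<close>, of a2 s]
    unfolding f2 g2 fg set_lebesgue_integral_def[symmetric] by simp
qed

section \<open>The law of a solution\<close>

context brownian_setting
begin

text \<open>With g = a2 E[Y] + b z as forcing, each path solves a linear equation with rate a1, so
  Y(t) is Gaussian with a mean that still involves E[Y]. Taking the mean of that law gives a linear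
  equation for E[Y], whose solution has rate a1 + a2; the variance does not see the mean-field
  term.\<close>

lemma mf_solution_law:
  assumes sol: "mf_solution M F0 W T a1 a2 b \<mu> Y z" and "0 \<le> T" and t: "t \<in> {0..T}"
  shows "distr M borel (Y t) = gaussian_law
    (exp ((a1 + a2) * t) * law_mean (distr M borel (Y 0)) +
      (LINT r:{0..t}|lborel. exp ((a1 + a2) * (t - r)) * (b * z r)))
    (exp (2 * a1 * t) * law_var (distr M borel (Y 0)) +
      (LINT r:{0..t}|lborel. exp (2 * a1 * (t - r)) * (z r)\<^sup>2))"
proof -
  define m where "m r = (\<integral>\<omega>. Y r \<omega> \<partial>M)" for r
  define g where "g r = a2 * m r + b * z r" for r
  have adapted: "\<And>t. t \<in> {0..T} \<Longrightarrow> Y t \<in> borel_measurable (filt t)"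
    and cont: "AE \<omega> in M. continuous_on {0..T} (\<lambda>t. Y t \<omega>)"
    and z: "set_borel_measurable borel {0..T} z"
    and z2: "set_integrable lborel {0..T} (\<lambda>r. (z r)\<^sup>2)"
    and Y0: "Y 0 \<in> borel_measurable (filt 0)" "distr M borel (Y 0) \<in> Gauss"
    and drift: "AE \<omega> in M. set_integrable lborel {0..T} (\<lambda>r. a1 * Y r \<omega> + g r)"
    and eq: "\<forall>t\<in>{0..T}. \<exists>J. is_stochastic_integral M W z t T J \<and>
        (AE \<omega> in M. Y t \<omega> = Y T \<omega> - (LINT r:{t..T}|lborel. a1 * Y r \<omega> + g r) - J \<omega>)"
    using sol by (simp_all add: mf_solution_def m_def g_def add.assoc)
  note Y_meas = measurable_filt[OF adapted]
  obtain m0 V0 where law0: "distr M borel (Y 0) = gaussian_law m0 V0" and "0 \<le> V0"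
    using Y0(2) by (auto simp: Gauss_def)
  from bchoice[OF eq] obtain J where J: "\<And>t. t \<in> {0..T} \<Longrightarrow> is_stochastic_integral M W z t T (J t)"
    and eqJ: "\<And>t. t \<in> {0..T} \<Longrightarrow>
      AE \<omega> in M. Y t \<omega> = Y T \<omega> - (LINT r:{t..T}|lborel. a1 * Y r \<omega> + g r) - J t \<omega>"
    by blast
  have zi: "set_integrable lborel {0..T} z"
    by (rule set_integrable_of_square[OF z z2])
  \<comment> \<open>A single good path suffices to make g integrable: its drift is integrable and
    its own contribution a1 Y is continuous.\<close>
  obtain \<omega>0 where \<omega>0: "continuous_on {0..T} (\<lambda>t. Y t \<omega>0)" "set_integrable lborel {0..T} (\<lambda>r. a1 * Y r \<omega>0 + g r)"
    using eventually_happens'[OF ae_filter_bot eventually_conj[OF cont drift]] by auto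
  have g: "set_integrable lborel {0..T} g"
  proof -
    have "set_integrable lborel {0..T} (\<lambda>r. a1 * Y r \<omega>0)"
      by (intro borel_integrable_atLeastAtMost' continuous_intros \<omega>0)
    from set_integral_diff(1)[OF \<omega>0(2) this] show ?thesis by simp
  qed
  have wiener_J: "wiener t T (\<lambda>r. indicator {t<..T} r * z r) (J t)" if "t \<in> {0..T}" for t
  proof (rule is_stochastic_integral_imp_wiener[OF J[OF that]])
    have "(\<lambda>r. indicator {t<..T} r * (indicator {0..T} r *\<^sub>R z r)) \<in> borel_measurable borel"
      using z unfolding set_borel_measurable_def by measurable
    also have "(\<lambda>r. indicator {t<..T} r * (indicator {0..T} r *\<^sub>R z r)) = (\<lambda>r. indicator {t<..T} r * z r)"
      using that by (auto simp: fun_eq_iff indicator_def)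
    finally show "(\<lambda>r. indicator {t<..T} r * z r) \<in> borel_measurable borel" .
  qed
  have forward: "AE \<omega> in M. Y t \<omega> = Y 0 \<omega> + (LINT r:{0..t}|lborel. a1 * Y r \<omega> + g r) + (J 0 \<omega> - J t \<omega>)"
    if t: "t \<in> {0..T}" for t
  proof -
    have "0 \<in> {0..T}" using \<open>0 \<le> T\<close> by simp
    from eqJ[OF this] eqJ[OF t] drift show ?thesis
    proof eventually_elim
      case (elim \<omega>)
      then show ?case
        using set_integral_combine[OF elim(3), of t] t by simp
    qed
  qed
  have law: "distr M borel (Y t) = gaussian_law
      (exp (a1 * t) * m0 + (LINT r:{0..t}|lborel. exp (a1 * (t - r)) * g r))
      ((exp (a1 * t))\<^sup>2 * V0 + (LINT r:{0..t}|lborel. (exp (a1 * (t - r)) * z r)\<^sup>2))" if "t \<in> {0..T}" for t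
    by (rule distr_linear_sde[where T = T and J = J])
      (use Y0 law0 \<open>0 \<le> V0\<close> Y_meas cont g wiener_J forward that in auto)
  have var_nonneg: "0 \<le> (exp (a1 * t))\<^sup>2 * V0 + (LINT r:{0..t}|lborel. (exp (a1 * (t - r)) * z r)\<^sup>2)" for t
    using \<open>0 \<le> V0\<close> unfolding set_lebesgue_integral_def
    by (intro add_nonneg_nonneg mult_nonneg_nonneg integral_nonneg_AE AE_I2) auto
  have m: "m t = exp (a1 * t) * m0 + (LINT r:{0..t}|lborel. exp (a1 * (t - r)) * g r)" if "t \<in> {0..T}" for t
  proof -
    have "m t = law_mean (distr M borel (Y t))"
      using Y_meas[OF that] by (simp add: m_def law_mean_def integral_distr)
    then show ?thesis
      using law_mean_gaussian_law[OF var_nonneg] by (simp add: law[OF that])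
  qed
  \<comment> \<open>The factor exp (- a1 r) removes the kernel exp (a1 (t - r)), and the equation
    for the mean becomes p' = a2 p + h in integral form.\<close>
  define p where "p r = exp (- (a1 * r)) * m r" for r
  define h where "h r = exp (- (a1 * r)) * (b * z r)" for r
  have hi: "set_integrable lborel {0..T} h"
    unfolding h_def using zi by (intro set_integrable_continuous_mult continuous_intros) simp
  have eg: "set_integrable lborel {0..T} (\<lambda>r. exp (- (a1 * r)) * g r)"
    by (intro set_integrable_continuous_mult g continuous_intros)
  have p: "p x = m0 + (LINT r:{0..x}|lborel. exp (- (a1 * r)) * g r)" if "x \<in> {0..T}" for x
  proof -
    have "p x = m0 + exp (- (a1 * x)) * (LINT r:{0..x}|lborel. exp (a1 * (x - r)) * g r)"
      by (simp add: p_def m[OF that] distrib_left mult.assoc[symmetric] exp_add[symmetric])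
    also have "exp (- (a1 * x)) * (LINT r:{0..x}|lborel. exp (a1 * (x - r)) * g r) =
        (LINT r:{0..x}|lborel. exp (- (a1 * x)) * (exp (a1 * (x - r)) * g r))"
      by simp
    also have "\<dots> = (LINT r:{0..x}|lborel. exp (- (a1 * r)) * g r)"
      by (simp only: mult.assoc[symmetric] exp_add[symmetric]) (simp add: algebra_simps)
    finally show ?thesis .
  qed
  have "p t = exp (a2 * t) * m0 + (LINT r:{0..t}|lborel. exp (a2 * (t - r)) * h r)"
  proof (rule linear_integral_equation[OF _ hi _ t])
    show "continuous_on {0..T} p"
      by (rule continuous_on_eq[of _ "\<lambda>x. m0 + (LINT r:{0..x}|lborel. exp (- (a1 * r)) * g r)"])
        (auto simp: p intro!: continuous_intros continuous_on_set_integral eg)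
    show "p x = m0 + (LINT r:{0..x}|lborel. a2 * p r + h r)" if "x \<in> {0..T}" for x
      unfolding p[OF that] by (simp add: p_def h_def g_def algebra_simps)
  qed
  then have "exp (a1 * t) * p t = exp (a1 * t) * exp (a2 * t) * m0 +
      (LINT r:{0..t}|lborel. exp (a1 * t) * (exp (a2 * (t - r)) * h r))"
    by (simp add: distrib_left)
  moreover have "exp (a1 * t) * p t = m t"
    by (simp add: p_def mult.assoc[symmetric] exp_add[symmetric])
  moreover have "exp (a1 * t) * (exp (a2 * (t - r)) * h r) = exp ((a1 + a2) * (t - r)) * (b * z r)" for r
    by (simp only: h_def mult.assoc[symmetric] exp_add[symmetric]) (simp add: algebra_simps)
  ultimately have mt: "m t = exp ((a1 + a2) * t) * m0 + (LINT r:{0..t}|lborel. exp ((a1 + a2) * (t - r)) * (b * z r))"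
    by (simp add: distrib_right exp_add)
  have sq: "(exp (a1 * t))\<^sup>2 = exp (2 * a1 * t)" "(exp (a1 * (t - r)) * z r)\<^sup>2 = exp (2 * a1 * (t - r)) * (z r)\<^sup>2" for r
    by (simp_all add: exp_double[symmetric] power_mult_distrib mult.assoc)
  show ?thesis
    using law[OF t] mt unfolding m[OF t, symmetric] sq law0 law_mean_gaussian_law[OF \<open>0 \<le> V0\<close>]
      law_var_gaussian_law[OF \<open>0 \<le> V0\<close>] by simp
qed

text \<open>The laws at s and at T are both explicit in terms of time 0; splitting the integrals at
  s eliminates the initial values.\<close>

lemma mf_solution_transition:
  assumes sol: "mf_solution M F0 W T a1 a2 b \<mu> Y z" and s: "0 \<le> s" "s \<le> T"
  obtains y \<sigma> where "distr M borel (Y s) = gaussian_law y \<sigma>" "0 \<le> \<sigma>"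
    "exp (- (a1 + a2) * (T - s)) * law_mean \<mu> = y + b * (LINT r:{s..T}|lborel. exp ((a1 + a2) * (s - r)) * z r)"
    "exp (- 2 * a1 * (T - s)) * law_var \<mu> = \<sigma> + (LINT r:{s..T}|lborel. exp (2 * a1 * (s - r)) * (z r)\<^sup>2)"
proof -
  define m0 V0 where "m0 = law_mean (distr M borel (Y 0))" and "V0 = law_var (distr M borel (Y 0))"
  define m where "m t = exp ((a1 + a2) * t) * m0 +
      (LINT r:{0..t}|lborel. exp ((a1 + a2) * (t - r)) * (b * z r))" for t
  define V where "V t = exp (2 * a1 * t) * V0 + (LINT r:{0..t}|lborel. exp (2 * a1 * (t - r)) * (z r)\<^sup>2)" for t
  have law: "distr M borel (Y t) = gaussian_law (m t) (V t)" if "t \<in> {0..T}" for t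
    using mf_solution_law[OF sol _ that] s by (simp add: m_def V_def m0_def V0_def)
  have V: "0 \<le> V t" for t
    unfolding V_def V0_def law_var_def set_lebesgue_integral_def
    by (intro add_nonneg_nonneg mult_nonneg_nonneg integral_nonneg_AE AE_I2) auto
  have \<mu>: "\<mu> = gaussian_law (m T) (V T)"
    using sol law[of T] s by (simp add: mf_solution_def)
  have z: "set_borel_measurable borel {0..T} z" and z2: "set_integrable lborel {0..T} (\<lambda>r. (z r)\<^sup>2)"
    using sol by (simp_all add: mf_solution_def)
  have zi: "set_integrable lborel {0..T} (\<lambda>r. b * z r)"
    using set_integrable_of_square[OF z z2] by simp
  show ?thesis
  proof (rule that)
    show "distr M borel (Y s) = gaussian_law (m s) (V s)"
      using law s by simp
    show "0 \<le> V s" by (rule V)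
    show "exp (- (a1 + a2) * (T - s)) * law_mean \<mu> =
        m s + b * (LINT r:{s..T}|lborel. exp ((a1 + a2) * (s - r)) * z r)"
      unfolding \<mu> law_mean_gaussian_law[OF V] unfolding m_def exp_integral_split[OF zi s]
      by (simp add: mult.left_commute[of _ b])
    show "exp (- 2 * a1 * (T - s)) * law_var \<mu> =
        V s + (LINT r:{s..T}|lborel. exp (2 * a1 * (s - r)) * (z r)\<^sup>2)"
      using exp_integral_split[OF z2 s, of "2 * a1" V0]
      unfolding \<mu> law_var_gaussian_law[OF V] unfolding V_def by simp
  qed
qed

text \<open>In the transition identities, Q is the variance spent on [s, T] and equals the
  discounted variance of \<mu> minus \<sigma>, while b P is the shift of the mean. The bounds on y
  are therefore \<bar>b P\<bar> \<le> \<bar>b\<bar> sqrt f sqrt Q.\<close>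

lemma backward_reachable_subset:
  assumes s: "0 \<le> s" "s < T"
  shows "backward_reachable M F0 W T a1 a2 b \<mu> s \<subseteq>
    {gaussian_law y \<sigma> | y \<sigma>.
       \<sigma> \<in> {0..exp (- 2 * a1 * (T - s)) * law_var \<mu>} \<and>
       y \<in> {y_min T a1 a2 b \<mu> s \<sigma>..y_max T a1 a2 b \<mu> s \<sigma>}}"
proof
  fix \<nu> assume "\<nu> \<in> backward_reachable M F0 W T a1 a2 b \<mu> s"
  then obtain Y z where \<nu>: "\<nu> = distr M borel (Y s)" and sol: "mf_solution M F0 W T a1 a2 b \<mu> Y z"
    by (auto simp: backward_reachable_def)
  define P where "P = (LINT r:{s..T}|lborel. exp ((a1 + a2) * (s - r)) * z r)"
  define Q where "Q = (LINT r:{s..T}|lborel. exp (2 * a1 * (s - r)) * (z r)\<^sup>2)"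
  obtain y \<sigma> where law: "\<nu> = gaussian_law y \<sigma>" and "0 \<le> \<sigma>"
    and mean: "exp (- (a1 + a2) * (T - s)) * law_mean \<mu> = y + b * P"
    and var: "exp (- 2 * a1 * (T - s)) * law_var \<mu> = \<sigma> + Q"
    unfolding \<nu> P_def Q_def by (rule mf_solution_transition[OF sol s(1) less_imp_le[OF s(2)]])
  have z: "set_borel_measurable borel {0..T} z" and z2: "set_integrable lborel {0..T} (\<lambda>r. (z r)\<^sup>2)"
    using sol by (simp_all add: mf_solution_def)
  have "\<bar>P\<bar> \<le> sqrt (f_coef a2 (T - s)) * sqrt Q"
    unfolding P_def Q_def
  proof (rule exp_integral_Cauchy_Schwarz)
    have "(\<lambda>r. indicator {s..T} r * (indicator {0..T} r *\<^sub>R z r)) \<in> borel_measurable borel"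
      using z unfolding set_borel_measurable_def by measurable
    also have "(\<lambda>r. indicator {s..T} r * (indicator {0..T} r *\<^sub>R z r)) = (\<lambda>r. indicator {s..T} r *\<^sub>R z r)"
      using s by (auto simp: fun_eq_iff indicator_def)
    finally show "set_borel_measurable borel {s..T} z"
      by (simp add: set_borel_measurable_def)
    show "set_integrable lborel {s..T} (\<lambda>r. (z r)\<^sup>2)"
      using s by (intro set_integrable_subset[OF z2]) auto
  qed (use s in simp)
  then have "\<bar>b\<bar> * \<bar>P\<bar> \<le> \<bar>b\<bar> * (sqrt (f_coef a2 (T - s)) * sqrt Q)"
    by (rule mult_left_mono) simp
  then have "\<bar>b * P\<bar> \<le> \<bar>b\<bar> * sqrt (f_coef a2 (T - s)) * sqrt Q"
    by (simp only: abs_mult mult.assoc)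
  then have "y \<in> {y_min T a1 a2 b \<mu> s \<sigma>..y_max T a1 a2 b \<mu> s \<sigma>}"
    unfolding y_min_def y_max_def mean var by (simp add: abs_le_iff)
  moreover have "0 \<le> Q"
    unfolding Q_def set_lebesgue_integral_def by (intro integral_nonneg_AE AE_I2) auto
  then have "\<sigma> \<in> {0..exp (- 2 * a1 * (T - s)) * law_var \<mu>}"
    unfolding var using \<open>0 \<le> \<sigma>\<close> by simp
  ultimately show "\<nu> \<in> {gaussian_law y \<sigma> | y \<sigma>.
       \<sigma> \<in> {0..exp (- 2 * a1 * (T - s)) * law_var \<mu>} \<and>
       y \<in> {y_min T a1 a2 b \<mu> s \<sigma>..y_max T a1 a2 b \<mu> s \<sigma>}}"
    using law by blast
qed

end

section \<open>Construction of solutions\<close>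

lemma volterra_0 [simp]: "volterra a k 0 = k 0"
  by (simp add: volterra_def)

lemma exp_steps_volterra_tendsto:
  assumes k: "continuous_on {0..T} k" and pq: "0 \<le> p" "p \<le> q" "q \<le> T"
  shows "(\<lambda>n. increment_sum (exp_steps a p q (Suc n)) k) \<longlonglongrightarrow>
    volterra a k q - exp (a * (q - p)) * volterra a k p"
proof -
  have sub: "{p..q} \<subseteq> {0..T}"
    using pq by auto
  note U = continuous_on_volterra[OF k, of a]
  show ?thesis
  proof (rule exp_steps_tendsto[where S = "\<lambda>x. LINT r:{0..x}|lborel. volterra a k r"])
    show "continuous_on {p..q} (volterra a k)"
      by (rule continuous_on_subset[OF U sub])
    show "((\<lambda>x. LINT r:{0..x}|lborel. volterra a k r) has_real_derivative volterra a k x) (at x within {p..q})"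
      if "x \<in> {p..q}" for x
      using that sub by (intro DERIV_subset[OF has_real_derivative_set_integral[OF U] sub]) auto
    show "k x = volterra a k x - a * (LINT r:{0..x}|lborel. volterra a k r)" if "x \<in> {p..q}" for x
      using volterra_eq[OF k, of x a] that sub by auto
  qed (rule pq)
qed

section \<open>Adapted continuous solutions built path by path\<close>

context brownian_setting
begin

text \<open>Adaptedness of the path-wise time integral: the value at t is a limit of finite sums
  over knots in [0, t], each of them measurable at time t.\<close>

lemma measurable_filt_volterra:
  assumes k: "\<And>r. r \<in> {0..T} \<Longrightarrow> k r \<in> borel_measurable (filt r)"
    and cont: "\<And>\<omega>. \<omega> \<in> space M \<Longrightarrow> continuous_on {0..T} (\<lambda>r. k r \<omega>)"
    and t: "t \<in> {0..T}"
  shows "(\<lambda>\<omega>. volterra a (\<lambda>r. k r \<omega>) t) \<in> borel_measurable (filt t)"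
proof (rule borel_measurable_LIMSEQ_real)
  let ?X = "\<lambda>n \<omega>. increment_sum (exp_steps a 0 t (Suc n)) (\<lambda>r. k r \<omega>) + exp (a * (t - 0)) * k 0 \<omega>"
  have T: "0 \<le> t" "t \<le> T"
    using t by auto
  show "(\<lambda>n. ?X n \<omega>) \<longlonglongrightarrow> volterra a (\<lambda>r. k r \<omega>) t" if "\<omega> \<in> space (filt t)" for \<omega>
  proof -
    have "(\<lambda>n. ?X n \<omega>) \<longlonglongrightarrow> (volterra a (\<lambda>r. k r \<omega>) t - exp (a * (t - 0)) * volterra a (\<lambda>r. k r \<omega>) 0) +
        exp (a * (t - 0)) * k 0 \<omega>"
      using that T by (intro tendsto_add tendsto_const exp_steps_volterra_tendsto[OF cont]) auto
    then show ?thesis by simp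
  qed
  show "?X n \<in> borel_measurable (filt t)" for n
  proof -
    have [measurable]: "k (knot 0 t (Suc n) i) \<in> borel_measurable (filt t)" if "i \<le> Suc n" for i
      using knot_in[OF T(1) that] T by (intro measurable_filt_mono[OF k]) auto
    have [measurable]: "k 0 \<in> borel_measurable (filt t)"
      using T by (intro measurable_filt_mono[OF k]) auto
    show ?thesis
      unfolding increment_sum_exp_steps
      by (intro borel_measurable_add borel_measurable_sum borel_measurable_times borel_measurable_diff
          borel_measurable_const) (auto simp del: sum.lessThan_Suc)
  qed
qed

text \<open>A solution needs one continuous adapted process serving all times at once. Integration
  by parts supplies it on every path: A(t) = exp (\<kappa> t) B(t) - \<kappa> \<integral> exp
  (\<kappa> r) B(r) dr over [0, t], which is the integral of exp (\<kappa> r) dB(r).\<close>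

lemma exp_wiener_process_exists:
  assumes "0 \<le> T"
  shows "\<exists>A. (\<forall>t\<in>{0..T}. A t \<in> borel_measurable (filt t)) \<and>
    (\<forall>\<omega>\<in>space M. continuous_on {0..T} (\<lambda>t. A t \<omega>)) \<and>
    (\<forall>p q. 0 \<le> p \<longrightarrow> p \<le> q \<longrightarrow> q \<le> T \<longrightarrow>
      wiener p q (\<lambda>r. indicator {p<..q} r * exp (\<kappa> * r)) (\<lambda>\<omega>. A q \<omega> - A p \<omega>))"
proof -
  obtain N where cont_W: "\<And>\<omega>. \<omega> \<in> space M - N \<Longrightarrow> continuous_on {0..} (\<lambda>t. W t \<omega>)" and N: "N \<in> null_sets M"
  proof -
    have "AE \<omega> in M. continuous_on {0..} (\<lambda>t. W t \<omega>)"
      using brownian by (simp add: brownian_motion_def)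
    then show ?thesis
      by (rule AE_E3) (rule that)
  qed
  \<comment> \<open>Killing the discontinuous paths makes continuity hold everywhere. The null set N
    lies in every \<sigma>-field of the augmented filtration, so B stays adapted.\<close>
  define B where "B t \<omega> = (if \<omega> \<in> N then 0 else W t \<omega>)" for t \<omega>
  have B_meas: "B r \<in> borel_measurable (filt r)" if "0 \<le> r" for r
  proof -
    have "N \<inter> space M = N"
      using null_setsD2[OF N] sets.sets_into_space by blast
    then show ?thesis
      unfolding B_def[abs_def] using that null_sets_filt[OF N]
      by (intro measurable_If_set W_measurable_filt) auto
  qed
  have B_cont: "continuous_on {0..T} (\<lambda>t. B t \<omega>)" if "\<omega> \<in> space M" for \<omega>
    using continuous_on_subset[OF cont_W, of \<omega> "{0..T}"] that by (cases "\<omega> \<in> N") (auto simp: B_def)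
  define A where "A t \<omega> = exp (\<kappa> * t) * volterra (- \<kappa>) (\<lambda>r. B r \<omega>) t" for t \<omega>
  have A_meas: "A t \<in> borel_measurable (filt t)" if "t \<in> {0..T}" for t
    unfolding A_def[abs_def]
    by (intro borel_measurable_times borel_measurable_const measurable_filt_volterra[OF _ B_cont that])
      (auto intro: B_meas)
  have A_cont: "continuous_on {0..T} (\<lambda>t. A t \<omega>)" if "\<omega> \<in> space M" for \<omega>
    unfolding A_def by (intro continuous_intros continuous_on_volterra B_cont that)
  have wA: "wiener p q (\<lambda>r. indicator {p<..q} r * exp (\<kappa> * r)) (\<lambda>\<omega>. A q \<omega> - A p \<omega>)"
    if pq: "0 \<le> p" "p \<le> q" "q \<le> T" for p q
  proof -
    let ?U = "\<lambda>\<omega>. volterra (- \<kappa>) (\<lambda>r. B r \<omega>)"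
    let ?l = "\<lambda>n. exp_steps (- \<kappa>) p q (Suc n)"
    let ?\<phi> = "\<lambda>r. indicator {p<..q} r * exp (- \<kappa> * (q - r))"
    \<comment> \<open>Scaled by exp (- \<kappa> q), the increment of A is the limit of the
      exponential sums with rate - \<kappa> on [p, q]. The scaling is undone at the end by
      linearity.\<close>
    have A_eq: "exp (- \<kappa> * q) * (A q \<omega> - A p \<omega>) = ?U \<omega> q - exp (- \<kappa> * (q - p)) * ?U \<omega> p" for \<omega>
      by (simp add: A_def right_diff_distrib mult.assoc[symmetric] exp_add[symmetric])
    have [measurable]: "A q \<in> borel_measurable M" "A p \<in> borel_measurable M"
      using A_meas[of q] A_meas[of p] pq by (auto intro: measurable_filt)
    have "wiener p q ?\<phi> (\<lambda>\<omega>. exp (- \<kappa> * q) * (A q \<omega> - A p \<omega>))"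
    proof (rule wienerI_pointwise)
      show "steps_in p q (?l n)" for n
        using pq by (simp add: steps_in_exp_steps)
      show "(\<lambda>n. \<integral>\<^sup>+r. ennreal ((step_fun (?l n) r - ?\<phi> r)\<^sup>2) \<partial>lborel) \<longlonglongrightarrow> 0"
      proof (rule L2_dominated_convergence)
        let ?w = "\<lambda>r. exp (\<bar>- \<kappa>\<bar> * (q - p)) * indicator {p<..q} r :: real"
        have "integrable lborel (\<lambda>r. (exp (\<bar>- \<kappa>\<bar> * (q - p)))\<^sup>2 * indicator {p<..q} r :: real)"
          using pq by (intro integrable_mult_right integrable_real_indicator) auto
        also have "(\<lambda>r. (exp (\<bar>- \<kappa>\<bar> * (q - p)))\<^sup>2 * indicator {p<..q} r :: real) = (\<lambda>r. (?w r)\<^sup>2)"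
          by (auto simp: fun_eq_iff indicator_def)
        finally show "integrable lborel (\<lambda>r. (?w r)\<^sup>2)" .
        show "AE r in lborel. \<bar>step_fun (?l n) r\<bar> \<le> ?w r" for n
        proof (rule AE_I2)
          fix r
          have "steps_in p q (?l n)"
            using pq by (simp add: steps_in_exp_steps)
          from step_fun_outside[OF this, of r] step_fun_exp_steps_bound[OF pq(2), of "- \<kappa>" n r]
          show "\<bar>step_fun (?l n) r\<bar> \<le> ?w r"
            by (cases "r \<in> {p<..q}") auto
        qed
        show "AE r in lborel. (\<lambda>n. step_fun (?l n) r) \<longlonglongrightarrow> ?\<phi> r"
        proof (rule AE_I2)
          fix r
          have l: "steps_in p q (?l n)" for n
            using pq by (simp add: steps_in_exp_steps)
          show "(\<lambda>n. step_fun (?l n) r) \<longlonglongrightarrow> ?\<phi> r"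
            using step_fun_outside[OF l, of r] step_fun_exp_steps_tendsto[OF pq(2), of r "- \<kappa>"]
            by (cases "r \<in> {p<..q}") auto
        qed
      qed measurable
      show "AE \<omega> in M. (\<lambda>n. W_sum (?l n) \<omega>) \<longlonglongrightarrow> exp (- \<kappa> * q) * (A q \<omega> - A p \<omega>)"
        using AE_not_in[OF N] AE_space
      proof eventually_elim
        case (elim \<omega>)
        then have "(\<lambda>r. W r \<omega>) = (\<lambda>r. B r \<omega>)"
          by (simp add: B_def)
        then show ?case
          unfolding A_eq using exp_steps_volterra_tendsto[OF B_cont[OF elim(2)] pq, of "- \<kappa>"] by simp
      qed
    qed (use pq in measurable)
    from wiener_linear[OF this this pq(1), of "exp (\<kappa> * q)" 0]
    have w: "wiener p q (\<lambda>r. exp (\<kappa> * q) * ?\<phi> r) (\<lambda>\<omega>. exp (\<kappa> * q) * (exp (- \<kappa> * q) * (A q \<omega> - A p \<omega>)))"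
      by simp
    have \<phi>: "exp (\<kappa> * q) * ?\<phi> r = indicator {p<..q} r * exp (\<kappa> * r)" for r
      by (simp only: mult.left_commute[of "exp (\<kappa> * q)"] exp_add[symmetric]) (simp add: algebra_simps)
    have inv: "exp (\<kappa> * q) * (exp (- \<kappa> * q) * y) = y" for y :: real
      by (simp add: mult.assoc[symmetric] exp_add[symmetric])
    show ?thesis
      using w unfolding \<phi> inv .
  qed
  show ?thesis
    using A_meas A_cont wA by blast
qed

text \<open>The equation is solved forward and its terminal law is whatever results. Taking
  expectations suggests the closed equation with rate a1 + a2 for the mean m; it is solved first,
  and m stands in for E[Y] in the forcing g. The process Y then solves a Volterra equation on each
  path, and its law confirms E[Y] = m.\<close>

lemma obtain_mf_solution:
  fixes V0 s x T a1 a2 b c \<kappa> m0 :: real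
  assumes rich: "rich_enough M F0" and "0 \<le> V0" and T: "0 \<le> s" "s \<le> x" "x \<le> T"
  defines "z \<equiv> \<lambda>r. c * exp (\<kappa> * r) * (indicator {s<..x} r - indicator {x<..T} r)"
  obtains Y where "mf_solution M F0 W T a1 a2 b (distr M borel (Y T)) Y z"
    "distr M borel (Y 0) = gaussian_law m0 V0"
proof -
  have "0 \<le> T" using T by simp
  obtain \<xi> where \<xi>: "\<xi> \<in> borel_measurable F0" "distr M borel \<xi> = gaussian_law m0 V0"
    using rich gaussian_law_in_Wasserstein2[OF \<open>0 \<le> V0\<close>] unfolding rich_enough_def by blast
  obtain A where A_meas: "\<And>t. t \<in> {0..T} \<Longrightarrow> A t \<in> borel_measurable (filt t)"
    and A_cont: "\<And>\<omega>. \<omega> \<in> space M \<Longrightarrow> continuous_on {0..T} (\<lambda>t. A t \<omega>)"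
    and A: "\<And>p q. 0 \<le> p \<Longrightarrow> p \<le> q \<Longrightarrow> q \<le> T \<Longrightarrow>
      wiener p q (\<lambda>r. indicator {p<..q} r * exp (\<kappa> * r)) (\<lambda>\<omega>. A q \<omega> - A p \<omega>)"
    using exp_wiener_process_exists[OF \<open>0 \<le> T\<close>, of \<kappa>] by blast
  have z_meas [measurable]: "z \<in> borel_measurable borel"
    unfolding z_def by measurable
  have z2: "set_integrable lborel {0..T} (\<lambda>r. (z r)\<^sup>2)"
  proof -
    have "set_integrable lborel {0..T} (\<lambda>r. (c * exp (\<kappa> * r))\<^sup>2 * (indicator {s<..T} r :: real))"
    proof (rule set_integrable_continuous_mult)
      have "integrable lborel (\<lambda>r. indicator {s<..T} r :: real)"
        using T by (intro integrable_real_indicator) auto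
      also have "(\<lambda>r. indicator {s<..T} r :: real) = (\<lambda>r. indicator {0..T} r *\<^sub>R indicator {s<..T} r)"
        using T by (auto simp: fun_eq_iff indicator_def)
      finally show "set_integrable lborel {0..T} (\<lambda>r. indicator {s<..T} r :: real)"
        by (simp add: set_integrable_def)
    qed (intro continuous_intros)
    moreover have "(c * exp (\<kappa> * r))\<^sup>2 * (indicator {s<..T} r :: real) = (z r)\<^sup>2" for r
      using T by (auto simp: z_def indicator_def)
    ultimately show ?thesis by simp
  qed
  have z_sbm: "set_borel_measurable borel {0..T} z"
    unfolding set_borel_measurable_def by measurable
  have bz: "set_integrable lborel {0..T} (\<lambda>r. b * z r)"
    using set_integrable_of_square[OF z_sbm z2] by simp
  define m where "m = volterra (a1 + a2) (\<lambda>t. m0 + (LINT r:{0..t}|lborel. b * z r))"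
  define g where "g r = a2 * m r + b * z r" for r
  have km: "continuous_on {0..T} (\<lambda>t. m0 + (LINT r:{0..t}|lborel. b * z r))"
    by (intro continuous_intros continuous_on_set_integral bz)
  have m_cont: "continuous_on {0..T} m"
    unfolding m_def by (rule continuous_on_volterra[OF km])
  have g: "set_integrable lborel {0..T} g"
    unfolding g_def by (intro set_integral_add bz borel_integrable_atLeastAtMost' continuous_intros m_cont)
  have m_eq: "m t = m0 + (LINT r:{0..t}|lborel. a1 * m r + g r)" if "t \<in> {0..T}" for t
  proof -
    have sub: "{0..t} \<subseteq> {0..T}" using that by auto
    have i: "set_integrable lborel {0..t} (\<lambda>r. b * z r)" "set_integrable lborel {0..t} (\<lambda>r. (a1 + a2) * m r)"
      using set_integrable_subset[OF bz _ sub] continuous_on_subset[OF m_cont sub]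
      by (auto intro!: borel_integrable_atLeastAtMost' continuous_intros simp del: set_integrable_mult_right_iff)
    have "m t = m0 + (LINT r:{0..t}|lborel. b * z r) + (a1 + a2) * (LINT r:{0..t}|lborel. m r)"
      unfolding m_def by (rule volterra_eq[OF km that])
    also have "\<dots> = m0 + (LINT r:{0..t}|lborel. (a1 + a2) * m r + b * z r)"
      by (simp add: set_integral_add(2)[OF i(2,1)])
    also have "(\<lambda>r. (a1 + a2) * m r + b * z r) = (\<lambda>r. a1 * m r + g r)"
      by (simp add: g_def fun_eq_iff algebra_simps)
    finally show ?thesis .
  qed
  \<comment> \<open>The maxima clip the two intervals (s, x] and (x, T], on which z has opposite
    signs, to (t, T].\<close>
  define J where "J t \<omega> = c * ((A (max t x) \<omega> - A (max t s) \<omega>) - (A T \<omega> - A (max t x) \<omega>))" for t \<omega>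
  have wJ: "wiener t T (\<lambda>r. indicator {t<..T} r * z r) (J t)" if "t \<in> {0..T}" for t
  proof -
    have "wiener t T (\<lambda>r. c * (indicator {max t s<..max t x} r * exp (\<kappa> * r)) +
        - c * (indicator {max t x<..T} r * exp (\<kappa> * r)))
      (\<lambda>\<omega>. c * (A (max t x) \<omega> - A (max t s) \<omega>) + - c * (A T \<omega> - A (max t x) \<omega>))"
    proof (rule wiener_linear)
      show "wiener t T (\<lambda>r. indicator {max t s<..max t x} r * exp (\<kappa> * r)) (\<lambda>\<omega>. A (max t x) \<omega> - A (max t s) \<omega>)"
        using that T by (intro wiener_mono[OF A]) auto
      show "wiener t T (\<lambda>r. indicator {max t x<..T} r * exp (\<kappa> * r)) (\<lambda>\<omega>. A T \<omega> - A (max t x) \<omega>)"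
        using that T by (intro wiener_mono[OF A]) auto
    qed (use that in simp)
    also have "(\<lambda>r. c * (indicator {max t s<..max t x} r * exp (\<kappa> * r)) +
        - c * (indicator {max t x<..T} r * exp (\<kappa> * r))) = (\<lambda>r. indicator {t<..T} r * z r)"
      using that T by (auto simp: fun_eq_iff z_def indicator_def)
    also have "(\<lambda>\<omega>. c * (A (max t x) \<omega> - A (max t s) \<omega>) + - c * (A T \<omega> - A (max t x) \<omega>)) = J t"
      by (simp add: J_def[abs_def] fun_eq_iff algebra_simps)
    finally show ?thesis .
  qed
  define k where "k t \<omega> = \<xi> \<omega> + (LINT r:{0..t}|lborel. g r) + (J 0 \<omega> - J t \<omega>)" for t \<omega>
  have k_meas: "k t \<in> borel_measurable (filt t)" if t: "t \<in> {0..T}" for t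
  proof -
    have after: "(\<lambda>\<omega>. A (max t d) \<omega> - A d \<omega>) \<in> borel_measurable (filt t)" if "d \<in> {0..T}" for d
    proof (cases "t \<le> d")
      case False
      then show ?thesis
        using t that by (auto intro!: borel_measurable_diff measurable_filt_mono[OF A_meas])
    qed (simp add: max_absorb2)
    \<comment> \<open>Both \<open>J 0\<close> and \<open>J t\<close> contain the future value A(T),
      which cancels in the difference. What is left are increments from s and from x that are 0
      until t has passed these times.\<close>
    have "k t = (\<lambda>\<omega>. \<xi> \<omega> + (LINT r:{0..t}|lborel. g r) +
        c * ((A (max t s) \<omega> - A s \<omega>) - 2 * (A (max t x) \<omega> - A x \<omega>)))"
      using T by (simp add: k_def J_def fun_eq_iff max_absorb2 algebra_simps)
    also have "\<dots> \<in> borel_measurable (filt t)"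
      using T
      by (intro borel_measurable_add borel_measurable_times borel_measurable_const F0_measurable_filt[OF \<xi>(1)]
          borel_measurable_diff[OF after borel_measurable_times[OF borel_measurable_const after]]) auto
    finally show ?thesis .
  qed
  have A_max: "continuous_on {0..T} (\<lambda>t. A (max t d) \<omega>)" if "\<omega> \<in> space M" "d \<in> {0..T}" for d \<omega>
    by (rule continuous_on_compose2[OF A_cont[OF that(1)], of _ "\<lambda>t. max t d"])
      (use that in \<open>auto intro!: continuous_intros\<close>)
  have k_cont: "continuous_on {0..T} (\<lambda>t. k t \<omega>)" if "\<omega> \<in> space M" for \<omega>
    unfolding k_def J_def using T that
    by (intro continuous_intros continuous_on_set_integral g A_max) auto
  define Y where "Y t \<omega> = volterra a1 (\<lambda>r. k r \<omega>) t" for t \<omega>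
  have Y_meas: "Y t \<in> borel_measurable (filt t)" if "t \<in> {0..T}" for t
    unfolding Y_def[abs_def] by (rule measurable_filt_volterra[OF k_meas k_cont that])
  have Y_cont: "continuous_on {0..T} (\<lambda>t. Y t \<omega>)" if "\<omega> \<in> space M" for \<omega>
    unfolding Y_def by (rule continuous_on_volterra[OF k_cont[OF that]])
  have Y_0: "Y 0 = \<xi>"
    using set_integral_singleton[of 0 g] by (simp add: Y_def k_def fun_eq_iff del: atLeastAtMost_singleton)
  have Y_drift: "set_integrable lborel {0..T} (\<lambda>r. a1 * Y r \<omega> + g r)" if "\<omega> \<in> space M" for \<omega>
    by (intro set_integral_add g borel_integrable_atLeastAtMost' continuous_intros Y_cont that)
  have Y_eq: "Y t \<omega> = Y 0 \<omega> + (LINT r:{0..t}|lborel. a1 * Y r \<omega> + g r) + (J 0 \<omega> - J t \<omega>)"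
    if t: "t \<in> {0..T}" and \<omega>: "\<omega> \<in> space M" for t \<omega>
  proof -
    have sub: "{0..t} \<subseteq> {0..T}" using t by auto
    have i: "set_integrable lborel {0..t} g" "set_integrable lborel {0..t} (\<lambda>r. a1 * Y r \<omega>)"
      using set_integrable_subset[OF g _ sub] continuous_on_subset[OF Y_cont[OF \<omega>] sub]
      by (simp_all add: borel_integrable_atLeastAtMost')
    have "Y t \<omega> = k t \<omega> + a1 * (LINT r:{0..t}|lborel. Y r \<omega>)"
      unfolding Y_def by (rule volterra_eq[OF k_cont[OF \<omega>] t])
    then show ?thesis
      using set_integral_add(2)[OF i(2,1)] by (simp add: k_def Y_0)
  qed
  have law: "distr M borel (Y t) = gaussian_law (m t)
      ((exp (a1 * t))\<^sup>2 * V0 + (LINT r:{0..t}|lborel. (exp (a1 * (t - r)) * z r)\<^sup>2))" if t: "t \<in> {0..T}" for t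
  proof -
    have "distr M borel (Y t) = gaussian_law
        (exp (a1 * t) * m0 + (LINT r:{0..t}|lborel. exp (a1 * (t - r)) * g r))
        ((exp (a1 * t))\<^sup>2 * V0 + (LINT r:{0..t}|lborel. (exp (a1 * (t - r)) * z r)\<^sup>2))"
    proof (rule distr_linear_sde[OF _ _ \<open>0 \<le> V0\<close> _ _ g wJ _ t])
      show "Y 0 \<in> borel_measurable (filt 0)"
        using Y_meas[of 0] \<open>0 \<le> T\<close> by simp
      show "distr M borel (Y 0) = gaussian_law m0 V0"
        by (simp add: Y_0 \<xi>)
      show "Y t \<in> borel_measurable M" if "t \<in> {0..T}" for t
        using Y_meas[OF that] by (rule measurable_filt)
      show "AE \<omega> in M. continuous_on {0..T} (\<lambda>t. Y t \<omega>)"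
        using Y_cont by (rule AE_I2)
      show "AE \<omega> in M. Y t \<omega> = Y 0 \<omega> + (LINT r:{0..t}|lborel. a1 * Y r \<omega> + g r) + (J 0 \<omega> - J t \<omega>)"
        if "t \<in> {0..T}" for t
        using Y_eq[OF that] by (rule AE_I2)
    qed
    \<comment> \<open>m solves the same linear equation with rate a1 and forcing g, so the mean in
      the law is m; this justifies putting m for E[Y] into g.\<close>
    then show ?thesis
      using linear_integral_equation[OF m_cont g m_eq t] by simp
  qed
  have var_nonneg: "0 \<le> (exp (a1 * t))\<^sup>2 * V0 + (LINT r:{0..t}|lborel. (exp (a1 * (t - r)) * z r)\<^sup>2)" for t
    using \<open>0 \<le> V0\<close> unfolding set_lebesgue_integral_def
    by (intro add_nonneg_nonneg mult_nonneg_nonneg integral_nonneg_AE AE_I2) auto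
  have Y_int: "integrable M (Y t)" and Y_mean: "(\<integral>\<omega>. Y t \<omega> \<partial>M) = m t" if t: "t \<in> {0..T}" for t
  proof -
    note [measurable] = measurable_filt[OF Y_meas[OF t]]
    show "integrable M (Y t)"
      using integrable_gaussian_law[OF var_nonneg, of "m t" t] unfolding law[OF t, symmetric]
      by (simp add: integrable_distr_eq)
    show "(\<integral>\<omega>. Y t \<omega> \<partial>M) = m t"
      using law_mean_gaussian_law[OF var_nonneg, of "m t" t] unfolding law[OF t, symmetric] law_mean_def
      by (simp add: integral_distr)
  qed
  have drift_eq: "(LINT r:{t..T}|lborel. a1 * Y r \<omega> + a2 * (\<integral>\<omega>'. Y r \<omega>' \<partial>M) + b * z r) =
      (LINT r:{t..T}|lborel. a1 * Y r \<omega> + g r)" if "0 \<le> t" for t \<omega>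
    using that by (intro set_lebesgue_integral_cong) (auto simp: Y_mean g_def)
  have sol: "mf_solution M F0 W T a1 a2 b (distr M borel (Y T)) Y z"
    unfolding mf_solution_def
  proof (intro conjI ballI)
    show "AE \<omega> in M. continuous_on {0..T} (\<lambda>t. Y t \<omega>)"
      using Y_cont by (rule AE_I2)
    show "Y 0 \<in> borel_measurable (filt 0)"
      using Y_meas[of 0] \<open>0 \<le> T\<close> by simp
    show "distr M borel (Y 0) \<in> Gauss"
      unfolding Y_0 \<xi>(2) Gauss_def using \<open>0 \<le> V0\<close> by blast
    show "AE \<omega> in M. set_integrable lborel {0..T} (\<lambda>r. a1 * Y r \<omega> + a2 * (\<integral>\<omega>'. Y r \<omega>' \<partial>M) + b * z r)"
    proof (rule AE_I2)
      fix \<omega> assume "\<omega> \<in> space M"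
      have "indicator {0..T} r *\<^sub>R (a1 * Y r \<omega> + a2 * (\<integral>\<omega>'. Y r \<omega>' \<partial>M) + b * z r) =
          indicator {0..T} r *\<^sub>R (a1 * Y r \<omega> + g r)" for r
        by (cases "r \<in> {0..T}") (simp_all add: Y_mean g_def)
      then show "set_integrable lborel {0..T} (\<lambda>r. a1 * Y r \<omega> + a2 * (\<integral>\<omega>'. Y r \<omega>' \<partial>M) + b * z r)"
        using Y_drift[OF \<open>\<omega> \<in> space M\<close>] by (simp only: set_integrable_def)
    qed
    show "\<exists>J. is_stochastic_integral M W z t T J \<and>
        (AE \<omega> in M. Y t \<omega> = Y T \<omega>
           - (LINT r:{t..T}|lborel. a1 * Y r \<omega> + a2 * (\<integral>\<omega>'. Y r \<omega>' \<partial>M) + b * z r)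
           - J \<omega>)" if t: "t \<in> {0..T}" for t
    proof (intro exI conjI)
      show "is_stochastic_integral M W z t T (J t)"
        using t by (intro wiener_imp_is_stochastic_integral wJ) auto
      have J_T: "J T \<omega> = 0" for \<omega>
        using T by (simp add: J_def max_absorb1)
      show "AE \<omega> in M. Y t \<omega> = Y T \<omega>
           - (LINT r:{t..T}|lborel. a1 * Y r \<omega> + a2 * (\<integral>\<omega>'. Y r \<omega>' \<partial>M) + b * z r)
           - J t \<omega>"
      proof (rule AE_I2)
        fix \<omega> assume \<omega>: "\<omega> \<in> space M"
        have "T \<in> {0..T}" "0 \<le> t" "t \<le> T"
          using t by auto
        then show "Y t \<omega> = Y T \<omega>
           - (LINT r:{t..T}|lborel. a1 * Y r \<omega> + a2 * (\<integral>\<omega>'. Y r \<omega>' \<partial>M) + b * z r)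
           - J t \<omega>"
          using Y_eq[OF t \<omega>] Y_eq[OF _ \<omega>, of T] set_integral_combine[OF Y_drift[OF \<omega>], of t]
          unfolding drift_eq[OF \<open>0 \<le> t\<close>] J_T by simp
      qed
    qed
  qed (use Y_meas z_sbm z2 Y_int in auto)
  show ?thesis
    by (rule that[OF sol]) (simp add: Y_0 \<xi>)
qed

text \<open>The extremal volatility is proportional to \<open>exp ((a1 - a2) r)\<close>, the equality case of the
  Cauchy--Schwarz bound. Switching its sign at some \<open>x \<in> [s, T]\<close> keeps the variance and lets the mean
  run continuously between the two extremes.\<close>

lemma backward_reachable_superset:
  assumes rich: "rich_enough M F0" and \<mu>: "\<mu> \<in> Gauss" and s: "0 \<le> s" "s < T"
    and \<sigma>: "\<sigma> \<in> {0..exp (- 2 * a1 * (T - s)) * law_var \<mu>}"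
    and y: "y \<in> {y_min T a1 a2 b \<mu> s \<sigma>..y_max T a1 a2 b \<mu> s \<sigma>}"
  shows "gaussian_law y \<sigma> \<in> backward_reachable M F0 W T a1 a2 b \<mu> s"
proof -
  obtain m\<mu> V\<mu> where \<mu>_eq: "\<mu> = gaussian_law m\<mu> V\<mu>" and "0 \<le> V\<mu>"
    using \<mu> by (auto simp: Gauss_def)
  have \<mu>_mv: "law_mean \<mu> = m\<mu>" "law_var \<mu> = V\<mu>"
    unfolding \<mu>_eq by (simp_all add: law_mean_gaussian_law law_var_gaussian_law \<open>0 \<le> V\<mu>\<close>)
  define f where "f = f_coef a2 (T - s)"
  define \<rho> where "\<rho> = exp (- 2 * a1 * (T - s)) * V\<mu> - \<sigma>"
  define \<delta> where "\<delta> = exp (- (a1 + a2) * (T - s)) * m\<mu> - y"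
  \<comment> \<open>\<rho> is the variance to be spent on [s, T] and \<delta> the required shift of
    the mean. The amplitude c is fixed by c^2 f = \<rho>.\<close>
  define c where "c = sqrt (\<rho> / f)"
  have f: "0 < f"
    unfolding f_def using s by (intro f_coef_pos) simp
  have \<rho>: "0 \<le> \<rho>" and "0 \<le> \<sigma>"
    using \<sigma> by (simp_all add: \<rho>_def \<mu>_mv)
  have c: "0 \<le> c" "c\<^sup>2 * f = \<rho>"
    using f \<rho> by (simp_all add: c_def del: real_sqrt_divide)
  have "c * f = c * (sqrt f * sqrt f)"
    using f by simp
  also have "\<dots> = sqrt f * (c * sqrt f)"
    by simp
  also have "c * sqrt f = sqrt \<rho>"
    using f unfolding c_def by (simp add: real_sqrt_divide)
  finally have cf: "c * f = sqrt f * sqrt \<rho>" .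
  have "\<bar>\<delta>\<bar> \<le> \<bar>b\<bar> * sqrt f * sqrt \<rho>"
    using y unfolding y_min_def y_max_def \<mu>_mv \<delta>_def f_def \<rho>_def by (simp add: abs_le_iff)
  then have \<delta>: "\<bar>\<delta>\<bar> \<le> \<bar>b * c\<bar> * f"
    using c(1) by (simp add: abs_mult mult.assoc cf)
  \<comment> \<open>With the sign switched at x, the shift is b c times f(x - s) minus the remainder
    f - f(x - s). As x runs from s to T, f(x - s) runs from 0 to f, and the intermediate value
    theorem hits \<delta>. If b c = 0 then \<delta> = 0 and any x serves.\<close>
  obtain x where x: "s \<le> x" "x \<le> T" "b * c * (2 * f_coef a2 (x - s) - f) = \<delta>"
  proof (cases "b * c = 0")
    case True
    then have "\<delta> = 0"
      using \<delta> by (simp only: abs_zero mult_zero_left abs_le_zero_iff)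
    with True show ?thesis
      using s that[of s] by auto
  next
    case False
    define w where "w = (\<delta> / (b * c) + f) / 2"
    have "\<bar>\<delta> / (b * c)\<bar> \<le> f"
      using \<delta> False by (simp add: abs_divide divide_le_eq mult.commute)
    then have w: "0 \<le> w" "w \<le> f"
      unfolding abs_le_iff w_def by simp_all
    have "continuous_on {s..T} (\<lambda>r. f_coef a2 (r - s))"
      by (rule DERIV_continuous_on[OF DERIV_f_coef])
    then have "\<exists>x\<ge>s. x \<le> T \<and> f_coef a2 (x - s) = w"
      using w s by (intro IVT') (auto simp: f_def)
    then obtain x where "s \<le> x" "x \<le> T" "f_coef a2 (x - s) = w"
      by blast
    moreover have "2 * ((X + f) / 2) - f = X" for X
      by (simp add: field_simps)
    then have "2 * w - f = \<delta> / (b * c)"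
      unfolding w_def .
    then have "b * c * (2 * w - f) = \<delta>"
      using False by simp
    ultimately show ?thesis
      using that by blast
  qed
  define \<kappa> where "\<kappa> = a1 - a2"
  \<comment> \<open>The factor exp (- \<kappa> s) normalises exp (a1 (s - r)) z(r) to plus or minus
    c exp (a2 (s - r)) for r in (s, T].\<close>
  define z where "z = (\<lambda>r. (c * exp (- \<kappa> * s)) * exp (\<kappa> * r) * (indicator {s<..x} r - indicator {x<..T} r))"
  have set_int: "set_integrable lborel {p..q} (\<lambda>r. C * exp (2 * a2 * (s - r)))" for p q C
    by (intro borel_integrable_atLeastAtMost' continuous_intros)
  have Q: "(LINT r:{s..T}|lborel. exp (2 * a1 * (s - r)) * (z r)\<^sup>2) = \<rho>"
  proof -
    have "(LINT r:{s..T}|lborel. exp (2 * a1 * (s - r)) * (z r)\<^sup>2) =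
        (LINT r:{s..T}|lborel. c\<^sup>2 * exp (2 * a2 * (s - r)))"
      unfolding set_lebesgue_integral_def
    proof (rule integral_cong_AE)
      have "AE r in lborel. r \<noteq> s"
        by (rule AE_lborel_singleton)
      then show "AE r in lborel. indicator {s..T} r *\<^sub>R (exp (2 * a1 * (s - r)) * (z r)\<^sup>2) =
          indicator {s..T} r *\<^sub>R (c\<^sup>2 * exp (2 * a2 * (s - r)))"
      proof eventually_elim
        case (elim r)
        show ?case
        proof (cases "r \<in> {s..T}")
          case True
          then have "(z r)\<^sup>2 = (c * exp (- \<kappa> * s) * exp (\<kappa> * r))\<^sup>2"
            using elim x by (auto simp: z_def indicator_def power_mult_distrib)
          also have "\<dots> = c\<^sup>2 * exp (2 * \<kappa> * (r - s))"
            by (simp only: mult.assoc exp_add[symmetric] power_mult_distrib exp_double[symmetric])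
              (simp add: algebra_simps)
          finally have "exp (2 * a1 * (s - r)) * (z r)\<^sup>2 = c\<^sup>2 * exp (2 * a2 * (s - r))"
            by (simp only: mult.left_commute[of _ "c\<^sup>2"] exp_add[symmetric]) (simp add: \<kappa>_def algebra_simps)
          then show ?thesis by simp
        qed simp
      qed
    qed (unfold z_def, measurable)
    also have "\<dots> = c\<^sup>2 * f"
      using set_integral_exp_eq_f_coef[of s T a2 s] s by (simp add: f_def)
    finally show ?thesis
      by (simp add: c)
  qed
  have P: "(LINT r:{s..T}|lborel. exp ((a1 + a2) * (s - r)) * z r) = c * (2 * f_coef a2 (x - s) - f)"
  proof -
    \<comment> \<open>Closed intervals, so that the integral becomes a difference of two set
      integrals; only the values at s and x are affected.\<close>
    define h where "h r = c * exp (2 * a2 * (s - r)) * (indicator {s..x} r - indicator {x..T} r)" for r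
    have zh: "exp ((a1 + a2) * (s - r)) * z r = h r" if "r \<in> {s..T}" "r \<noteq> s" "r \<noteq> x" for r
    proof -
      have "exp ((a1 + a2) * (s - r)) * (exp (- \<kappa> * s) * exp (\<kappa> * r)) = exp (2 * a2 * (s - r))"
        by (simp only: exp_add[symmetric]) (simp add: \<kappa>_def algebra_simps)
      moreover have "indicator {s<..x} r - indicator {x<..T} r = (indicator {s..x} r - indicator {x..T} r :: real)"
        using that by (auto simp: indicator_def)
      moreover have "exp ((a1 + a2) * (s - r)) * z r =
          c * (exp ((a1 + a2) * (s - r)) * (exp (- \<kappa> * s) * exp (\<kappa> * r))) * (indicator {s<..x} r - indicator {x<..T} r)"
        by (simp add: z_def)
      ultimately show ?thesis
        by (simp only: h_def)
    qed
    have "(LINT r:{s..T}|lborel. exp ((a1 + a2) * (s - r)) * z r) =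
        (LINT r|lborel. indicator {s..x} r *\<^sub>R (c * exp (2 * a2 * (s - r))) -
          indicator {x..T} r *\<^sub>R (c * exp (2 * a2 * (s - r))))"
      unfolding set_lebesgue_integral_def
    proof (rule integral_cong_AE)
      have "AE r in lborel. r \<noteq> s" "AE r in lborel. r \<noteq> x"
        by (rule AE_lborel_singleton)+
      then show "AE r in lborel. indicator {s..T} r *\<^sub>R (exp ((a1 + a2) * (s - r)) * z r) =
          indicator {s..x} r *\<^sub>R (c * exp (2 * a2 * (s - r))) -
          indicator {x..T} r *\<^sub>R (c * exp (2 * a2 * (s - r)))"
      proof eventually_elim
        case (elim r)
        then show ?case
          using zh[of r] x by (cases "r \<in> {s..T}") (auto simp: h_def indicator_def)
      qed
    qed (unfold z_def, measurable)
    also have "\<dots> = (LINT r:{s..x}|lborel. c * exp (2 * a2 * (s - r))) -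
        (LINT r:{x..T}|lborel. c * exp (2 * a2 * (s - r)))"
      using set_int[unfolded set_integrable_def] unfolding set_lebesgue_integral_def
      by (rule Bochner_Integration.integral_diff) (rule set_int[unfolded set_integrable_def])
    also have "\<dots> = c * f_coef a2 (x - s) - c * (f - f_coef a2 (x - s))"
      using set_integral_exp_eq_f_coef[OF x(1), of a2 s] set_integral_exp_eq_f_coef[OF x(2), of a2 s]
      by (simp add: f_def)
    finally show ?thesis
      by (simp add: algebra_simps)
  qed
  have z_0: "z r = 0" if "r \<le> s" for r
    using that x by (simp add: z_def indicator_def)
  have V0: "0 \<le> exp (- (2 * a1 * s)) * \<sigma>"
    using \<open>0 \<le> \<sigma>\<close> by simp
  \<comment> \<open>Since z vanishes up to s, the mean and the variance grow there by the factors
    exp ((a1 + a2) s) and exp (2 a1 s). The initial law is (y, \<sigma>) divided by these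
    factors.\<close>
  obtain Y where sol: "mf_solution M F0 W T a1 a2 b (distr M borel (Y T)) Y z"
    and Y0: "distr M borel (Y 0) = gaussian_law (exp (- (a1 + a2) * s) * y) (exp (- (2 * a1 * s)) * \<sigma>)"
    unfolding z_def by (rule obtain_mf_solution[OF rich V0 s(1) x(1,2)])
  have law_s: "distr M borel (Y s) = gaussian_law y \<sigma>"
  proof -
    have "(LINT r:{0..s}|lborel. h r (z r)) = 0" if "\<And>r. h r 0 = 0" for h :: "real \<Rightarrow> real \<Rightarrow> real"
    proof -
      have "(LINT r:{0..s}|lborel. h r (z r)) = (LINT r:{0..s}|lborel. 0)"
        by (intro set_lebesgue_integral_cong) (auto simp: z_0 that)
      then show ?thesis
        by (simp add: set_lebesgue_integral_def)
    qed
    from this[of "\<lambda>r w. exp ((a1 + a2) * (s - r)) * (b * w)"] this[of "\<lambda>r w. exp (2 * a1 * (s - r)) * w\<^sup>2"]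
    have zero: "(LINT r:{0..s}|lborel. exp ((a1 + a2) * (s - r)) * (b * z r)) = 0"
      "(LINT r:{0..s}|lborel. exp (2 * a1 * (s - r)) * (z r)\<^sup>2) = 0"
      by simp_all
    have cancel: "exp ((a1 + a2) * s) * (exp (- (a1 + a2) * s) * y) = y"
      "exp (2 * a1 * s) * (exp (- (2 * a1 * s)) * \<sigma>) = \<sigma>"
      by (simp_all add: mult.assoc[symmetric] exp_add[symmetric] distrib_right[symmetric])
    have "0 \<le> T" "s \<in> {0..T}"
      using s by simp_all
    note law = mf_solution_law[OF sol this]
    show ?thesis
      unfolding law Y0 law_mean_gaussian_law[OF V0] law_var_gaussian_law[OF V0] zero cancel add_0_right ..
  qed
  have "distr M borel (Y T) = \<mu>"
  proof -
    obtain y' \<sigma>' where tr: "distr M borel (Y s) = gaussian_law y' \<sigma>'" "0 \<le> \<sigma>'"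
      "exp (- (a1 + a2) * (T - s)) * law_mean (distr M borel (Y T)) =
        y' + b * (LINT r:{s..T}|lborel. exp ((a1 + a2) * (s - r)) * z r)"
      "exp (- 2 * a1 * (T - s)) * law_var (distr M borel (Y T)) =
        \<sigma>' + (LINT r:{s..T}|lborel. exp (2 * a1 * (s - r)) * (z r)\<^sup>2)"
      by (rule mf_solution_transition[OF sol s(1) less_imp_le[OF s(2)]])
    \<comment> \<open>A Gaussian law determines its two parameters as mean and variance. The
      transition identities can therefore be read with y and \<sigma>, and they fix the terminal
      mean and variance.\<close>
    have "y' = y" "\<sigma>' = \<sigma>"
      using law_mean_gaussian_law[OF tr(2), of y'] law_var_gaussian_law[OF tr(2), of y']
        law_mean_gaussian_law[OF \<open>0 \<le> \<sigma>\<close>, of y] law_var_gaussian_law[OF \<open>0 \<le> \<sigma>\<close>, of y]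
        tr(1) law_s by simp_all
    then have "exp (- (a1 + a2) * (T - s)) * law_mean (distr M borel (Y T)) = exp (- (a1 + a2) * (T - s)) * m\<mu>"
      "exp (- 2 * a1 * (T - s)) * law_var (distr M borel (Y T)) = exp (- 2 * a1 * (T - s)) * V\<mu>"
      using tr(3,4) x(3) unfolding P Q by (simp_all add: \<delta>_def \<rho>_def mult.assoc)
    then have "law_mean (distr M borel (Y T)) = m\<mu>" "law_var (distr M borel (Y T)) = V\<mu>"
      by simp_all
    moreover have "0 \<le> T" using s by simp
    then obtain y'' \<sigma>'' where "distr M borel (Y T) = gaussian_law y'' \<sigma>''" "0 \<le> \<sigma>''"
      by (rule mf_solution_transition[OF sol _ order_refl])
    ultimately show ?thesis
      unfolding \<mu>_eq by (simp add: law_mean_gaussian_law law_var_gaussian_law)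
  qed
  with sol law_s show ?thesis
    unfolding backward_reachable_def by (intro CollectI exI[of _ Y] exI[of _ z]) simp
qed

end

theorem theorem5p3:
  fixes M F0 :: "'a measure" and W :: "real \<Rightarrow> 'a \<Rightarrow> real"
    and T a1 a2 b s :: real and \<mu> :: "real measure"
  assumes "0 < T"
    and "prob_space M"
    and "brownian_motion M W"
    and "subalgebra M F0"
    and "independent_of_process M F0 W"
    and "rich_enough M F0"
    and "\<mu> \<in> Gauss"
    and "0 \<le> s" and "s < T"
  shows "backward_reachable M F0 W T a1 a2 b \<mu> s =
    {gaussian_law y \<sigma> | y \<sigma>.
       \<sigma> \<in> {0..exp (- 2 * a1 * (T - s)) * law_var \<mu>} \<and>
       y \<in> {y_min T a1 a2 b \<mu> s \<sigma>..y_max T a1 a2 b \<mu> s \<sigma>}}"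
proof -
  interpret brownian_setting M F0 W
    using assms by (simp add: brownian_setting_def brownian_setting_axioms_def)
  show ?thesis
    using backward_reachable_subset[OF assms(8,9)] backward_reachable_superset[OF assms(6-9)] by blast
qed

end
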